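(* Up to $O(1)$ multiplicative factors (absolute constants), for all (possibly partial) Boolean functions $f:\mathcal{D}\subseteq\{0,1\}^n\to\{0,1\}$, $$\mathsf{QC}(f)=\mathsf{Q}^{\mathsf{cert}}(f)=\mathsf{QD}^{\mathsf{cert}}(f)=\mathsf{MM}^{\mathsf{cert}}(f)=\mathsf{QS}^{\mathsf{cert}}(f),$$ where $\mathsf{QS}$ may be any of the four variants $\mathsf{QS}_{\mathsf{weak}},\ \mathsf{QS}_{\mathsf{weak}}^{\mathsf{ind}},\ \mathsf{QS}_{\mathsf{str}},\ \mathsf{QS}_{\mathsf{str}}^{\mathsf{ind}}$ of quantum sabotage complexity.
   Context: A (possibly partial) Boolean function is a map $f:\mathcal{D}\to\{0,1\}$ with $\mathcal{D}\subseteq\{0,1\}^n$. **Certification.** For $z\in\mathcal{D}$, $f^{\mathsf{cert}}_z$ is the partial function with domain $\{z\}\cup\{y\in\mathcal{D}: f(y)\ne f(z)\}$, with $f^{\mathsf{cert}}_z(z)=1$ and $f^{\mathsf{cert}}_z(y)=0$ whenever $f(y)\neq f(z)$. For a complexity measure $\mathsf{M}$, $\mathsf{M}^{\mathsf{cert}}(f):=\max_{z\in\mathcal{D}}\mathsf{M}(f^{\mathsf{cert}}_z)$. **Measures.** Quantum query algorithms are in the standard quantum query model. - $\mathsf{Q}(f)$: minimum number of queries of a quantum query algorithm that on every $x\in\mathcal{D}$ outputs $f(x)$ with probability at least $2/3$ (and analogously for functions of strings over a larger finite alphabet, or for search problems, where a valid output must be produced with probability at least $2/3$). - $\mathsf{QC}(f)=\max_{z\in\mathcal{D}}\mathsf{QC}(f,z)$,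 where $\mathsf{QC}(f,z)$ is the minimum number of queries of a quantum query algorithm that accepts input $z$ with probability $1$ and rejects every $y\in\mathcal{D}$ with $f(y)\neq f(z)$ with probability at least $1/2$. - $\mathsf{QD}(f)$ (quantum distinguishing complexity): smallest $k$ for which there is a $k$-query quantum algorithm that on each input $x\in\mathcal{D}$ outputs a quantum state $\rho_x$ such that the trace distance between $\rho_x$ and $\rho_y$ is at least $1/6$ for all $x,y\in\mathcal{D}$ with $f(x)\ne f(y)$. - $\mathsf{MM}(f)$ (minimax adversary bound): minimum of $\max_{x\in\mathcal{D}}\sum_{i\in[n]}w_x(i)$ over weights $w_x(i)\ge 0$ such that $\sum_{i:x_i\neq y_i}\sqrt{w_x(i)w_y(i)}\ge 1$ for all $x,y\in\mathcal{D}$ with $f(x)\neq f(y)$. - Quantum sabotage complexity. For $x,y\in\{0,1\}^n$ and $b\in\{*,\dagger\}$, let $[x,y,b]\in\{0,1,b\}^n$ have $i$-th coordinate $x_i$ if $x_i=y_i$ and $b$ if $x_i\neq y_i$. Let $S_b=\{[x,y,b]:x\in f^{-1}(0),y\in f^{-1}(1)\}$. The sabotage function $f_{\mathsf{sab}}:S_*\cup S_\dagger\to\{0,1\}$ is $0$ on $S_*$ and $1$ on $S_\dagger$. $\mathsf{QS}_{\mathsf{weak}}(f)=\mathsf{Q}(f_{\mathsf{sab}})$, with query access only to the sabotaged string $[x,y,b]$ (symbols in $\{0,1,*,\dagger\}$). $\mathsf{QS}_{\mathsf{weak}}^{\mathsf{ind}}(f)$ is the bounded-error quantum query complexity, in the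 same input model, of outputting an index $i$ at which the sabotaged string has a symbol in $\{*,\dagger\}$. $\mathsf{QS}_{\mathsf{str}}(f)$ and $\mathsf{QS}_{\mathsf{str}}^{\mathsf{ind}}(f)$ are the corresponding complexities of these two tasks in the strong input model, where the algorithm has query access to $x\in f^{-1}(0)$, $y\in f^{-1}(1)$ and the sabotaged string $[x,y,b]$.
   Formalization: Where QC, Q^cert, QD^cert, MM^cert or a non-index QS^cert is bounded by an index variant of QS^cert, the latter is replaced by its maximum with 1, since it can be 0 for nonconstant f (e.g. the identity on one bit, where QC ≥ 1). *)

theory Defs
  imports Jordan_Normal_Form.Schur_Decomposition
    "HOL-Computational_Algebra.Fundamental_Theorem_Algebra"
begin

section \<open>Partial functions on strings\<close>

text \<open>
  Strings are lists over the alphabet $\{0,\dots,q-1\}$ of natural numbers, and $\{0,1\}^n$ is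
  the case $q = 2$. The sabotaged strings use $q = 4$, with 2 and 3 standing for the symbols
  $*$ and $\dagger$. A partial function is a map whose domain is \<^term>\<open>dom f\<close>.
\<close>

definition strings :: "nat \<Rightarrow> nat \<Rightarrow> nat list set" where
  "strings q n = {x. length x = n \<and> set x \<subseteq> {..<q}}"

definition partial_boolean :: "nat \<Rightarrow> (nat list \<rightharpoonup> bool) \<Rightarrow> bool" where
  "partial_boolean n f \<longleftrightarrow> dom f \<subseteq> strings 2 n"

definition cert_fun :: "(nat list \<rightharpoonup> bool) \<Rightarrow> nat list \<Rightarrow> (nat list \<rightharpoonup> bool)" where
  "cert_fun f z = (\<lambda>y. if y = z then Some True
                       else if y \<in> dom f \<and> f y \<noteq> f z then Some False else None)"

text \<open>
  All measures are nonnegative, so inserting 0 only fixes the value for the empty domain, where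
  the maximum would otherwise be meaningless. The same applies to \<open>QC\<close> below.
\<close>

definition cert :: "((nat list \<rightharpoonup> bool) \<Rightarrow> 'r::{linorder,zero}) \<Rightarrow> (nat list \<rightharpoonup> bool) \<Rightarrow> 'r" where
  "cert M f = Max (insert 0 ((\<lambda>z. M (cert_fun f z)) ` dom f))"


section \<open>Quantum query algorithms\<close>

text \<open>
  The state space has the basis $|i,b,w\rangle$ with an index register $i \in \{0,\dots,n\}$, an
  answer register $b \in \{0,\dots,q-1\}$ and a workspace $w \in \{0,\dots,m-1\}$; the triple is
  encoded as the number $(iq + b)m + w$. The oracle maps $|i,b,w\rangle$ to
  $|i, (b + x_i) \bmod q, w\rangle$ for $i < n$ (for $q = 2$ this is the usual $b \oplus x_i$) and
  fixes the basis states with $i = n$, a null query.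
\<close>

definition qdim :: "nat \<Rightarrow> nat \<Rightarrow> nat \<Rightarrow> nat" where
  "qdim q n m = (n + 1) * q * m"

definition query_basis :: "nat \<Rightarrow> nat \<Rightarrow> nat \<Rightarrow> nat list \<Rightarrow> nat \<Rightarrow> nat" where
  "query_basis q n m x j =
     (let i = j div m div q; b = j div m mod q; w = j mod m
      in if i < n then (i * q + (b + x ! i) mod q) * m + w else j)"

definition query_op :: "nat \<Rightarrow> nat \<Rightarrow> nat \<Rightarrow> nat list \<Rightarrow> complex mat" where
  "query_op q n m x = mat (qdim q n m) (qdim q n m)
     (\<lambda>(r, c). if r = query_basis q n m x c then 1 else 0)"

definition unitary_on :: "nat \<Rightarrow> complex mat \<Rightarrow> bool" where
  "unitary_on d U \<longleftrightarrow> U \<in> carrier_mat d d \<and> mat_adjoint U * U = 1\<^sub>m d"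

text \<open>A $k$-query algorithm is given by the input-independent unitaries $U_0, \dots, U_k$.\<close>

definition query_algorithm :: "nat \<Rightarrow> nat \<Rightarrow> nat \<Rightarrow> nat \<Rightarrow> (nat \<Rightarrow> complex mat) \<Rightarrow> bool" where
  "query_algorithm q n k m U \<longleftrightarrow> m > 0 \<and> (\<forall>t\<le>k. unitary_on (qdim q n m) (U t))"

primrec final_state ::
  "nat \<Rightarrow> nat \<Rightarrow> nat \<Rightarrow> (nat \<Rightarrow> complex mat) \<Rightarrow> nat list \<Rightarrow> nat \<Rightarrow> complex vec" where
  "final_state q n m U x 0 = U 0 *\<^sub>v unit_vec (qdim q n m) 0"
| "final_state q n m U x (Suc t) = U (Suc t) *\<^sub>v (query_op q n m x *\<^sub>v final_state q n m U x t)"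

text \<open>
  The final state is measured in the computational basis, and the outcome \<open>j\<close> is
  announced as the output \<open>out j\<close>. The following is the probability that the output is in \<open>V\<close>.
\<close>

definition output_prob :: "complex vec \<Rightarrow> (nat \<Rightarrow> 'o) \<Rightarrow> 'o set \<Rightarrow> real" where
  "output_prob \<psi> out V = (\<Sum>j | j < dim_vec \<psi> \<and> out j \<in> V. (cmod (\<psi> $ j))\<^sup>2)"


section \<open>Measures\<close>

text \<open>Bounded-error complexity of the search problem with inputs \<open>D\<close> and valid outputs \<open>V x\<close>.\<close>

definition Q_search :: "nat \<Rightarrow> nat \<Rightarrow> nat list set \<Rightarrow> (nat list \<Rightarrow> 'o set) \<Rightarrow> nat" where
  "Q_search q n D V = (LEAST k. \<exists>m U (out :: nat \<Rightarrow> 'o). query_algorithm q n k m U \<and>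
     (\<forall>x\<in>D. output_prob (final_state q n m U x k) out (V x) \<ge> 2/3))"

definition Q :: "nat \<Rightarrow> nat \<Rightarrow> (nat list \<rightharpoonup> bool) \<Rightarrow> nat" where
  "Q q n f = Q_search q n (dom f) (\<lambda>x. {the (f x)})"

definition QC_at :: "nat \<Rightarrow> (nat list \<rightharpoonup> bool) \<Rightarrow> nat list \<Rightarrow> nat" where
  "QC_at n f z = (LEAST k. \<exists>m U (acc :: nat \<Rightarrow> bool). query_algorithm 2 n k m U \<and>
     output_prob (final_state 2 n m U z k) acc {True} = 1 \<and>
     (\<forall>y\<in>dom f. f y \<noteq> f z \<longrightarrow> output_prob (final_state 2 n m U y k) acc {False} \<ge> 1/2))"

definition QC :: "nat \<Rightarrow> (nat list \<rightharpoonup> bool) \<Rightarrow> nat" where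
  "QC n f = Max (insert 0 (QC_at n f ` dom f))"

text \<open>
  The trace norm is the sum of the singular values, with multiplicity: the eigenvalues of
  $A^\dagger A$ are nonnegative reals, so \<open>Re\<close> only changes their type.
\<close>

definition trace_norm :: "complex mat \<Rightarrow> real" where
  "trace_norm A = (\<Sum>\<mu>\<in>#proots (char_poly (mat_adjoint A * A)). sqrt (Re \<mu>))"

definition trace_distance :: "complex mat \<Rightarrow> complex mat \<Rightarrow> real" where
  "trace_distance \<rho> \<sigma> = trace_norm (\<rho> - \<sigma>) / 2"

text \<open>
  The density matrix of the first register when \<open>\<psi>\<close> lives on $\mathbb{C}^a \otimes \mathbb{C}^c$
  and the second register is traced out.
\<close>

definition reduced_state :: "nat \<Rightarrow> nat \<Rightarrow> complex vec \<Rightarrow> complex mat" where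
  "reduced_state a c \<psi> = mat a a (\<lambda>(i, j). \<Sum>s<c. \<psi> $ (i * c + s) * cnj (\<psi> $ (j * c + s)))"

definition QD :: "nat \<Rightarrow> (nat list \<rightharpoonup> bool) \<Rightarrow> nat" where
  "QD n f = (LEAST k. \<exists>m U a c. query_algorithm 2 n k m U \<and> a * c = qdim 2 n m \<and>
     (\<forall>x\<in>dom f. \<forall>y\<in>dom f. f x \<noteq> f y \<longrightarrow>
        trace_distance (reduced_state a c (final_state 2 n m U x k))
                       (reduced_state a c (final_state 2 n m U y k)) \<ge> 1/6))"

definition MM_feasible :: "nat \<Rightarrow> (nat list \<rightharpoonup> bool) \<Rightarrow> (nat list \<Rightarrow> nat \<Rightarrow> real) \<Rightarrow> bool" where
  "MM_feasible n f w \<longleftrightarrow> (\<forall>x\<in>dom f. \<forall>i<n. w x i \<ge> 0) \<and>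
     (\<forall>x\<in>dom f. \<forall>y\<in>dom f. f x \<noteq> f y \<longrightarrow>
        (\<Sum>i | i < n \<and> x ! i \<noteq> y ! i. sqrt (w x i * w y i)) \<ge> 1)"

definition MM :: "nat \<Rightarrow> (nat list \<rightharpoonup> bool) \<Rightarrow> real" where
  "MM n f = Inf {Max ((\<lambda>x. \<Sum>i<n. w x i) ` dom f) | w. MM_feasible n f w}"


section \<open>Quantum sabotage complexity\<close>

abbreviation (input) star :: nat where "star \<equiv> 2"
abbreviation (input) dagger :: nat where "dagger \<equiv> 3"

definition sab_string :: "nat list \<Rightarrow> nat list \<Rightarrow> nat \<Rightarrow> nat list" where
  "sab_string x y b = map2 (\<lambda>u v. if u = v then u else b) x y"

text \<open>
  In the strong model the oracle answers queries to $x$, to $y$ and to the sabotaged string, so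
  the input is their concatenation, of length $3n$.
\<close>

definition sab_weak :: "(nat list \<rightharpoonup> bool) \<Rightarrow> nat \<Rightarrow> nat list set" where
  "sab_weak f b = {sab_string x y b | x y. f x = Some False \<and> f y = Some True}"

definition sab_str :: "(nat list \<rightharpoonup> bool) \<Rightarrow> nat \<Rightarrow> nat list set" where
  "sab_str f b = {x @ y @ sab_string x y b | x y. f x = Some False \<and> f y = Some True}"

definition sab_fun :: "(nat \<Rightarrow> nat list set) \<Rightarrow> (nat list \<rightharpoonup> bool)" where
  "sab_fun S = (\<lambda>s. if s \<in> S star then Some False else if s \<in> S dagger then Some True else None)"

definition QS_weak :: "nat \<Rightarrow> (nat list \<rightharpoonup> bool) \<Rightarrow> nat" where
  "QS_weak n f = Q 4 n (sab_fun (sab_weak f))"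

definition QS_str :: "nat \<Rightarrow> (nat list \<rightharpoonup> bool) \<Rightarrow> nat" where
  "QS_str n f = Q 4 (3 * n) (sab_fun (sab_str f))"

definition QS_weak_ind :: "nat \<Rightarrow> (nat list \<rightharpoonup> bool) \<Rightarrow> nat" where
  "QS_weak_ind n f = Q_search 4 n (sab_weak f star \<union> sab_weak f dagger)
     (\<lambda>s. {i. i < n \<and> s ! i \<in> {star, dagger}})"

definition QS_str_ind :: "nat \<Rightarrow> (nat list \<rightharpoonup> bool) \<Rightarrow> nat" where
  "QS_str_ind n f = Q_search 4 (3 * n) (sab_str f star \<union> sab_str f dagger)
     (\<lambda>s. {i. i < n \<and> s ! (2 * n + i) \<in> {star, dagger}})"

text \<open>
  The index variants can vanish although \<open>f\<close> is not constant, because a fixed index may be valid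
  for all inputs, while every other measure is positive for nonconstant \<open>f\<close>. Hence a bound in terms of an index variant \<open>b\<close> has to be read as a bound in terms of \<open>max 1 b\<close>. The
  identity function on one bit is an example, in both input models.
\<close>

lemma Q_search_eq_0:
  assumes "q > 0" and "\<And>x. x \<in> D \<Longrightarrow> c \<in> V x"
  shows "Q_search q n D V = 0"
proof -
  let ?d = "qdim q n 1" and ?U = "\<lambda>_. 1\<^sub>m (qdim q n 1)"
  have d: "?d > 0" using assms(1) by (simp add: qdim_def)
  have adj: "mat_adjoint (1\<^sub>m ?d :: complex mat) = 1\<^sub>m ?d"
    by (rule eq_matI) (auto simp: mat_adjoint_def mat_of_rows_def cols_def)
  have alg: "query_algorithm q n 0 1 ?U"
    using adj by (simp add: query_algorithm_def unitary_on_def del: One_nat_def)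
  have prob: "output_prob (final_state q n 1 ?U x 0) (\<lambda>_. c) (V x) = 1" if "x \<in> D" for x
  proof -
    have "output_prob (final_state q n 1 ?U x 0) (\<lambda>_. c) (V x)
        = (\<Sum>j<?d. if j = 0 then 1 else 0)"
      using assms(2)[OF that] d unfolding output_prob_def
      by (intro sum.cong) (auto simp: unit_vec_def)
    also have "\<dots> = 1" using d by (simp add: sum.delta)
    finally show ?thesis .
  qed
  have "\<exists>m U (out :: nat \<Rightarrow> 'a). query_algorithm q n 0 m U \<and>
     (\<forall>x\<in>D. output_prob (final_state q n m U x 0) out (V x) \<ge> 2/3)"
    using alg prob by (intro exI[of _ 1] exI[of _ ?U] exI[of _ "\<lambda>_. c"]) auto
  then show ?thesis unfolding Q_search_def by (rule Least_eq_0)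
qed

lemma QS_ind_identity_bit:
  defines "f \<equiv> [[0] \<mapsto> False, [1] \<mapsto> True]"
  shows "cert (QS_weak_ind 1) f = 0" and "cert (QS_str_ind 1) f = 0"
proof -
  have sab: "(\<exists>x\<in>{[0], [1]}. \<exists>y\<in>{[0], [1]}. x \<noteq> y \<and> s = x @ y @ sab_string x y b)"
    if "s \<in> sab_str (cert_fun f z) b" "z \<in> dom f" for s z b
    using that by (auto simp: sab_str_def cert_fun_def f_def split: if_splits)
  have sab': "(\<exists>x\<in>{[0], [1]}. \<exists>y\<in>{[0], [1]}. x \<noteq> y \<and> s = sab_string x y b)"
    if "s \<in> sab_weak (cert_fun f z) b" "z \<in> dom f" for s z b
    using that by (auto simp: sab_weak_def cert_fun_def f_def split: if_splits)
  have "QS_weak_ind 1 (cert_fun f z) = 0" "QS_str_ind 1 (cert_fun f z) = 0"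
    if z: "z \<in> dom f" for z
    unfolding QS_weak_ind_def QS_str_ind_def
    by (rule Q_search_eq_0[where c = 0]; use sab[OF _ z] sab'[OF _ z] in
        \<open>fastforce simp: sab_string_def\<close>)+
  then show "cert (QS_weak_ind 1) f = 0" and "cert (QS_str_ind 1) f = 0"
    by (auto simp: cert_def f_def)
qed

lemma no_zero_query_certificate:
  assumes y: "y \<in> dom f" "f y \<noteq> f z"
  shows "\<not> (\<exists>m U acc. query_algorithm 2 n 0 m U \<and>
     output_prob (final_state 2 n m U z 0) acc {True} = 1 \<and>
     (\<forall>y\<in>dom f. f y \<noteq> f z \<longrightarrow> output_prob (final_state 2 n m U y 0) acc {False} \<ge> 1/2))"
proof (rule notI, elim exE conjE)
  fix m U acc
  assume alg: "query_algorithm 2 n 0 m U"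
    and 1: "output_prob (final_state 2 n m U z 0) acc {True} = 1"
    and 2: "\<forall>y\<in>dom f. f y \<noteq> f z \<longrightarrow> output_prob (final_state 2 n m U y 0) acc {False} \<ge> 1/2"
  define d where "d = qdim 2 n m"
  define \<psi> where "\<psi> = final_state 2 n m U z 0"
  have d: "d > 0" and U: "U 0 \<in> carrier_mat d d" "mat_adjoint (U 0) * U 0 = 1\<^sub>m d"
    using alg by (auto simp: query_algorithm_def unitary_on_def d_def qdim_def)
  have \<psi>: "\<psi> = col (U 0) 0"
    using U d by (auto simp: \<psi>_def d_def[symmetric] intro!: eq_vecI)
  have "complex_of_real (\<Sum>j<d. (cmod (\<psi> $ j))\<^sup>2) = (\<Sum>j<d. cnj (\<psi> $ j) * \<psi> $ j)"
    unfolding of_real_sum complex_norm_square by (simp add: mult.commute)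
  also have "\<dots> = (mat_adjoint (U 0) * U 0) $$ (0, 0)"
    using U(1) d by (simp add: mat_adjoint_def scalar_prod_def \<psi> atLeast0LessThan)
  also have "\<dots> = 1" using U(2) d by simp
  finally have norm: "(\<Sum>j<d. (cmod (\<psi> $ j))\<^sup>2) = 1"
    using of_real_eq_1_iff by blast
  have dim: "dim_vec \<psi> = d" using U(1) by (simp add: \<psi>)
  have "output_prob \<psi> acc {True} + output_prob \<psi> acc {False} = (\<Sum>j<d. (cmod (\<psi> $ j))\<^sup>2)"
    unfolding output_prob_def dim
    by (subst sum.union_disjoint[symmetric]) (auto intro!: sum.cong)
  moreover have "output_prob \<psi> acc {False} \<ge> 1/2"
    using 2[rule_format, OF y] by (simp add: \<psi>_def)
  ultimately show False using 1 norm by (simp add: \<psi>_def)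
qed

end

theory Submission
  imports Defs "HOL-Analysis.L2_Norm"
begin

text \<open>
  For an input \<open>z\<close> let \<open>\<rho>\<close> be the square root of its fractional certificate complexity, the least
  total of weights \<open>v i \<ge> 0\<close> such that every \<open>y\<close> with \<open>f y \<noteq> f z\<close> differs from \<open>z\<close> on weight at
  least 1. All measures of the certification problem at \<open>z\<close> are within constant factors of \<open>\<rho>\<close>.

  Upper bounds: amplitude amplification on the distribution proportional to \<open>v\<close> finds with
  \<open>O(\<rho>)\<close> queries a position where the input differs from \<open>z\<close>, and never reports a false one.

  Lower bounds: by the hybrid argument a \<open>k\<close>-query algorithm that tells apart \<open>z\<close> and \<open>y\<close> must,
  when run on \<open>z\<close>, query the positions where they differ with total weight at least a constant
  divided by \<open>k\<close>. Rescaling the query weights of the run on \<open>z\<close> gives a fractional certificate of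
  total \<open>O(k\<^sup>2)\<close>. In the sabotage problems the reference input is \<open>z\<close> (weak model) or \<open>z @ z @ z\<close>
  (strong model), which is itself not an instance of the problem but differs from the instances
  exactly where it should.
\<close>

section \<open>Unitaries and distances\<close>

text \<open>The answer register keeps the queried symbol, so the label of every outcome of nonzero
  amplitude is correct; this gives acceptance with probability exactly 1 in \<open>QC\<close> and
  lets one search solve both the decision and the index form of sabotage.

  The lower bounds only use that the final states on an instance and on the reference are 1/12
  apart. The weakest case, deciding sabotage, sets this number. The index variants fit less
  smoothly, since a valid answer on an instance may be likely on the reference too. There the output
  distribution of the reference run contributes a certificate of constant total, and this additive
  constant is the origin of \<open>max 1\<close>. Comparing the two index variants with each other
  then needs a separate argument that they vanish together.

  For \<open>MM\<close> the agreement with \<open>\<rho>\<close> is exact.\<close>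

definition isometry_on :: "nat \<Rightarrow> (nat \<Rightarrow> nat \<Rightarrow> complex) \<Rightarrow> bool" where
  "isometry_on d M \<longleftrightarrow>
     (\<forall>i<d. \<forall>j<d. (\<Sum>l<d. cnj (M l i) * M l j) = (if i = j then 1 else 0))"

lemma unitary_on_iff:
  "unitary_on d U \<longleftrightarrow> U \<in> carrier_mat d d \<and> isometry_on d (\<lambda>i j. U $$ (i, j))"
proof (cases "U \<in> carrier_mat d d")
  case True
  have entry: "(mat_adjoint U * U) $$ (i, j) = (\<Sum>l<d. cnj (U $$ (l, i)) * U $$ (l, j))"
    if "i < d" "j < d" for i j
    using True that by (simp add: mat_adjoint_def scalar_prod_def atLeast0LessThan)
  have dims: "dim_row (mat_adjoint U * U) = d" "dim_col (mat_adjoint U * U) = d"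
    using True by (auto simp: mat_adjoint_def)
  show ?thesis
  proof
    assume "unitary_on d U"
    then show "U \<in> carrier_mat d d \<and> isometry_on d (\<lambda>i j. U $$ (i, j))"
      unfolding isometry_on_def unitary_on_def using entry True by auto
  next
    assume "U \<in> carrier_mat d d \<and> isometry_on d (\<lambda>i j. U $$ (i, j))"
    then have "mat_adjoint U * U = 1\<^sub>m d"
      unfolding isometry_on_def using entry dims by (intro eq_matI) auto
    then show "unitary_on d U" using True by (simp add: unitary_on_def)
  qed
qed (simp add: unitary_on_def)

text \<open>Expanding the squared moduli and summing over \<open>j\<close> first leaves the Gram
  matrix of the columns of \<open>M\<close>, which is the identity.\<close>

lemma isometry_on_norm:
  assumes "isometry_on d M"
  shows "(\<Sum>j<d. (cmod (\<Sum>l<d. M j l * f l))\<^sup>2) = (\<Sum>l<d. (cmod (f l))\<^sup>2)"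
proof -
  have "complex_of_real (\<Sum>j<d. (cmod (\<Sum>l<d. M j l * f l))\<^sup>2)
      = (\<Sum>j<d. \<Sum>a<d. \<Sum>b<d. cnj (f a) * f b * (cnj (M j a) * M j b))"
    unfolding of_real_sum complex_norm_square
    by (simp add: sum_distrib_left sum_distrib_right mult_ac)
  also have "\<dots> = (\<Sum>a<d. \<Sum>b<d. cnj (f a) * f b * (\<Sum>j<d. cnj (M j a) * M j b))"
    unfolding sum_distrib_left by (subst sum.swap, rule sum.cong[OF refl], rule sum.swap)
  also have "\<dots> = (\<Sum>a<d. \<Sum>b<d. if a = b then cnj (f a) * f b else 0)"
    using assms unfolding isometry_on_def by (intro sum.cong refl) auto
  also have "\<dots> = (\<Sum>a<d. cnj (f a) * f a)" by (simp add: sum.delta)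
  also have "\<dots> = complex_of_real (\<Sum>l<d. (cmod (f l))\<^sup>2)"
    unfolding of_real_sum complex_norm_square by (simp add: mult.commute)
  finally show ?thesis using of_real_eq_iff by blast
qed

definition vnorm :: "nat \<Rightarrow> (nat \<Rightarrow> complex) \<Rightarrow> real" where
  "vnorm d f = L2_set (\<lambda>j. cmod (f j)) {..<d}"

lemma vnorm_isometry: "isometry_on d M \<Longrightarrow> vnorm d (\<lambda>j. \<Sum>l<d. M j l * f l) = vnorm d f"
  unfolding vnorm_def L2_set_def by (simp only: isometry_on_norm)

lemma vnorm_triangle: "vnorm d (\<lambda>j. f j + g j) \<le> vnorm d f + vnorm d g"
  unfolding vnorm_def
  by (rule order_trans[OF L2_set_mono L2_set_triangle_ineq]) (auto intro: norm_triangle_ineq)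

lemma vnorm_minus: "vnorm d (\<lambda>j. - f j) = vnorm d f"
  by (simp add: vnorm_def)

lemma vnorm_diff: "vnorm d (\<lambda>j. f j - g j) \<le> vnorm d f + vnorm d g"
  using vnorm_triangle[of d f "\<lambda>j. - g j"] by (simp add: vnorm_minus)

lemma vnorm_cong: "(\<And>j. j < d \<Longrightarrow> f j = g j) \<Longrightarrow> vnorm d f = vnorm d g"
  unfolding vnorm_def L2_set_def by simp

lemma vnorm_nonneg: "0 \<le> vnorm d f"
  by (simp add: vnorm_def)

lemma vnorm_square: "(vnorm d f)\<^sup>2 = (\<Sum>j<d. (cmod (f j))\<^sup>2)"
  unfolding vnorm_def L2_set_def by (simp add: sum_nonneg)

section \<open>The query operator\<close>

lemma triple_index:
  fixes i b w :: nat
  assumes "b < q" "w < m"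
  shows "((i * q + b) * m + w) div m div q = i" "((i * q + b) * m + w) div m mod q = b"
    "((i * q + b) * m + w) mod m = w"
  using assms by auto

lemma triple_index_less: "i \<le> n \<Longrightarrow> b < q \<Longrightarrow> w < m \<Longrightarrow> (i * q + b) * m + w < qdim q n m"
proof -
  assume *: "i \<le> n" "b < q" "w < m"
  have "(i * q + b) * m + w < (i * q + b + 1) * m" using * by (simp add: algebra_simps)
  also have "\<dots> \<le> ((i + 1) * q) * m" using * by (intro mult_right_mono) (auto simp: algebra_simps)
  also have "\<dots> \<le> ((n + 1) * q) * m" using * by (intro mult_right_mono) auto
  finally show ?thesis by (simp add: qdim_def)
qed

lemma triple_index_eq: "j = (j div m div q * q + j div m mod q) * m + j mod m" for j m q :: nat
  by simp

lemma triple_index_bounds: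
  assumes "j < qdim q n m"
  shows "j div m div q \<le> n" "j div m mod q < q" "j mod m < m"
proof -
  have pos: "q > 0" "m > 0" using assms by (auto simp: qdim_def intro!: Nat.gr0I)
  have "j div m < (n + 1) * q" using assms pos by (simp add: qdim_def less_mult_imp_div_less)
  then have "j div m div q < n + 1" using pos less_mult_imp_div_less by blast
  then show "j div m div q \<le> n" "j div m mod q < q" "j mod m < m" using pos by auto
qed

lemma query_basis_triple:
  assumes "b < q" "w < m"
  shows "query_basis q n m x ((i * q + b) * m + w)
       = (i * q + (if i < n then (b + x ! i) mod q else b)) * m + w"
  using triple_index[OF assms, of i] by (simp add: query_basis_def Let_def)

lemma query_basis_less:
  assumes "j < qdim q n m" shows "query_basis q n m x j < qdim q n m"
proof -
  note b = triple_index_bounds[OF assms]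
  show ?thesis
    by (subst (1) triple_index_eq[of j m q], subst query_basis_triple[OF b(2,3)])
      (use b in \<open>auto intro!: triple_index_less\<close>)
qed

lemma inj_on_query_basis: "inj_on (query_basis q n m x) {..<qdim q n m}"
proof (rule inj_onI)
  fix j j' assume j: "j \<in> {..<qdim q n m}" "j' \<in> {..<qdim q n m}"
    and eq: "query_basis q n m x j = query_basis q n m x j'"
  define i b w where "i = j div m div q" "b = j div m mod q" "w = j mod m"
  define i' b' w' where "i' = j' div m div q" "b' = j' div m mod q" "w' = j' mod m"
  note d = i_b_w_def i'_b'_w'_def
  have jeq: "j = (i * q + b) * m + w" "j' = (i' * q + b') * m + w'" unfolding d by simp_all
  have bd: "b < q" "w < m" "b' < q" "w' < m"
    using triple_index_bounds j unfolding d by auto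
  define c where "c = (if i < n then (b + x ! i) mod q else b)"
  define c' where "c' = (if i' < n then (b' + x ! i') mod q else b')"
  have cq: "c < q" "c' < q" using bd by (auto simp: c_def c'_def)
  have e: "(i * q + c) * m + w = (i' * q + c') * m + w'"
    using eq unfolding jeq query_basis_triple[OF bd(1,2)] query_basis_triple[OF bd(3,4)]
      c_def c'_def .
  have "i = i'" "c = c'" "w = w'"
    using triple_index[OF cq(1) bd(2), of i] triple_index[OF cq(2) bd(4), of i']
    unfolding e by auto
  moreover have "b = b'"
  proof (cases "i < n")
    case True
    then have "(b + x ! i) mod q = (b' + x ! i) mod q"
      using \<open>c = c'\<close> \<open>i = i'\<close> by (simp add: c_def c'_def)
    then have "(int b + int (x ! i)) mod int q = (int b' + int (x ! i)) mod int q"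
      by (metis of_nat_add of_nat_mod)
    then have "int b mod int q = int b' mod int q" by (simp add: mod_eq_dvd_iff)
    then show ?thesis using bd by (simp flip: of_nat_mod)
  qed (use \<open>c = c'\<close> \<open>i = i'\<close> in \<open>simp add: c_def c'_def\<close>)
  ultimately show "j = j'" unfolding jeq by simp
qed

lemma isometry_on_permutation:
  assumes "inj_on p {..<d}" "p ` {..<d} \<subseteq> {..<d}"
  shows "isometry_on d (\<lambda>i j. if i = p j then 1 else 0)"
  unfolding isometry_on_def
proof (intro allI impI)
  fix i j assume ij: "i < d" "j < d"
  have "(\<Sum>l<d. cnj (if l = p i then 1 else 0) * (if l = p j then 1 else 0) :: complex)
      = (\<Sum>l<d. if l = p i then (if p i = p j then 1 else 0) else 0)"
    by (intro sum.cong) auto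
  also have "\<dots> = (if p i = p j then 1 else 0)" using assms(2) ij by (subst sum.delta) auto
  also have "\<dots> = (if i = j then 1 else 0)" using assms(1) ij by (auto dest: inj_onD)
  finally show "(\<Sum>l<d. cnj (if l = p i then 1 else 0) * (if l = p j then 1 else 0))
      = (if i = j then 1 else 0 :: complex)" .
qed

lemma isometry_on_query:
  "isometry_on (qdim q n m) (\<lambda>i j. if i = query_basis q n m x j then 1 else 0)"
  by (rule isometry_on_permutation) (auto simp: inj_on_query_basis query_basis_less)

lemma query_op_mult_vec:
  assumes "dim_vec v = qdim q n m" "j < qdim q n m"
  shows "(query_op q n m x *\<^sub>v v) $ j
       = (\<Sum>c<qdim q n m. (if j = query_basis q n m x c then 1 else 0) * v $ c)"
  using assms by (simp add: query_op_def scalar_prod_def atLeast0LessThan)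

lemma dim_query_op [simp]: "dim_row (query_op q n m x) = qdim q n m"
  by (simp add: query_op_def)

lemma mat_mult_vec_index:
  assumes "U \<in> carrier_mat d d" "dim_vec v = d" "j < d"
  shows "(U *\<^sub>v v) $ j = (\<Sum>c<d. U $$ (j, c) * v $ c)"
  using assms by (simp add: scalar_prod_def atLeast0LessThan)

lemma vnorm_mat_mult:
  assumes "unitary_on d U" "dim_vec v = d"
  shows "vnorm d (\<lambda>j. (U *\<^sub>v v) $ j) = vnorm d (\<lambda>j. v $ j)"
proof -
  have "vnorm d (\<lambda>j. (U *\<^sub>v v) $ j) = vnorm d (\<lambda>j. \<Sum>c<d. U $$ (j, c) * v $ c)"
    by (rule vnorm_cong, rule mat_mult_vec_index) (use assms in \<open>auto simp: unitary_on_def\<close>)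
  also have "\<dots> = vnorm d (\<lambda>j. v $ j)"
    by (rule vnorm_isometry) (use assms in \<open>simp add: unitary_on_iff\<close>)
  finally show ?thesis .
qed

lemma unitary_on_query: "unitary_on (qdim q n m) (query_op q n m x)"
proof -
  have "isometry_on (qdim q n m) (\<lambda>i j. query_op q n m x $$ (i, j))"
    using isometry_on_query[of q n m x] by (simp add: isometry_on_def query_op_def)
  then show ?thesis by (simp add: unitary_on_iff query_op_def)
qed

lemma dim_final_state:
  assumes "query_algorithm q n k m U" "t \<le> k"
  shows "dim_vec (final_state q n m U x t) = qdim q n m"
  using assms by (cases t) (auto simp: query_algorithm_def unitary_on_def)

lemma norm_final_state:
  assumes "query_algorithm q n k m U" "t \<le> k" "q > 0"
  shows "vnorm (qdim q n m) (\<lambda>j. final_state q n m U x t $ j) = 1"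
  using assms(2)
proof (induction t)
  case 0
  let ?d = "qdim q n m"
  have d: "?d > 0" using assms by (auto simp: query_algorithm_def qdim_def)
  have "vnorm ?d (\<lambda>j. final_state q n m U x 0 $ j) = vnorm ?d (\<lambda>j. unit_vec ?d 0 $ j)"
    unfolding final_state.simps
    by (rule vnorm_mat_mult) (use assms in \<open>auto simp: query_algorithm_def\<close>)
  also have "\<dots> = vnorm ?d (\<lambda>j. if j = 0 then 1 else 0)"
    by (intro vnorm_cong) auto
  also have "\<dots> = 1"
  proof -
    have "(\<Sum>j<?d. (cmod (if j = 0 then 1 else 0))\<^sup>2) = (\<Sum>j<?d. if j = 0 then 1 else 0)"
      by (intro sum.cong) auto
    also have "\<dots> = 1" using d by (simp add: sum.delta)
    finally show ?thesis by (simp add: vnorm_def L2_set_def)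
  qed
  finally show ?case .
next
  case (Suc t)
  let ?d = "qdim q n m"
  let ?v = "final_state q n m U x t"
  have "vnorm ?d (\<lambda>j. final_state q n m U x (Suc t) $ j)
      = vnorm ?d (\<lambda>j. (query_op q n m x *\<^sub>v ?v) $ j)"
    unfolding final_state.simps
    by (rule vnorm_mat_mult) (use assms Suc.prems in \<open>auto simp: query_algorithm_def\<close>)
  also have "\<dots> = vnorm ?d (\<lambda>j. ?v $ j)"
    by (rule vnorm_mat_mult[OF unitary_on_query]) (use dim_final_state[OF assms(1)] Suc.prems in simp)
  also have "\<dots> = 1" using Suc by simp
  finally show ?case .
qed

section \<open>The hybrid argument\<close>

definition vdist :: "complex vec \<Rightarrow> complex vec \<Rightarrow> real" where
  "vdist v w = vnorm (dim_vec v) (\<lambda>j. v $ j - w $ j)"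

lemma vdist_mat_mult:
  assumes "unitary_on d U" "dim_vec v = d" "dim_vec w = d"
  shows "vdist (U *\<^sub>v v) (U *\<^sub>v w) = vdist v w"
proof -
  have U: "U \<in> carrier_mat d d" using assms by (simp add: unitary_on_def)
  have "vdist (U *\<^sub>v v) (U *\<^sub>v w) = vnorm d (\<lambda>j. (U *\<^sub>v v) $ j - (U *\<^sub>v w) $ j)"
    using U by (simp add: vdist_def)
  also have "\<dots> = vnorm d (\<lambda>j. \<Sum>c<d. U $$ (j, c) * (v $ c - w $ c))"
    unfolding right_diff_distrib sum_subtractf
    by (rule vnorm_cong) (simp only: mat_mult_vec_index[OF U] assms(2,3))
  also have "\<dots> = vdist v w"
    unfolding vdist_def assms(2)
    by (rule vnorm_isometry) (use assms in \<open>simp add: unitary_on_iff\<close>)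
  finally show ?thesis .
qed

lemma vdist_triangle:
  assumes "dim_vec u = d" "dim_vec v = d"
  shows "vdist u w \<le> vdist u v + vdist v w"
  using vnorm_triangle[of d "\<lambda>j. u $ j - v $ j" "\<lambda>j. v $ j - w $ j"] assms
  by (simp add: vdist_def)

lemma vdist_commute: "dim_vec u = dim_vec v \<Longrightarrow> vdist u v = vdist v u"
  using vnorm_minus[of "dim_vec u" "\<lambda>j. u $ j - v $ j"] by (simp add: vdist_def)

text \<open>The two oracles agree on basis states whose index register lies outside
  \<open>D\<close>, so only the part of \<open>v\<close> inside \<open>D\<close> survives in the
  difference. Both oracles preserve its norm, and the triangle inequality costs the factor
  2.\<close>

lemma query_diff_le:
  assumes d_def: "d = qdim q n m"
    and D: "{i. i < n \<and> y ! i \<noteq> z ! i} \<subseteq> D" and dv: "dim_vec v = d"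
  shows "vnorm d (\<lambda>j. (query_op q n m y *\<^sub>v v) $ j - (query_op q n m z *\<^sub>v v) $ j)
       \<le> 2 * sqrt (\<Sum>j | j < d \<and> j div m div q \<in> D. (cmod (v $ j))\<^sup>2)"
proof -
  let ?M = "\<lambda>x j c. if j = query_basis q n m x c then 1 else 0 :: complex"
  let ?v = "\<lambda>c. if c div m div q \<in> D then v $ c else 0"
  have "query_basis q n m y c = query_basis q n m z c"
    if "c div m div q \<notin> D" for c
    using D that by (auto simp: query_basis_def Let_def)
  then have "?M y j c * v $ c - ?M z j c * v $ c = ?M y j c * ?v c - ?M z j c * ?v c" for j c
    by simp
  then have "vnorm d (\<lambda>j. (query_op q n m y *\<^sub>v v) $ j - (query_op q n m z *\<^sub>v v) $ j)
      = vnorm d (\<lambda>j. (\<Sum>c<d. ?M y j c * ?v c) - (\<Sum>c<d. ?M z j c * ?v c))"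
    using dv unfolding d_def
    by (intro vnorm_cong) (simp only: query_op_mult_vec sum_subtractf[symmetric])
  also have "\<dots> \<le> vnorm d (\<lambda>j. \<Sum>c<d. ?M y j c * ?v c) + vnorm d (\<lambda>j. \<Sum>c<d. ?M z j c * ?v c)"
    by (rule vnorm_diff)
  also have "\<dots> = 2 * vnorm d ?v"
    unfolding d_def by (subst (1 2) vnorm_isometry[OF isometry_on_query]) simp
  also have "vnorm d ?v = sqrt (\<Sum>j<d. if j div m div q \<in> D then (cmod (v $ j))\<^sup>2 else 0)"
    unfolding vnorm_def L2_set_def by (intro arg_cong[of _ _ sqrt] sum.cong) auto
  also have "(\<Sum>j<d. if j div m div q \<in> D then (cmod (v $ j))\<^sup>2 else 0)
      = (\<Sum>j | j < d \<and> j div m div q \<in> D. (cmod (v $ j))\<^sup>2)"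
    by (subst sum.inter_filter[symmetric]) (auto intro!: sum.cong)
  finally show ?thesis .
qed

text \<open>The hybrid \<open>query_op q n m y *\<^sub>v v\<close>, with \<open>v\<close> the state
  of the run on \<open>z\<close>, is put between the two new states. One half preserves the old
  distance, the other is bounded by \<open>query_diff_le\<close>, and only amplitudes of the run on
  \<open>z\<close> enter.\<close>

lemma final_state_dist_le:
  assumes alg: "query_algorithm q n k m U"
    and D: "{i. i < n \<and> y ! i \<noteq> z ! i} \<subseteq> D" and "t \<le> k"
  shows "vdist (final_state q n m U y t) (final_state q n m U z t)
       \<le> (\<Sum>s<t. 2 * sqrt (\<Sum>j | j < qdim q n m \<and> j div m div q \<in> D.
                              (cmod (final_state q n m U z s $ j))\<^sup>2))"
  using \<open>t \<le> k\<close>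
proof (induction t)
  case 0
  show ?case by (simp add: vdist_def vnorm_def L2_set_def)
next
  case (Suc t)
  let ?d = "qdim q n m"
  let ?O = "query_op q n m"
  define u where "u = final_state q n m U y t"
  define v where "v = final_state q n m U z t"
  have dims: "dim_vec u = ?d" "dim_vec v = ?d"
    using dim_final_state[OF alg] Suc.prems by (auto simp: u_def v_def)
  have "vdist (final_state q n m U y (Suc t)) (final_state q n m U z (Suc t))
      = vdist (?O y *\<^sub>v u) (?O z *\<^sub>v v)"
    unfolding final_state.simps u_def v_def
    by (rule vdist_mat_mult) (use alg Suc.prems in \<open>auto simp: query_algorithm_def\<close>)
  also have "\<dots> \<le> vdist (?O y *\<^sub>v u) (?O y *\<^sub>v v) + vdist (?O y *\<^sub>v v) (?O z *\<^sub>v v)"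
    by (rule vdist_triangle) auto
  also have "vdist (?O y *\<^sub>v u) (?O y *\<^sub>v v) = vdist u v"
    by (rule vdist_mat_mult[OF unitary_on_query dims])
  also have "vdist (?O y *\<^sub>v v) (?O z *\<^sub>v v)
      \<le> 2 * sqrt (\<Sum>j | j < ?d \<and> j div m div q \<in> D. (cmod (v $ j))\<^sup>2)"
    using query_diff_le[OF refl D dims(2)] by (simp add: vdist_def)
  also have "vdist u v \<le> (\<Sum>s<t. 2 * sqrt (\<Sum>j | j < ?d \<and> j div m div q \<in> D.
                              (cmod (final_state q n m U z s $ j))\<^sup>2))"
    using Suc by (simp add: u_def v_def)
  finally show ?case by (simp add: v_def)
qed

text \<open>\<open>u i\<close> is the probability mass with which the run on \<open>z\<close> has
  \<open>i\<close> in its index register, summed over the \<open>k\<close> queries; each query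
  contributes at most 1, null queries being left out. The weights come from the run on
  \<open>z\<close> alone, hence serve every \<open>y\<close> simultaneously, which is what turns
  them into a certificate after rescaling.\<close>

lemma query_weights:
  assumes alg: "query_algorithm q n k m U" and q: "q > 0"
  obtains u :: "nat \<Rightarrow> real" where "\<And>i. u i \<ge> 0" "(\<Sum>i<n. u i) \<le> real k"
    "\<And>y. vdist (final_state q n m U y k) (final_state q n m U z k)
           \<le> 2 * sqrt (real k * (\<Sum>i | i < n \<and> y ! i \<noteq> z ! i. u i))"
proof -
  let ?d = "qdim q n m"
  let ?p = "\<lambda>s j. (cmod (final_state q n m U z s $ j))\<^sup>2"
  let ?J = "\<lambda>i. {j. j < ?d \<and> j div m div q = i}"
  define u where "u = (\<lambda>i. \<Sum>s<k. \<Sum>j\<in>?J i. ?p s j)"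
  have pos: "u i \<ge> 0" for i unfolding u_def by (intro sum_nonneg) auto
  have swap: "(\<Sum>i\<in>I. u i) = (\<Sum>s<k. \<Sum>j | j < ?d \<and> j div m div q \<in> I. ?p s j)"
    if "finite I" for I
  proof -
    have "(\<Sum>i\<in>I. u i) = (\<Sum>s<k. \<Sum>i\<in>I. \<Sum>j\<in>?J i. ?p s j)"
      unfolding u_def by (rule sum.swap)
    also have "\<dots> = (\<Sum>s<k. \<Sum>j | j < ?d \<and> j div m div q \<in> I. ?p s j)"
    proof (rule sum.cong[OF refl])
      fix s
      have "(\<Sum>i\<in>I. \<Sum>j\<in>?J i. ?p s j) = sum (?p s) (\<Union>i\<in>I. ?J i)"
        using that by (subst sum.UNION_disjoint) auto
      also have "(\<Union>i\<in>I. ?J i) = {j. j < ?d \<and> j div m div q \<in> I}" by auto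
      finally show "(\<Sum>i\<in>I. \<Sum>j\<in>?J i. ?p s j)
          = (\<Sum>j | j < ?d \<and> j div m div q \<in> I. ?p s j)" .
    qed
    finally show ?thesis .
  qed
  have "(\<Sum>i<n. u i) = (\<Sum>s<k. \<Sum>j | j < ?d \<and> j div m div q \<in> {..<n}. ?p s j)"
    by (rule swap) simp
  also have "\<dots> \<le> (\<Sum>s<k. \<Sum>j<?d. ?p s j)"
    by (intro sum_mono sum_mono2) auto
  also have "\<dots> = (\<Sum>s<k. 1)"
    using norm_final_state[OF alg _ q, THEN arg_cong[where f = "\<lambda>r. r\<^sup>2"], of _ z]
    by (intro sum.cong refl) (simp add: vnorm_square)
  finally have total: "(\<Sum>i<n. u i) \<le> real k" by simp
  have dist: "vdist (final_state q n m U y k) (final_state q n m U z k)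
       \<le> 2 * sqrt (real k * (\<Sum>i | i < n \<and> y ! i \<noteq> z ! i. u i))" for y
  proof -
  let ?D = "{i. i < n \<and> y ! i \<noteq> z ! i}"
  let ?a = "\<lambda>s. \<Sum>j | j < ?d \<and> j div m div q \<in> ?D. ?p s j"
  have "vdist (final_state q n m U y k) (final_state q n m U z k) \<le> (\<Sum>s<k. 2 * sqrt (?a s))"
    by (rule final_state_dist_le[OF alg]) auto
  \<comment> \<open>Cauchy-Schwarz against the constant 1 turns the sum of \<open>k\<close> square
    roots into one square root with the factor \<open>k\<close>; the absolute values fit
    \<open>L2_set_mult_ineq\<close>.\<close>
  also have "\<dots> = 2 * (\<Sum>s<k. \<bar>1\<bar> * \<bar>sqrt (?a s)\<bar>)"
    by (simp add: sum_distrib_left sum_nonneg)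
  also have "\<dots> \<le> 2 * (L2_set (\<lambda>s. 1) {..<k} * L2_set (\<lambda>s. sqrt (?a s)) {..<k})"
    by (intro mult_left_mono L2_set_mult_ineq) auto
  also have "\<dots> = 2 * sqrt (real k * (\<Sum>i\<in>?D. u i))"
    by (subst swap) (simp_all add: L2_set_def sum_nonneg real_sqrt_mult)
  finally show ?thesis .
  qed
  show ?thesis by (rule that[OF pos total dist])
qed

lemma output_prob_eq_L2:
  "output_prob v out V = (L2_set (\<lambda>j. cmod (v $ j)) {j. j < dim_vec v \<and> out j \<in> V})\<^sup>2"
  unfolding output_prob_def L2_set_def by (simp add: sum_nonneg)

lemma output_prob_nonneg: "0 \<le> output_prob v out V"
  unfolding output_prob_def by (simp add: sum_nonneg)

lemma output_prob_le_norm: "output_prob v out V \<le> (vnorm (dim_vec v) (\<lambda>j. v $ j))\<^sup>2"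
  unfolding vnorm_square output_prob_def by (rule sum_mono2) auto

lemma output_prob_Compl:
  "output_prob v out V + output_prob v out (- V) = (vnorm (dim_vec v) (\<lambda>j. v $ j))\<^sup>2"
  unfolding vnorm_square output_prob_def
  by (subst sum.union_disjoint[symmetric]) (auto intro!: sum.cong)

text \<open>Both probabilities are squares of norms \<open>a\<close>, \<open>b\<close> of projected
  vectors. In the factorization \<open>(a - b) * (a + b)\<close> the first factor is at most the
  distance and the second at most 2.\<close>

lemma output_prob_diff_le:
  assumes "dim_vec v = d" "dim_vec w = d"
    and "vnorm d (\<lambda>j. v $ j) = 1" "vnorm d (\<lambda>j. w $ j) = 1"
  shows "output_prob v out V - output_prob w out V \<le> 2 * vdist v w"
proof -
  let ?J = "{j. j < d \<and> out j \<in> V}"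
  let ?a = "L2_set (\<lambda>j. cmod (v $ j)) ?J" and ?b = "L2_set (\<lambda>j. cmod (w $ j)) ?J"
  have "?a \<le> L2_set (\<lambda>j. cmod (w $ j) + cmod (v $ j - w $ j)) ?J"
    by (rule L2_set_mono) (use norm_triangle_sub in auto)
  also have "\<dots> \<le> ?b + L2_set (\<lambda>j. cmod (v $ j - w $ j)) ?J" by (rule L2_set_triangle_ineq)
  also have "L2_set (\<lambda>j. cmod (v $ j - w $ j)) ?J \<le> vdist v w"
    unfolding vdist_def vnorm_def assms L2_set_def by (intro real_sqrt_le_mono sum_mono2) auto
  finally have ab: "?a \<le> ?b + vdist v w" by simp
  have le1: "?a \<le> 1" "?b \<le> 1"
    using assms output_prob_le_norm[of v out V] output_prob_le_norm[of w out V]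
    by (simp_all add: output_prob_eq_L2 abs_square_le_1)
  have pos: "0 \<le> ?a" "0 \<le> ?b" "0 \<le> vdist v w" by (auto simp: vdist_def vnorm_nonneg)
  have "output_prob v out V - output_prob w out V = (?a - ?b) * (?a + ?b)"
    unfolding output_prob_eq_L2 assms by (simp add: power2_eq_square algebra_simps)
  also have "\<dots> \<le> vdist v w * (?a + ?b)" using ab pos by (intro mult_right_mono) auto
  also have "\<dots> \<le> vdist v w * 2" using le1 pos by (intro mult_left_mono) auto
  finally show ?thesis by simp
qed

section \<open>Spectral theorem and trace norm\<close>

lemma mat_adjoint_carrier [simp]: "A \<in> carrier_mat m n \<Longrightarrow> mat_adjoint A \<in> carrier_mat n m"
  by (auto simp: mat_adjoint_def)

lemma mat_adjoint_index:
  fixes A :: "complex mat"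
  assumes "A \<in> carrier_mat m n" "i < n" "j < m"
  shows "mat_adjoint A $$ (i, j) = cnj (A $$ (j, i))"
  using assms by (simp add: mat_adjoint_def mat_of_rows_index)

lemma mat_adjoint_adjoint:
  fixes A :: "complex mat"
  assumes "A \<in> carrier_mat m n" shows "mat_adjoint (mat_adjoint A) = A"
proof (rule eq_matI)
  fix i j assume "i < dim_row A" "j < dim_col A"
  then have ij: "i < m" "j < n" using assms by auto
  show "mat_adjoint (mat_adjoint A) $$ (i, j) = A $$ (i, j)"
    using mat_adjoint_index[OF mat_adjoint_carrier[OF assms] ij]
      mat_adjoint_index[OF assms ij(2,1)] by simp
qed (use carrier_matD[OF mat_adjoint_carrier[OF mat_adjoint_carrier[OF assms]]]
      carrier_matD[OF assms] in auto)

lemma mat_adjoint_hermitian: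
  fixes A :: "complex mat"
  assumes "A \<in> carrier_mat n n" "\<And>i j. i < n \<Longrightarrow> j < n \<Longrightarrow> A $$ (i, j) = cnj (A $$ (j, i))"
  shows "mat_adjoint A = A"
proof (rule eq_matI)
  fix i j assume "i < dim_row A" "j < dim_col A"
  then have ij: "i < n" "j < n" using assms(1) by auto
  show "mat_adjoint A $$ (i, j) = A $$ (i, j)"
    unfolding mat_adjoint_index[OF assms(1) ij] by (rule assms(2)[OF ij, symmetric])
qed (use assms(1) in \<open>auto simp: mat_adjoint_def\<close>)

lemma mat_mult_index:
  assumes "A \<in> carrier_mat m n" "B \<in> carrier_mat n p" "i < m" "j < p"
  shows "(A * B) $$ (i, j) = (\<Sum>l<n. A $$ (i, l) * B $$ (l, j))"
  using assms by (simp add: scalar_prod_def atLeast0LessThan)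

lemma mat_adjoint_mult:
  fixes A B :: "complex mat"
  assumes "A \<in> carrier_mat m n" "B \<in> carrier_mat n p"
  shows "mat_adjoint (A * B) = mat_adjoint B * mat_adjoint A"
proof -
  have AB: "A * B \<in> carrier_mat m p" using assms by simp
  show ?thesis
  proof (rule eq_matI)
    fix i j assume "i < dim_row (mat_adjoint B * mat_adjoint A)"
      "j < dim_col (mat_adjoint B * mat_adjoint A)"
    then have ij: "i < p" "j < m" using assms by (auto simp: mat_adjoint_def)
    show "mat_adjoint (A * B) $$ (i, j) = (mat_adjoint B * mat_adjoint A) $$ (i, j)"
      unfolding mat_adjoint_index[OF AB ij] mat_mult_index[OF assms ij(2,1)]
        mat_mult_index[OF mat_adjoint_carrier[OF assms(2)] mat_adjoint_carrier[OF assms(1)] ij]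
      using assms ij by (simp add: mat_adjoint_index mult.commute)
  qed (use assms in \<open>auto simp: mat_adjoint_def\<close>)
qed

lemma unitary_on_right_inverse:
  assumes "unitary_on n U" shows "U * mat_adjoint U = 1\<^sub>m n"
  using assms unfolding unitary_on_def
  by (intro mat_mult_left_right_inverse[of "mat_adjoint U" n U]) auto

lemma unitary_on_mult:
  assumes "unitary_on n U" "unitary_on n V" shows "unitary_on n (U * V)"
proof -
  have c: "U \<in> carrier_mat n n" "V \<in> carrier_mat n n"
    "mat_adjoint U \<in> carrier_mat n n" "mat_adjoint V \<in> carrier_mat n n"
    using assms by (auto simp: unitary_on_def)
  have "mat_adjoint (U * V) * (U * V) = mat_adjoint V * (mat_adjoint U * U * V)"
    using c by (simp add: mat_adjoint_mult[OF c(1,2)] assoc_mult_mat[of _ n n _ n _ n])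
  also have "\<dots> = 1\<^sub>m n" using assms c by (simp add: unitary_on_def)
  finally show ?thesis using c by (simp add: unitary_on_def)
qed

text \<open>A left inverse of a square matrix is also a right inverse, so orthonormal columns force
  orthonormal rows.\<close>

lemma isometry_on_rows:
  assumes "isometry_on d M" "i < d" "j < d"
  shows "(\<Sum>l<d. M i l * cnj (M j l)) = (if i = j then 1 else 0)"
proof -
  let ?U = "mat d d (\<lambda>(i, j). M i j)"
  have U: "?U \<in> carrier_mat d d" by simp
  have "isometry_on d (\<lambda>i j. ?U $$ (i, j))"
    using assms(1) by (auto simp: isometry_on_def)
  then have "unitary_on d ?U" using U by (simp add: unitary_on_iff)
  then have "(?U * mat_adjoint ?U) $$ (i, j) = (if i = j then 1 else 0)"
    using assms by (simp add: unitary_on_right_inverse)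
  then show ?thesis
    unfolding mat_mult_index[OF U mat_adjoint_carrier[OF U] assms(2,3)]
    using assms by (simp add: mat_adjoint_index[OF U])
qed

text \<open>
  A Householder reflection: the phase \<open>c\<close> makes the first entry of \<open>c v\<close> a nonpositive real,
  so that the denominator \<open>1 + |v 0|\<close> does not vanish.
\<close>

lemma isometry_completion:
  fixes v :: "nat \<Rightarrow> complex"
  assumes v: "(\<Sum>l<d. (cmod (v l))\<^sup>2) = 1"
  obtains M where "isometry_on d M" "\<And>i. i < d \<Longrightarrow> M i 0 = v i"
proof -
  have d: "0 < d" using v by (cases d) auto
  define c where "c = (if v 0 = 0 then 1 else - cnj (v 0) / cmod (v 0))"
  define r where "r = cmod (v 0)"
  define s where "s = complex_of_real (1 + r)"
  have s0: "s \<noteq> 0" unfolding s_def r_def by (smt (verit) norm_ge_zero of_real_eq_0_iff)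
  have cc: "cnj c * c = 1"
  proof (cases "v 0 = 0")
    case False
    have "cnj c * c = (v 0 * cnj (v 0)) / (of_real (cmod (v 0)))\<^sup>2"
      using False by (simp add: c_def power2_eq_square)
    also have "\<dots> = 1" using False complex_norm_square[of "v 0", symmetric] by simp
    finally show ?thesis .
  qed (simp add: c_def)
  have c0: "c * v 0 = - of_real r"
    unfolding r_def c_def using complex_norm_square[of "v 0"]
    by (auto simp: field_simps power2_eq_square)
  define w where "w l = (if l = 0 then 1 else 0) - c * v l" for l
  define H where "H i j = (if i = j then 1 else 0) - w i * cnj (w j) / s" for i j
  have w0: "w 0 = s" by (simp add: w_def c0 s_def)
  have cs: "cnj s = s" by (simp add: s_def)
  have "(\<Sum>l<d. cnj (w l) * w l)
      = (\<Sum>l<d. (if l = 0 then 1 - c * v 0 - cnj (c * v 0) else 0) + cnj c * c * (cnj (v l) * v l))"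
    by (intro sum.cong) (auto simp: w_def algebra_simps)
  also have "\<dots> = (1 + 2 * of_real r) + (\<Sum>l<d. cnj (v l) * v l)"
    using d by (simp add: sum.distrib cc c0 sum.delta del: complex_cnj_mult)
  also have "(\<Sum>l<d. cnj (v l) * v l) = of_real (\<Sum>l<d. (cmod (v l))\<^sup>2)"
    unfolding of_real_sum complex_norm_square by (simp add: mult.commute)
  \<comment> \<open>The squared norm of \<open>w\<close> is \<open>2 * s\<close>, so the division by
    \<open>s\<close> in \<open>H\<close> is the usual factor two over the squared norm of a
    reflection.\<close>
  finally have ww: "(\<Sum>l<d. cnj (w l) * w l) = 2 * s" using v by (simp add: s_def)
  have H: "isometry_on d H"
    unfolding isometry_on_def
  proof (intro allI impI)
    fix i j assume ij: "i < d" "j < d"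
    have "(\<Sum>l<d. cnj (H l i) * H l j)
        = (\<Sum>l<d. (if l = i then (if i = j then 1 else 0) - w i * cnj (w j) / s else 0)
                 - (if l = j then w i * cnj (w j) / s else 0)
                 + (w i * cnj (w j) / s\<^sup>2) * (cnj (w l) * w l))"
      by (intro sum.cong) (auto simp: H_def cs algebra_simps power2_eq_square)
    also have "\<dots> = (if i = j then 1 else 0) - w i * cnj (w j) / s - w i * cnj (w j) / s
                   + (w i * cnj (w j) / s\<^sup>2) * (2 * s)"
      using ij unfolding sum.distrib sum_subtractf sum_distrib_left[symmetric] ww
      by (simp add: sum.delta)
    also have "\<dots> = (if i = j then 1 else 0)" using s0 by (simp add: power2_eq_square field_simps)
    finally show "(\<Sum>l<d. cnj (H l i) * H l j) = (if i = j then 1 else 0)" .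
  qed
  \<comment> \<open>\<open>H\<close> sends the first basis vector to \<open>c\<close> times
    \<open>v\<close>; the factor \<open>cnj c\<close> removes the phase.\<close>
  have "isometry_on d (\<lambda>i j. cnj c * H i j)"
  proof -
    have "cnj (cnj c * H l i) * (cnj c * H l j) = (cnj c * c) * (cnj (H l i) * H l j)" for l i j
      by (simp add: mult_ac)
    then show ?thesis using H unfolding isometry_on_def by (simp only: cc mult_1_left)
  qed
  moreover have "cnj c * H i 0 = v i" for i
  proof -
    have "H i 0 = (if i = 0 then 1 else 0) - w i" using s0 by (simp add: H_def w0 cs)
    then have "cnj c * H i 0 = (cnj c * c) * v i" by (simp add: w_def)
    then show ?thesis by (simp add: cc)
  qed
  ultimately show ?thesis using that[of "\<lambda>i j. cnj c * H i j"] by blast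
qed

section \<open>Diagonalization of Hermitian matrices and their trace norm\<close>

definition real_diag :: "nat \<Rightarrow> (nat \<Rightarrow> real) \<Rightarrow> complex mat" where
  "real_diag n e = mat n n (\<lambda>(i, j). if i = j then of_real (e i) else 0)"

lemma real_diag_carrier [simp]: "real_diag n e \<in> carrier_mat n n"
  by (simp add: real_diag_def)

lemma mult_real_diag_index:
  assumes "A \<in> carrier_mat n n" "i < n" "j < n"
  shows "(A * real_diag n e) $$ (i, j) = A $$ (i, j) * of_real (e j)"
proof -
  have "(A * real_diag n e) $$ (i, j) = (\<Sum>l<n. if l = j then A $$ (i, j) * of_real (e j) else 0)"
    unfolding mat_mult_index[OF assms(1) real_diag_carrier assms(2,3)]
    using assms by (intro sum.cong) (auto simp: real_diag_def)
  then show ?thesis using assms by (simp add: sum.delta)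
qed

text \<open>The characteristic polynomial has degree \<open>n > 0\<close>, hence a complex root; an
  eigenvector for it is divided by its norm.\<close>

lemma unit_eigenvector:
  fixes A :: "complex mat"
  assumes A: "A \<in> carrier_mat n n" and "n > 0"
  obtains v \<kappa> where "(\<Sum>l<n. (cmod (v l))\<^sup>2) = 1"
    "\<And>i. i < n \<Longrightarrow> (\<Sum>j<n. A $$ (i, j) * v j) = \<kappa> * v i"
proof -
  have "degree (char_poly A) = n" using degree_monic_char_poly[OF A] by simp
  then have "\<not> constant (poly (char_poly A))" using \<open>n > 0\<close> by (simp add: constant_degree)
  then obtain \<kappa> where "poly (char_poly A) \<kappa> = 0" using fundamental_theorem_of_algebra by blast
  then obtain x where x: "x \<in> carrier_vec n" "x \<noteq> 0\<^sub>v n" "A *\<^sub>v x = \<kappa> \<cdot>\<^sub>v x"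
    using eigenvalue_root_char_poly[OF A] A by (auto simp: eigenvalue_def eigenvector_def)
  define r where "r = vnorm n (\<lambda>j. x $ j)"
  have "\<exists>l<n. x $ l \<noteq> 0" using x by (auto simp: vec_eq_iff)
  then have "0 < (\<Sum>l<n. (cmod (x $ l))\<^sup>2)"
    by (metis (mono_tags, lifting) finite_lessThan lessThan_iff norm_eq_zero sum_pos2
        zero_le_power2 zero_less_power2)
  then have r: "r > 0" unfolding r_def vnorm_def L2_set_def by simp
  define v where "v l = x $ l / of_real r" for l
  have "(\<Sum>l<n. (cmod (v l))\<^sup>2) = (\<Sum>l<n. (cmod (x $ l))\<^sup>2) / r\<^sup>2"
    using r by (simp add: v_def norm_divide power_divide sum_divide_distrib)
  also have "\<dots> = 1" using r by (simp add: vnorm_square[symmetric] r_def)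
  finally have "(\<Sum>l<n. (cmod (v l))\<^sup>2) = 1" .
  moreover have "(\<Sum>j<n. A $$ (i, j) * v j) = \<kappa> * v i" if "i < n" for i
  proof -
    have "(\<Sum>j<n. A $$ (i, j) * v j) = (A *\<^sub>v x) $ i / of_real r"
      using x(1) that by (subst mat_mult_vec_index[OF A]) (auto simp: v_def sum_divide_distrib)
    then show ?thesis using x that by (simp add: v_def)
  qed
  ultimately show ?thesis by (rule that)
qed

text \<open>Deflation: a unit eigenvector is completed to a unitary \<open>M\<close>, and
  conjugation by \<open>M\<close> makes the first column a multiple of the first basis vector. The
  result is Hermitian again, so the rest of the first row vanishes as well and the remaining block
  falls under the induction hypothesis.\<close>

lemma hermitian_diagonalization:
  fixes A :: "complex mat"
  assumes "A \<in> carrier_mat n n" "\<And>i j. i < n \<Longrightarrow> j < n \<Longrightarrow> A $$ (i, j) = cnj (A $$ (j, i))"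
  shows "\<exists>U e. unitary_on n U \<and> A * U = U * real_diag n e"
  using assms
proof (induction n arbitrary: A)
  case 0
  then show ?case
    by (intro exI[of _ "1\<^sub>m 0"] exI[of _ "\<lambda>_. 0"])
      (auto simp: unitary_on_def mat_adjoint_def real_diag_def intro!: eq_matI)
next
  case (Suc n)
  let ?N = "Suc n"
  note A = Suc.prems(1)
  obtain v \<kappa> where v: "(\<Sum>l<?N. (cmod (v l))\<^sup>2) = 1"
    and ev: "\<And>i. i < ?N \<Longrightarrow> (\<Sum>j<?N. A $$ (i, j) * v j) = \<kappa> * v i"
    using unit_eigenvector[OF A] by blast
  obtain M0 where M0: "isometry_on ?N M0" "\<And>i. i < ?N \<Longrightarrow> M0 i 0 = v i"
    using isometry_completion[OF v] by blast
  define M where "M = mat ?N ?N (\<lambda>(i, j). M0 i j)"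
  have Mc: "M \<in> carrier_mat ?N ?N" by (simp add: M_def)
  have Mi: "isometry_on ?N (\<lambda>i j. M $$ (i, j))" using M0(1) by (auto simp: isometry_on_def M_def)
  then have Mu: "unitary_on ?N M" using Mc by (simp add: unitary_on_iff)
  define B where "B = mat_adjoint M * A * M"
  have Bc: "B \<in> carrier_mat ?N ?N" 
    unfolding B_def by (intro mult_carrier_mat[of _ ?N ?N] mat_adjoint_carrier A Mc)
  have adjA: "mat_adjoint A = A" by (rule mat_adjoint_hermitian[OF Suc.prems])
  have adjB: "mat_adjoint B = B"
  proof -
    have c: "mat_adjoint M \<in> carrier_mat ?N ?N" using Mc by simp
    show ?thesis
      unfolding B_def using c A Mc mat_adjoint_adjoint[OF Mc]
      by (simp add: mat_adjoint_mult[of _ ?N ?N _ ?N] adjA assoc_mult_mat[of _ ?N ?N _ ?N _ ?N])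
  qed
  have Bherm: "B $$ (i, j) = cnj (B $$ (j, i))" if "i < ?N" "j < ?N" for i j
    using mat_adjoint_index[OF Bc that] by (simp add: adjB)
  have B0: "B $$ (i, 0) = (if i = 0 then \<kappa> else 0)" if "i < ?N" for i
  proof -
    have "B $$ (i, 0) = (\<Sum>a<?N. mat_adjoint M $$ (i, a) * (A * M) $$ (a, 0))"
      unfolding B_def using A Mc that
      by (simp only: assoc_mult_mat[of _ ?N ?N _ ?N _ ?N] mat_adjoint_carrier)
        (subst mat_mult_index[of _ ?N ?N _ ?N], auto)
    also have "\<dots> = (\<Sum>a<?N. cnj (M $$ (a, i)) * (\<kappa> * M $$ (a, 0)))"
    proof (intro sum.cong refl)
      fix a assume "a \<in> {..<?N}"
      then have a: "a < ?N" by simp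
      have "(A * M) $$ (a, 0) = (\<Sum>j<?N. A $$ (a, j) * v j)"
        by (subst mat_mult_index[OF A Mc]) (use a M0(2) in \<open>auto simp: M_def intro!: sum.cong\<close>)
      also have "\<dots> = \<kappa> * M $$ (a, 0)" using M0(2)[OF a] ev[OF a] a by (simp add: M_def del: sum.lessThan_Suc)
      finally show "mat_adjoint M $$ (i, a) * (A * M) $$ (a, 0)
          = cnj (M $$ (a, i)) * (\<kappa> * M $$ (a, 0))"
        using a that by (simp add: mat_adjoint_index[OF Mc])
    qed
    also have "\<dots> = \<kappa> * (\<Sum>a<?N. cnj (M $$ (a, i)) * M $$ (a, 0))"
      by (simp add: sum_distrib_left mult_ac del: sum.lessThan_Suc)
    also have "\<dots> = (if i = 0 then \<kappa> else 0)"
      using Mi that by (simp add: isometry_on_def del: sum.lessThan_Suc)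
    finally show ?thesis .
  qed
  \<comment> \<open>A diagonal entry of a Hermitian matrix is real, so the eigenvalue fits the real
    entries of \<open>real_diag\<close>.\<close>
  have "cnj \<kappa> = \<kappa>" using Bherm[of 0 0] B0[of 0] by simp
  then have \<kappa>: "\<kappa> = of_real (Re \<kappa>)" by (metis Reals_cnj_iff of_real_Re)
  define B' where "B' = mat n n (\<lambda>(i, j). B $$ (Suc i, Suc j))"
  have B': "B' \<in> carrier_mat n n" by (simp add: B'_def)
  have "\<exists>U e. unitary_on n U \<and> B' * U = U * real_diag n e"
  proof (rule Suc.IH[OF B'])
    fix i j assume "i < n" "j < n"
    then show "B' $$ (i, j) = cnj (B' $$ (j, i))"
      using Bherm[of "Suc i" "Suc j"] by (simp add: B'_def)
  qed
  then obtain U' e' where U': "unitary_on n U'" "B' * U' = U' * real_diag n e'" by blast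
  have U'c: "U' \<in> carrier_mat n n" and U'i: "isometry_on n (\<lambda>i j. U' $$ (i, j))"
    using U' by (auto simp: unitary_on_iff)
  define W where "W = mat ?N ?N (\<lambda>(i, j). if i = 0 \<or> j = 0 then (if i = j then 1 else 0)
                                         else U' $$ (i - 1, j - 1))"
  define e where "e k = (case k of 0 \<Rightarrow> Re \<kappa> | Suc k \<Rightarrow> e' k)" for k
  have Wc: "W \<in> carrier_mat ?N ?N" by (simp add: W_def)
  have W_simps: "W $$ (0, 0) = 1" "\<And>j. j < n \<Longrightarrow> W $$ (0, Suc j) = 0"
    "\<And>j. j < n \<Longrightarrow> W $$ (Suc j, 0) = 0"
    "\<And>i j. i < n \<Longrightarrow> j < n \<Longrightarrow> W $$ (Suc i, Suc j) = U' $$ (i, j)"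
    by (auto simp: W_def)
  have "isometry_on ?N (\<lambda>i j. W $$ (i, j))"
    unfolding isometry_on_def
  proof (intro allI impI)
    fix i j assume "i < ?N" "j < ?N"
    then show "(\<Sum>l<?N. cnj (W $$ (l, i)) * W $$ (l, j)) = (if i = j then 1 else 0)"
      using U'i unfolding sum.lessThan_Suc_shift isometry_on_def
      by (cases i; cases j) (auto simp: W_simps cong: sum.cong_simp)
  qed
  then have Wu: "unitary_on ?N W" using Wc by (simp add: unitary_on_iff)
  have BW: "B * W = W * real_diag ?N e"
  proof (rule eq_matI)
    fix i j assume "i < dim_row (W * real_diag ?N e)" "j < dim_col (W * real_diag ?N e)"
    then have ij: "i < ?N" "j < ?N" using Wc by (auto simp: real_diag_def)
    have 0: "B $$ (0, Suc l) = 0" if "l < n" for l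
      using Bherm[of 0 "Suc l"] B0[of "Suc l"] that by simp
    have IH: "(\<Sum>l<n. B $$ (Suc i, Suc l) * U' $$ (l, j)) = U' $$ (i, j) * of_real (e' j)"
      if "i < n" "j < n" for i j
    proof -
      have "(\<Sum>l<n. B $$ (Suc i, Suc l) * U' $$ (l, j)) = (B' * U') $$ (i, j)"
        unfolding mat_mult_index[OF B' U'c that] using that by (simp add: B'_def)
      then show ?thesis using U'c that by (simp only: U'(2) mult_real_diag_index)
    qed
    have e0: "complex_of_real (e 0) = \<kappa>" unfolding e_def nat.case by (rule \<kappa>[symmetric])
    have eq: "B $$ (i, 0) * W $$ (0, j) + (\<Sum>l<n. B $$ (i, Suc l) * W $$ (Suc l, j))
        = W $$ (i, j) * of_real (e j)"
    proof (cases i)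
      case i: 0
      have "(\<Sum>l<n. B $$ (i, Suc l) * W $$ (Suc l, j)) = 0"
        by (rule sum.neutral) (simp add: 0 i)
      then show ?thesis using i ij by (cases j) (simp_all add: B0 W_simps e0)
    next
      case i: (Suc i')
      show ?thesis
      proof (cases j)
        case 0
        have "(\<Sum>l<n. B $$ (i, Suc l) * W $$ (Suc l, j)) = 0"
          by (rule sum.neutral) (simp add: W_simps 0)
        then show ?thesis using i 0 ij by (simp add: B0 W_simps)
      next
        case j: (Suc j')
        have "(\<Sum>l<n. B $$ (i, Suc l) * W $$ (Suc l, j)) = (\<Sum>l<n. B $$ (Suc i', Suc l) * U' $$ (l, j'))"
          by (rule sum.cong[OF refl]) (use i j ij in \<open>simp add: W_simps\<close>)
        also have "\<dots> = U' $$ (i', j') * of_real (e' j')" by (rule IH) (use i j ij in auto)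
        finally show ?thesis using i j ij by (simp add: B0 W_simps e_def)
      qed
    qed
    show "(B * W) $$ (i, j) = (W * real_diag ?N e) $$ (i, j)"
      unfolding mat_mult_index[OF Bc Wc ij] mult_real_diag_index[OF Wc ij] sum.lessThan_Suc_shift
      by (rule eq)
  qed (use Bc Wc in \<open>auto simp: real_diag_def\<close>)
  have AM: "A * M = M * B"
  proof -
    have c: "mat_adjoint M \<in> carrier_mat ?N ?N" using Mc by simp
    have "M * B = (M * mat_adjoint M) * (A * M)"
      unfolding B_def using c A Mc by (simp add: assoc_mult_mat[of _ ?N ?N _ ?N _ ?N])
    then show ?thesis using A Mc by (simp add: unitary_on_right_inverse[OF Mu])
  qed
  have "A * (M * W) = A * M * W" by (rule assoc_mult_mat[OF A Mc Wc, symmetric])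
  also have "\<dots> = M * (B * W)" unfolding AM by (rule assoc_mult_mat[OF Mc Bc Wc])
  also have "\<dots> = M * W * real_diag ?N e"
    unfolding BW by (rule assoc_mult_mat[OF Mc Wc real_diag_carrier, symmetric])
  finally show ?case using unitary_on_mult[OF Mu Wu] by blast
qed

text \<open>The adjoint of \<open>A\<close> is \<open>A\<close>, and \<open>A * A\<close> is similar
  to the diagonal matrix of the squares of the \<open>e k\<close>. Its characteristic polynomial has
  these squares as roots with multiplicity, and their square roots are the absolute values.\<close>

lemma trace_norm_hermitian:
  assumes A: "A \<in> carrier_mat n n" "\<And>i j. i < n \<Longrightarrow> j < n \<Longrightarrow> A $$ (i, j) = cnj (A $$ (j, i))"
    and U: "unitary_on n U" "A * U = U * real_diag n e"
  shows "trace_norm A = (\<Sum>k<n. \<bar>e k\<bar>)"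
proof -
  let ?U' = "mat_adjoint U" and ?D = "real_diag n e" and ?E = "real_diag n (\<lambda>k. (e k)\<^sup>2)"
  have c: "U \<in> carrier_mat n n" "?U' \<in> carrier_mat n n" using U by (auto simp: unitary_on_def)
  have adj: "mat_adjoint A = A" by (rule mat_adjoint_hermitian[OF A])
  have DD: "?D * ?D = ?E"
  proof (rule eq_matI)
    fix i j assume "i < dim_row ?E" "j < dim_col ?E"
    then have ij: "i < n" "j < n" by (auto simp: real_diag_def)
    show "(?D * ?D) $$ (i, j) = ?E $$ (i, j)"
      unfolding mult_real_diag_index[OF real_diag_carrier ij]
      using ij by (simp add: real_diag_def power2_eq_square)
  qed (auto simp: real_diag_def)
  have "A * A * U = A * (A * U)" using A c by (simp add: assoc_mult_mat[of _ n n _ n _ n])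
  also have "\<dots> = (A * U) * ?D"
    using A c by (simp add: U(2) assoc_mult_mat[of _ n n _ n _ n, symmetric])
  also have "\<dots> = U * ?E" using c by (simp add: U(2) assoc_mult_mat[of _ n n _ n _ n] DD)
  finally have diag: "A * A * U = U * ?E" .
  have "A * A = A * A * (U * ?U')" using A by (simp add: unitary_on_right_inverse[OF U(1)])
  also have "\<dots> = A * A * U * ?U'" using A c by (intro assoc_mult_mat[of _ n n _ n _ n, symmetric] mult_carrier_mat[of _ n n]) auto
  also have "\<dots> = U * ?E * ?U'" by (simp only: diag)
  finally have AA: "A * A = U * ?E * ?U'" .
  have "A * A \<in> carrier_mat n n" by (rule mult_carrier_mat[OF A(1) A(1)])
  then have carr: "{A * A, ?E, U, ?U'} \<subseteq> carrier_mat n n" using c by (simp del: mult_carrier_mat)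
  have "?U' * U = 1\<^sub>m n" using U(1) by (simp add: unitary_on_def)
  from similar_matI[OF carr unitary_on_right_inverse[OF U(1)] this AA]
  have "similar_mat (A * A) ?E" .
  then have "char_poly (A * A) = char_poly ?E" by (rule char_poly_similar)
  also have "\<dots> = (\<Prod>a\<leftarrow>diag_mat ?E. [:- a, 1:])"
    by (rule char_poly_upper_triangular[OF real_diag_carrier]) (auto simp: real_diag_def)
  finally have "proots (char_poly (mat_adjoint A * A)) = proots (\<Prod>a\<leftarrow>diag_mat ?E. [:- a, 1:])"
    by (simp add: adj)
  also have "\<dots> = mset (diag_mat ?E)"
  proof -
    have "proots (\<Prod>a\<leftarrow>xs. [:- a, 1:]) = mset xs" for xs :: "complex list"
    proof (induction xs)
      case (Cons a xs)
      have "(\<Prod>a\<leftarrow>xs. [:- a, 1:]) \<noteq> 0" by (auto simp: prod_list_zero_iff)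
      then show ?case using Cons by (simp add: proots_mult del: mult_pCons_left)
    qed simp
    then show ?thesis .
  qed
  finally have "trace_norm A = (\<Sum>\<mu>\<in>#mset (diag_mat ?E). sqrt (Re \<mu>))"
    by (simp add: trace_norm_def)
  also have "\<dots> = (\<Sum>\<mu>\<leftarrow>diag_mat ?E. sqrt (Re \<mu>))"
    by (simp only: mset_map[symmetric] sum_mset_sum_list)
  also have "\<dots> = (\<Sum>k\<leftarrow>[0..<n]. \<bar>e k\<bar>)"
    unfolding diag_mat_def by (intro arg_cong[of _ _ sum_list])
      (auto simp: real_diag_def simp flip: of_real_power)
  also have "\<dots> = (\<Sum>k<n. \<bar>e k\<bar>)" by (simp add: sum_list_distinct_conv_sum_set atLeast0LessThan)
  finally show ?thesis .
qed

text \<open>The Rayleigh quotient of the \<open>k\<close>-th column of \<open>U\<close>, which is a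
  unit eigenvector.\<close>

lemma hermitian_eigenvalue:
  assumes A: "A \<in> carrier_mat n n"
    and U: "unitary_on n U" "A * U = U * real_diag n e" and k: "k < n"
  shows "of_real (e k) = (\<Sum>i<n. \<Sum>j<n. cnj (U $$ (i, k)) * A $$ (i, j) * U $$ (j, k))"
proof -
  have c: "U \<in> carrier_mat n n" and iso: "isometry_on n (\<lambda>i j. U $$ (i, j))"
    using U(1) by (auto simp: unitary_on_iff)
  have "(\<Sum>i<n. \<Sum>j<n. cnj (U $$ (i, k)) * A $$ (i, j) * U $$ (j, k))
      = (\<Sum>i<n. cnj (U $$ (i, k)) * (A * U) $$ (i, k))"
    by (intro sum.cong refl, subst mat_mult_index[OF A c])
      (use k in \<open>auto simp: sum_distrib_left mult_ac\<close>)
  also have "\<dots> = (\<Sum>i<n. cnj (U $$ (i, k)) * U $$ (i, k)) * of_real (e k)"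
    unfolding sum_distrib_right U(2)
    by (intro sum.cong refl, subst mult_real_diag_index[OF c]) (use k in \<open>auto simp: mult_ac\<close>)
  also have "\<dots> = of_real (e k)" using iso k by (simp add: isometry_on_def)
  finally show ?thesis ..
qed

text \<open>In the eigenbasis the form is the sum of the eigenvalues weighted by the squared moduli
  of the components \<open>g k\<close> of \<open>v\<close>. These add up to 1, so each is at most
  1.\<close>

lemma hermitian_quadratic_form_le_trace_norm:
  assumes A: "A \<in> carrier_mat n n" "\<And>i j. i < n \<Longrightarrow> j < n \<Longrightarrow> A $$ (i, j) = cnj (A $$ (j, i))"
    and v: "(\<Sum>l<n. (cmod (v l))\<^sup>2) = 1"
  shows "Re (\<Sum>i<n. \<Sum>j<n. cnj (v i) * A $$ (i, j) * v j) \<le> trace_norm A"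
proof -
  obtain U e where U: "unitary_on n U" "A * U = U * real_diag n e"
    using hermitian_diagonalization[OF A] by blast
  let ?U' = "mat_adjoint U"
  have c: "U \<in> carrier_mat n n" "?U' \<in> carrier_mat n n" using U by (auto simp: unitary_on_def)
  define g where "g k = (\<Sum>i<n. cnj (v i) * U $$ (i, k))" for k
  have "A = A * (U * ?U')" using A by (simp add: unitary_on_right_inverse[OF U(1)])
  also have "\<dots> = A * U * ?U'" using A c by (intro assoc_mult_mat[of _ n n _ n _ n, symmetric] mult_carrier_mat[of _ n n]) auto
  finally have AU: "A = U * real_diag n e * ?U'" by (simp only: U(2))
  have entry: "A $$ (i, j) = (\<Sum>k<n. U $$ (i, k) * of_real (e k) * cnj (U $$ (j, k)))"
    if ij: "i < n" "j < n" for i j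
  proof -
    have "A $$ (i, j) = (U * real_diag n e * ?U') $$ (i, j)" using AU by simp
    also have "\<dots> = (\<Sum>k<n. (U * real_diag n e) $$ (i, k) * ?U' $$ (k, j))"
      using c ij by (intro mat_mult_index) auto
    also have "\<dots> = (\<Sum>k<n. U $$ (i, k) * of_real (e k) * cnj (U $$ (j, k)))"
      by (intro sum.cong refl)
        (use ij in \<open>simp add: mult_real_diag_index[OF c(1)] mat_adjoint_index[OF c(1)]
           del: index_mult_mat(1)\<close>)
    finally show ?thesis .
  qed
  have "(\<Sum>i<n. \<Sum>j<n. cnj (v i) * A $$ (i, j) * v j)
      = (\<Sum>i<n. \<Sum>j<n. \<Sum>k<n. of_real (e k) * ((cnj (v i) * U $$ (i, k)) * (cnj (U $$ (j, k)) * v j)))"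
    by (intro sum.cong refl) (simp add: entry sum_distrib_left sum_distrib_right mult_ac)
  also have "\<dots> = (\<Sum>i<n. \<Sum>k<n. \<Sum>j<n. of_real (e k) * ((cnj (v i) * U $$ (i, k)) * (cnj (U $$ (j, k)) * v j)))"
    by (rule sum.cong[OF refl], rule sum.swap)
  also have "\<dots> = (\<Sum>k<n. \<Sum>i<n. \<Sum>j<n. of_real (e k) * ((cnj (v i) * U $$ (i, k)) * (cnj (U $$ (j, k)) * v j)))"
    by (rule sum.swap)
  also have "\<dots> = (\<Sum>k<n. of_real (e k) * (g k * cnj (g k)))"
    unfolding g_def by (simp add: sum_product sum_distrib_left mult_ac)
  also have "\<dots> = of_real (\<Sum>k<n. e k * (cmod (g k))\<^sup>2)"
    by (simp only: of_real_sum of_real_mult complex_norm_square)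
  finally have "Re (\<Sum>i<n. \<Sum>j<n. cnj (v i) * A $$ (i, j) * v j) = (\<Sum>k<n. e k * (cmod (g k))\<^sup>2)"
    by simp
  also have "\<dots> \<le> (\<Sum>k<n. \<bar>e k\<bar>)"
  proof (rule sum_mono)
    fix k assume k: "k \<in> {..<n}"
    \<comment> \<open>\<open>g\<close> is the image of the conjugate of \<open>v\<close> under the
      transpose of \<open>U\<close>, again an isometry by \<open>isometry_on_rows\<close>.\<close>
    have "(\<Sum>k<n. (cmod (g k))\<^sup>2) = (\<Sum>k<n. (cmod (\<Sum>i<n. U $$ (i, k) * cnj (v i)))\<^sup>2)"
      by (simp add: g_def mult.commute)
    also have "\<dots> = (\<Sum>i<n. (cmod (cnj (v i)))\<^sup>2)"
    proof (rule isometry_on_norm)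
      have "isometry_on n (\<lambda>i j. U $$ (i, j))" using U(1) by (simp add: unitary_on_iff)
      from isometry_on_rows[OF this] show "isometry_on n (\<lambda>i j. U $$ (j, i))"
        unfolding isometry_on_def by (simp add: mult.commute)
    qed
    finally have "(\<Sum>k<n. (cmod (g k))\<^sup>2) = 1" using v by simp
    then have "(cmod (g k))\<^sup>2 \<le> 1"
      using member_le_sum[OF k, of "\<lambda>k. (cmod (g k))\<^sup>2"] by simp
    then have "\<bar>e k\<bar> * (cmod (g k))\<^sup>2 \<le> \<bar>e k\<bar> * 1" by (intro mult_left_mono) auto
    moreover have "e k * (cmod (g k))\<^sup>2 \<le> \<bar>e k\<bar> * (cmod (g k))\<^sup>2" by (intro mult_right_mono) auto
    ultimately show "e k * (cmod (g k))\<^sup>2 \<le> \<bar>e k\<bar>" by simp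
  qed
  also have "\<dots> = trace_norm A" using trace_norm_hermitian[OF A U] by simp
  finally show ?thesis .
qed

section \<open>Trace distance of reduced states\<close>

lemma reduced_state_diff:
  "reduced_state a c \<psi> - reduced_state a c \<phi> \<in> carrier_mat a a"
  "i < a \<Longrightarrow> j < a \<Longrightarrow> (reduced_state a c \<psi> - reduced_state a c \<phi>) $$ (i, j)
     = (\<Sum>s<c. \<psi> $ (i * c + s) * cnj (\<psi> $ (j * c + s)))
       - (\<Sum>s<c. \<phi> $ (i * c + s) * cnj (\<phi> $ (j * c + s)))"
  by (auto simp: reduced_state_def)

lemma reduced_state_diff_hermitian:
  assumes "i < a" "j < a"
  shows "(reduced_state a c \<psi> - reduced_state a c \<phi>) $$ (i, j)
       = cnj ((reduced_state a c \<psi> - reduced_state a c \<phi>) $$ (j, i))"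
  unfolding reduced_state_diff(2)[OF assms] reduced_state_diff(2)[OF assms(2,1)]
  by (simp add: mult.commute)

text \<open>The difference of the two rank-one matrices is tested on \<open>\<psi>\<close> itself,
  where its quadratic form is one minus the squared overlap. This is weaker than the exact formula
  with a square root, but enough for the threshold 1/6.\<close>

lemma trace_distance_pure_ge:
  assumes d: "dim_vec \<psi> = d" "dim_vec \<phi> = d" and norm: "vnorm d (\<lambda>j. \<psi> $ j) = 1"
  shows "trace_distance (reduced_state d 1 \<psi>) (reduced_state d 1 \<phi>)
       \<ge> (1 - (cmod (\<Sum>j<d. cnj (\<psi> $ j) * \<phi> $ j))\<^sup>2) / 2"
proof -
  let ?A = "reduced_state d 1 \<psi> - reduced_state d 1 \<phi>"
  define h where "h = (\<Sum>j<d. cnj (\<psi> $ j) * \<phi> $ j)"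
  have v: "(\<Sum>l<d. (cmod (\<psi> $ l))\<^sup>2) = 1" using norm by (simp add: vnorm_square[symmetric])
  have vc: "(\<Sum>l<d. cnj (\<psi> $ l) * \<psi> $ l) = 1"
    using arg_cong[OF v, of complex_of_real]
    unfolding of_real_sum complex_norm_square by (simp add: mult.commute)
  have "(\<Sum>i<d. \<Sum>j<d. cnj (\<psi> $ i) * ?A $$ (i, j) * \<psi> $ j)
      = (\<Sum>i<d. \<Sum>j<d. (cnj (\<psi> $ i) * \<psi> $ i) * (cnj (\<psi> $ j) * \<psi> $ j))
        - (\<Sum>i<d. \<Sum>j<d. (cnj (\<psi> $ i) * \<phi> $ i) * cnj (cnj (\<psi> $ j) * \<phi> $ j))"
    unfolding sum_subtractf[symmetric]
    by (intro sum.cong refl) (simp add: reduced_state_diff(2) algebra_simps del: index_minus_mat)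
  also have "\<dots> = 1 - h * cnj h"
    unfolding sum_product[symmetric] vc h_def cnj_sum by simp
  also have "\<dots> = of_real (1 - (cmod h)\<^sup>2)"
    by (simp only: complex_norm_square of_real_diff of_real_1)
  finally have "1 - (cmod h)\<^sup>2 = Re (\<Sum>i<d. \<Sum>j<d. cnj (\<psi> $ i) * ?A $$ (i, j) * \<psi> $ j)"
    by (simp only: Re_complex_of_real)
  also have "\<dots> \<le> trace_norm ?A"
    by (rule hermitian_quadratic_form_le_trace_norm[OF reduced_state_diff(1)
          reduced_state_diff_hermitian v])
  finally have "1 - (cmod h)\<^sup>2 \<le> trace_norm ?A" .
  then show ?thesis by (simp add: trace_distance_def h_def)
qed

lemma sum_mult_index:
  fixes F :: "nat \<Rightarrow> 'a::comm_monoid_add"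
  shows "(\<Sum>j<a * c. F j) = (\<Sum>i<a. \<Sum>s<c. F (i * c + s))"
proof -
  have "(\<Sum>j<a * c. F j) = (\<Sum>i<a. sum F {i * c..<i * c + c})" by (rule sum.nat_group[symmetric])
  also have "\<dots> = (\<Sum>i<a. \<Sum>s<c. F (i * c + s))"
  proof (rule sum.cong[OF refl])
    fix i
    show "sum F {i * c..<i * c + c} = (\<Sum>s<c. F (i * c + s))"
      using sum.shift_bounds_nat_ivl[of F 0 "i * c" c]
      by (simp add: atLeast0LessThan add.commute)
  qed
  finally show ?thesis .
qed

text \<open>In an eigenbasis of the difference of the reduced states, each eigenvalue is a
  difference of sums of squared amplitudes \<open>g\<close>, \<open>h\<close> of the two full
  vectors. As \<open>g^2 - h^2\<close> has modulus at most \<open>r * (g + h)\<close>, with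
  \<open>r\<close> the amplitude of the difference vector, Cauchy-Schwarz bounds the trace norm by
  \<open>2 * vdist \<psi> \<phi>\<close>.\<close>

lemma trace_distance_reduced_le:
  assumes d: "dim_vec \<psi> = a * c" "dim_vec \<phi> = a * c"
    and norm: "vnorm (a * c) (\<lambda>j. \<psi> $ j) = 1" "vnorm (a * c) (\<lambda>j. \<phi> $ j) = 1"
  shows "trace_distance (reduced_state a c \<psi>) (reduced_state a c \<phi>) \<le> vdist \<psi> \<phi>"
proof -
  let ?A = "reduced_state a c \<psi> - reduced_state a c \<phi>"
  let ?K = "{..<a} \<times> {..<c}"
  note A = reduced_state_diff(1)[of a c \<psi> \<phi>] reduced_state_diff_hermitian[of _ a _ c \<psi> \<phi>]
  obtain U e where U: "unitary_on a U" "?A * U = U * real_diag a e"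
    using hermitian_diagonalization[OF A] by blast
  have iso: "isometry_on a (\<lambda>i j. U $$ (i, j))" using U(1) by (simp add: unitary_on_iff)
  have iso': "isometry_on a (\<lambda>i j. cnj (U $$ (j, i)))"
    using isometry_on_rows[OF iso] unfolding isometry_on_def by simp
  \<comment> \<open>\<open>G F (k, s)\<close> is the modulus of the component of \<open>F\<close>
    along the \<open>k\<close>-th eigenvector tensored with the \<open>s\<close>-th basis state of
    the traced-out register.\<close>
  define G where "G F = (\<lambda>(k, s). cmod (\<Sum>i<a. cnj (U $$ (i, k)) * F (i * c + s)))" for F
  have L2: "L2_set (G F) ?K = vnorm (a * c) F" for F
  proof -
    have "(\<Sum>x\<in>?K. (G F x)\<^sup>2) = (\<Sum>k<a. \<Sum>s<c. (G F (k, s))\<^sup>2)"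
      by (simp add: sum.cartesian_product)
    also have "\<dots> = (\<Sum>s<c. \<Sum>k<a. (G F (k, s))\<^sup>2)" by (rule sum.swap)
    also have "\<dots> = (\<Sum>s<c. \<Sum>k<a. (cmod (F (k * c + s)))\<^sup>2)"
      unfolding G_def using isometry_on_norm[OF iso'] by simp
    also have "\<dots> = (\<Sum>k<a. \<Sum>s<c. (cmod (F (k * c + s)))\<^sup>2)" by (rule sum.swap)
    also have "\<dots> = (\<Sum>j<a * c. (cmod (F j))\<^sup>2)" by (rule sum_mult_index[symmetric])
    finally show ?thesis by (simp add: L2_set_def vnorm_def)
  qed
  let ?g = "G (\<lambda>j. \<psi> $ j)" and ?h = "G (\<lambda>j. \<phi> $ j)" and ?r = "G (\<lambda>j. \<psi> $ j - \<phi> $ j)"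
  have quad: "(\<Sum>i<a. \<Sum>j<a. cnj (U $$ (i, k)) * (\<Sum>s<c. \<xi> $ (i * c + s) * cnj (\<xi> $ (j * c + s))) * U $$ (j, k))
      = of_real (\<Sum>s<c. (G (\<lambda>j. \<xi> $ j) (k, s))\<^sup>2)" for \<xi> k
  proof -
    have "(\<Sum>i<a. \<Sum>j<a. cnj (U $$ (i, k)) * (\<Sum>s<c. \<xi> $ (i * c + s) * cnj (\<xi> $ (j * c + s))) * U $$ (j, k))
      = (\<Sum>i<a. \<Sum>j<a. \<Sum>s<c. (cnj (U $$ (i, k)) * \<xi> $ (i * c + s)) * cnj (cnj (U $$ (j, k)) * \<xi> $ (j * c + s)))"
      by (simp add: sum_distrib_left sum_distrib_right mult_ac)
    also have "\<dots> = (\<Sum>i<a. \<Sum>s<c. \<Sum>j<a. (cnj (U $$ (i, k)) * \<xi> $ (i * c + s)) * cnj (cnj (U $$ (j, k)) * \<xi> $ (j * c + s)))"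
      by (rule sum.cong[OF refl], rule sum.swap)
    also have "\<dots> = (\<Sum>s<c. \<Sum>i<a. \<Sum>j<a. (cnj (U $$ (i, k)) * \<xi> $ (i * c + s)) * cnj (cnj (U $$ (j, k)) * \<xi> $ (j * c + s)))"
      by (rule sum.swap)
    also have "\<dots> = (\<Sum>s<c. (\<Sum>i<a. cnj (U $$ (i, k)) * \<xi> $ (i * c + s)) * cnj (\<Sum>i<a. cnj (U $$ (i, k)) * \<xi> $ (i * c + s)))"
      unfolding cnj_sum sum_product ..
    also have "\<dots> = of_real (\<Sum>s<c. (G (\<lambda>j. \<xi> $ j) (k, s))\<^sup>2)"
      unfolding G_def by (simp only: of_real_sum complex_norm_square split_conv)
    finally show ?thesis .
  qed
  have e: "e k = (\<Sum>s<c. (?g (k, s))\<^sup>2) - (\<Sum>s<c. (?h (k, s))\<^sup>2)" if "k < a" for k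
  proof -
    have "complex_of_real (e k) = (\<Sum>i<a. \<Sum>j<a. cnj (U $$ (i, k)) * ?A $$ (i, j) * U $$ (j, k))"
      by (rule hermitian_eigenvalue[OF A(1) U that])
    also have "\<dots> = of_real (\<Sum>s<c. (?g (k, s))\<^sup>2) - of_real (\<Sum>s<c. (?h (k, s))\<^sup>2)"
      unfolding quad[symmetric] sum_subtractf[symmetric]
      by (intro sum.cong refl) (simp add: reduced_state_diff(2) algebra_simps del: index_minus_mat)
    finally show ?thesis unfolding of_real_diff[symmetric] of_real_eq_iff .
  qed
  have step: "\<bar>(?g x)\<^sup>2 - (?h x)\<^sup>2\<bar> \<le> \<bar>?r x\<bar> * \<bar>?g x\<bar> + \<bar>?r x\<bar> * \<bar>?h x\<bar>" for x
  proof -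
    obtain k s where x: "x = (k, s)" by force
    have pos: "0 \<le> ?g x" "0 \<le> ?h x" "0 \<le> ?r x" by (auto simp: G_def x)
    have "\<bar>?g x - ?h x\<bar> \<le> ?r x"
      unfolding G_def x split_conv right_diff_distrib sum_subtractf by (rule norm_triangle_ineq3)
    then have "\<bar>?g x - ?h x\<bar> * (?g x + ?h x) \<le> ?r x * (?g x + ?h x)"
      using pos by (intro mult_right_mono) auto
    moreover have "\<bar>(?g x)\<^sup>2 - (?h x)\<^sup>2\<bar> = \<bar>?g x - ?h x\<bar> * (?g x + ?h x)"
      using pos by (simp add: power2_eq_square square_diff_square_factored abs_mult mult.commute)
    ultimately show ?thesis using pos by (simp add: algebra_simps)
  qed
  have "trace_norm ?A = (\<Sum>k<a. \<bar>e k\<bar>)" by (rule trace_norm_hermitian[OF A U])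
  also have "\<dots> \<le> (\<Sum>k<a. \<Sum>s<c. \<bar>(?g (k, s))\<^sup>2 - (?h (k, s))\<^sup>2\<bar>)"
    by (intro sum_mono) (simp add: e sum_subtractf[symmetric])
  also have "\<dots> = (\<Sum>x\<in>?K. \<bar>(?g x)\<^sup>2 - (?h x)\<^sup>2\<bar>)" by (simp add: sum.cartesian_product)
  also have "\<dots> \<le> (\<Sum>x\<in>?K. \<bar>?r x\<bar> * \<bar>?g x\<bar>) + (\<Sum>x\<in>?K. \<bar>?r x\<bar> * \<bar>?h x\<bar>)"
    unfolding sum.distrib[symmetric] by (intro sum_mono step)
  also have "\<dots> \<le> L2_set ?r ?K * L2_set ?g ?K + L2_set ?r ?K * L2_set ?h ?K"
    by (intro add_mono L2_set_mult_ineq)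
  also have "\<dots> = 2 * vdist \<psi> \<phi>" unfolding L2 norm by (simp add: vdist_def d)
  finally show ?thesis by (simp add: trace_distance_def)
qed

section \<open>Query algorithms as sequences of elementary steps\<close>

text \<open>A state is given by its amplitudes for all inputs at once, produced by one
  \<open>U\<close> independent of the input. Algorithms are then assembled by rules for single
  steps, in which only queries raise \<open>k\<close>.\<close>

definition reaches :: "nat \<Rightarrow> nat \<Rightarrow> nat \<Rightarrow> nat \<Rightarrow> (nat list \<Rightarrow> nat \<Rightarrow> complex) \<Rightarrow> bool" where
  "reaches q n m k \<Psi> \<longleftrightarrow> (\<exists>U. query_algorithm q n k m U \<and>
     (\<forall>x\<in>strings q n. \<forall>j<qdim q n m. final_state q n m U x k $ j = \<Psi> x j))"

lemma reaches_cong: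
  assumes "reaches q n m k \<Psi>"
    and "\<And>x j. x \<in> strings q n \<Longrightarrow> j < qdim q n m \<Longrightarrow> \<Psi> x j = \<Phi> x j"
  shows "reaches q n m k \<Phi>"
  using assms unfolding reaches_def by fastforce

text \<open>A unitary with first column \<open>u\<close>, from \<open>isometry_completion\<close>,
  prepares \<open>u\<close> out of the initial basis state before any query.\<close>

lemma reaches_init:
  assumes "(\<Sum>j<qdim q n m. (cmod (u j))\<^sup>2) = 1" "m > 0"
  shows "reaches q n m 0 (\<lambda>x. u)"
proof -
  let ?d = "qdim q n m"
  obtain M where M: "isometry_on ?d M" "\<And>i. i < ?d \<Longrightarrow> M i 0 = u i"
    using isometry_completion[OF assms(1)] by blast
  let ?U = "mat ?d ?d (\<lambda>(i, j). M i j)"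
  have "isometry_on ?d (\<lambda>i j. ?U $$ (i, j))" using M(1) by (auto simp: isometry_on_def)
  then have U: "unitary_on ?d ?U" by (simp add: unitary_on_iff)
  have "(?U *\<^sub>v unit_vec ?d 0) $ j = u j" if "j < ?d" for j
  proof -
    have "(?U *\<^sub>v unit_vec ?d 0) $ j = (\<Sum>c<?d. ?U $$ (j, c) * unit_vec ?d 0 $ c)"
      by (rule mat_mult_vec_index) (use that in auto)
    also have "\<dots> = (\<Sum>c<?d. if c = 0 then M j 0 else 0)"
      using that by (intro sum.cong) auto
    also have "\<dots> = u j" using that M(2) by (simp add: sum.delta)
    finally show ?thesis .
  qed
  then show ?thesis unfolding reaches_def
    using U assms(2) by (intro exI[of _ "\<lambda>_. ?U"]) (simp add: query_algorithm_def)
qed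

lemma final_state_cong:
  "(\<And>s. s \<le> t \<Longrightarrow> U s = V s) \<Longrightarrow> final_state q n m U x t = final_state q n m V x t"
  by (induction t) auto

text \<open>An additional unitary costs no query: it is multiplied into the last \<open>U k\<close>,
  whether that one follows a query or, for \<open>k = 0\<close>, prepares the initial state.\<close>

lemma reaches_unitary:
  assumes "reaches q n m k \<Psi>" and M: "isometry_on (qdim q n m) M"
  shows "reaches q n m k (\<lambda>x j. \<Sum>l<qdim q n m. M j l * \<Psi> x l)"
proof -
  let ?d = "qdim q n m"
  obtain U where U: "query_algorithm q n k m U"
    "\<And>x j. x \<in> strings q n \<Longrightarrow> j < ?d \<Longrightarrow> final_state q n m U x k $ j = \<Psi> x j"
    using assms(1) unfolding reaches_def by blast
  let ?V = "mat ?d ?d (\<lambda>(i, j). M i j)"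
  let ?U = "U(k := ?V * U k)"
  have "isometry_on ?d (\<lambda>i j. ?V $$ (i, j))" using M by (auto simp: isometry_on_def)
  then have V: "unitary_on ?d ?V" by (simp add: unitary_on_iff)
  have alg: "query_algorithm q n k m ?U"
    using U(1) V unitary_on_mult by (auto simp: query_algorithm_def)
  have Uk: "U k \<in> carrier_mat ?d ?d" using U(1) by (auto simp: query_algorithm_def unitary_on_def)
  have step: "final_state q n m ?U x k = ?V *\<^sub>v final_state q n m U x k" for x
  proof (cases k)
    case 0
    then show ?thesis using Uk by (simp add: assoc_mult_mat_vec[of _ ?d ?d _ ?d])
  next
    case (Suc t)
    have "final_state q n m ?U x t = final_state q n m U x t"
      using Suc by (intro final_state_cong) auto
    moreover have "query_op q n m x *\<^sub>v final_state q n m U x t \<in> carrier_vec ?d"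
      by (rule carrier_vecI) simp
    ultimately show ?thesis using Suc Uk by (simp add: assoc_mult_mat_vec[of _ ?d ?d _ ?d])
  qed
  have "final_state q n m ?U x k $ j = (\<Sum>l<?d. M j l * \<Psi> x l)"
    if "x \<in> strings q n" "j < ?d" for x j
  proof -
    have "final_state q n m ?U x k $ j = (\<Sum>l<?d. ?V $$ (j, l) * final_state q n m U x k $ l)"
      unfolding step
      by (rule mat_mult_vec_index) (use that dim_final_state[OF U(1)] in auto)
    then show ?thesis using that U(2) by simp
  qed
  then show ?thesis unfolding reaches_def using alg by blast
qed

lemma sum_permutation:
  fixes f :: "nat \<Rightarrow> complex"
  assumes "inj_on p {..<d}" "j < d"
  shows "(\<Sum>c<d. (if p j = p c then 1 else 0) * f c) = f j"
proof -
  have "(\<Sum>c<d. (if p j = p c then 1 else 0) * f c) = (\<Sum>c<d. if c = j then f j else 0)"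
    using assms by (intro sum.cong refl) (auto dest: inj_onD)
  then show ?thesis using assms by (simp add: sum.delta)
qed

lemma reaches_permutation:
  assumes "reaches q n m k \<Psi>"
    and p: "inj_on p {..<qdim q n m}" "p ` {..<qdim q n m} \<subseteq> {..<qdim q n m}"
    and \<Phi>: "\<And>x j. x \<in> strings q n \<Longrightarrow> j < qdim q n m \<Longrightarrow> \<Phi> x (p j) = \<Psi> x j"
  shows "reaches q n m k \<Phi>"
proof (rule reaches_cong[OF reaches_unitary[OF assms(1) isometry_on_permutation[OF p]]])
  fix x l assume x: "x \<in> strings q n" and l: "l < qdim q n m"
  obtain j where j: "j < qdim q n m" "l = p j"
    using endo_inj_surj[OF _ p(2,1)] l by auto
  show "(\<Sum>c<qdim q n m. (if l = p c then 1 else 0) * \<Psi> x c) = \<Phi> x l"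
    unfolding j(2) using sum_permutation[OF p(1) j(1)] \<Phi>[OF x j(1)] by simp
qed

text \<open>The identity serves as the unitary after the new query. The target amplitudes are
  prescribed at the images under the oracle permutation, so its inverse never has to be written
  down.\<close>

lemma reaches_query:
  assumes "reaches q n m k \<Psi>"
    and \<Phi>: "\<And>x j. x \<in> strings q n \<Longrightarrow> j < qdim q n m \<Longrightarrow> \<Phi> x (query_basis q n m x j) = \<Psi> x j"
  shows "reaches q n m (Suc k) \<Phi>"
proof -
  let ?d = "qdim q n m"
  obtain U where U: "query_algorithm q n k m U"
    "\<And>x j. x \<in> strings q n \<Longrightarrow> j < ?d \<Longrightarrow> final_state q n m U x k $ j = \<Psi> x j"
    using assms(1) unfolding reaches_def by blast
  let ?U = "U(Suc k := 1\<^sub>m ?d)"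
  have "isometry_on ?d (\<lambda>i j. 1\<^sub>m ?d $$ (i, j))"
    using isometry_on_permutation[of "\<lambda>j. j" ?d] by (simp add: isometry_on_def)
  then have "query_algorithm q n (Suc k) m ?U"
    using U(1) by (auto simp: query_algorithm_def unitary_on_iff le_Suc_eq)
  moreover have "final_state q n m ?U x (Suc k) $ l = \<Phi> x l"
    if x: "x \<in> strings q n" and l: "l < ?d" for x l
  proof -
    let ?p = "query_basis q n m x"
    obtain j where j: "j < ?d" "l = ?p j"
      using endo_inj_surj[OF _ _ inj_on_query_basis, of q n m x] query_basis_less l
      by (metis (no_types, lifting) finite_lessThan image_iff image_subsetI lessThan_iff)
    have "final_state q n m ?U x k = final_state q n m U x k" by (intro final_state_cong) auto
    moreover have "query_op q n m x *\<^sub>v final_state q n m U x k \<in> carrier_vec ?d"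
      by (rule carrier_vecI) simp
    ultimately have "final_state q n m ?U x (Suc k) $ l
        = (query_op q n m x *\<^sub>v final_state q n m U x k) $ l"
      by (simp only: final_state.simps fun_upd_same one_mult_mat_vec)
    also have "\<dots> = (\<Sum>c<?d. (if l = ?p c then 1 else 0) * final_state q n m U x k $ c)"
      by (rule query_op_mult_vec) (use l dim_final_state[OF U(1)] in auto)
    also have "\<dots> = \<Psi> x j"
      unfolding j(2) sum_permutation[OF inj_on_query_basis j(1)] by (rule U(2)[OF x j(1)])
    also have "\<dots> = \<Phi> x l" unfolding j(2) using \<Phi>[OF x j(1)] by simp
    finally show ?thesis .
  qed
  ultimately show ?thesis unfolding reaches_def by blast
qed

text \<open>A controlled operation: an index is read as \<open>i * c + e\<close>, and
  \<open>N e\<close> acts on \<open>i\<close> while \<open>e\<close> is untouched. Different values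
  of \<open>e\<close> give orthogonal blocks.\<close>

lemma isometry_on_block:
  assumes "\<And>e. e < c \<Longrightarrow> isometry_on a (N e)"
  shows "isometry_on (a * c)
    (\<lambda>j l. if j mod c = l mod c then N (l mod c) (j div c) (l div c) else 0)"
    (is "isometry_on _ ?M")
  unfolding isometry_on_def
proof (intro allI impI)
  fix i j assume ij: "i < a * c" "j < a * c"
  then have c: "c > 0" by (auto intro: Nat.gr0I)
  have lt: "i div c < a" "j div c < a" "i mod c < c" "j mod c < c"
    using ij c by (auto simp: less_mult_imp_div_less)
  have "(\<Sum>l<a * c. cnj (?M l i) * ?M l j)
      = (\<Sum>l<a. \<Sum>s<c. if s = i mod c then (if i mod c = j mod c
           then cnj (N (i mod c) l (i div c)) * N (i mod c) l (j div c) else 0) else 0)"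
    unfolding sum_mult_index by (intro sum.cong refl) auto
  also have "\<dots> = (\<Sum>l<a. if i mod c = j mod c
           then cnj (N (i mod c) l (i div c)) * N (i mod c) l (j div c) else 0)"
    using lt by (simp add: sum.delta)
  also have "\<dots> = (if i mod c = j mod c \<and> i div c = j div c then 1 else 0)"
    using assms[OF lt(3)] lt by (cases "i mod c = j mod c") (auto simp: isometry_on_def)
  also have "\<dots> = (if i = j then 1 else 0)"
    by (metis div_mult_mod_eq)
  finally show "(\<Sum>l<a * c. cnj (?M l i) * ?M l j) = (if i = j then 1 else 0)" .
qed

lemma reaches_block:
  assumes "reaches q n m k \<Psi>" and d: "qdim q n m = a * c"
    and N: "\<And>e. e < c \<Longrightarrow> isometry_on a (N e)"
  shows "reaches q n m k (\<lambda>x j. \<Sum>i<a. N (j mod c) (j div c) i * \<Psi> x (i * c + j mod c))"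
proof -
  let ?M = "\<lambda>j l. if j mod c = l mod c then N (l mod c) (j div c) (l div c) else 0"
  have "isometry_on (qdim q n m) ?M" unfolding d by (rule isometry_on_block[OF N])
  from reaches_unitary[OF assms(1) this] show ?thesis
  proof (rule reaches_cong)
    fix x j assume "j < qdim q n m"
    then have "c > 0" unfolding d by (auto intro: Nat.gr0I)
    have "(\<Sum>l<a * c. ?M j l * \<Psi> x l)
        = (\<Sum>i<a. \<Sum>s<c. if s = j mod c then N (j mod c) (j div c) i * \<Psi> x (i * c + j mod c) else 0)"
      unfolding sum_mult_index by (intro sum.cong refl) auto
    also have "\<dots> = (\<Sum>i<a. N (j mod c) (j div c) i * \<Psi> x (i * c + j mod c))"
      using \<open>c > 0\<close> by (simp add: sum.delta)
    finally show "(\<Sum>l<qdim q n m. ?M j l * \<Psi> x l)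
        = (\<Sum>i<a. N (j mod c) (j div c) i * \<Psi> x (i * c + j mod c))" by (simp only: d)
  qed
qed

lemma reaches_sign:
  assumes "reaches q n m k \<Psi>" and \<sigma>: "\<And>j. \<sigma> j * cnj (\<sigma> j) = 1"
  shows "reaches q n m k (\<lambda>x j. \<sigma> j * \<Psi> x j)"
proof -
  let ?d = "qdim q n m"
  have "isometry_on ?d (\<lambda>i j. if i = j then \<sigma> j else 0)"
    unfolding isometry_on_def
  proof (intro allI impI)
    fix i j assume ij: "i < ?d" "j < ?d"
    have "(\<Sum>l<?d. cnj (if l = i then \<sigma> i else 0) * (if l = j then \<sigma> j else 0))
        = (\<Sum>l<?d. if l = i then (if i = j then 1 else 0) else 0)"
      using \<sigma> by (intro sum.cong refl) (auto simp: mult.commute)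
    then show "(\<Sum>l<?d. cnj (if l = i then \<sigma> i else 0) * (if l = j then \<sigma> j else 0))
        = (if i = j then 1 else 0)" using ij by (simp add: sum.delta)
  qed
  from reaches_unitary[OF assms(1) this] show ?thesis
  proof (rule reaches_cong)
    fix x j assume "j < ?d"
    have "(\<Sum>l<?d. (if j = l then \<sigma> l else 0) * \<Psi> x l) = (\<Sum>l<?d. if l = j then \<sigma> j * \<Psi> x j else 0)"
      by (intro sum.cong refl) auto
    then show "(\<Sum>l<?d. (if j = l then \<sigma> l else 0) * \<Psi> x l) = \<sigma> j * \<Psi> x j"
      using \<open>j < ?d\<close> by (simp add: sum.delta)
  qed
qed

section \<open>Running an algorithm twice\<close>

lemma query_basis_tensor:
  assumes "d > 0"
  shows "query_basis q n (m * d) x J div d = query_basis q n m x (J div d)"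
    "query_basis q n (m * d) x J mod d = J mod d"
proof -
  have 1: "J div (m * d) = J div d div m" by (metis div_mult2_eq mult.commute)
  have 2: "J mod (m * d) = (J div d mod m) * d + J mod d"
    by (metis mod_mult2_eq mult.commute)
  have "query_basis q n (m * d) x J = query_basis q n m x (J div d) * d + J mod d"
    unfolding query_basis_def Let_def 1 2 by (simp add: algebra_simps)
  then show "query_basis q n (m * d) x J div d = query_basis q n m x (J div d)"
    "query_basis q n (m * d) x J mod d = J mod d" using assms by simp_all
qed

lemma reaches_twice:
  assumes "reaches q n m k \<Psi>" and q: "q > 0"
  defines "d \<equiv> qdim q n m"
  shows "reaches q n (m * d) (2 * k) (\<lambda>x J. \<Psi> x (J div d) * \<Psi> x (J mod d))"
proof -
  obtain U where U: "query_algorithm q n k m U"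
    "\<And>x j. x \<in> strings q n \<Longrightarrow> j < d \<Longrightarrow> final_state q n m U x k $ j = \<Psi> x j"
    using assms(1) unfolding reaches_def d_def by blast
  have m: "m > 0" using U(1) by (simp add: query_algorithm_def)
  have d: "d > 0" using m q by (simp add: d_def qdim_def)
  have dd: "qdim q n (m * d) = d * d" by (simp add: d_def qdim_def algebra_simps)
  define F where "F t x j = final_state q n m U x t $ j" for t x j
  have iso: "isometry_on d (\<lambda>i j. U t $$ (i, j))" and carr: "U t \<in> carrier_mat d d" if "t \<le> k" for t
    using U(1) that by (auto simp: query_algorithm_def unitary_on_iff d_def)
  \<comment> \<open>The resting factor \<open>g\<close> is arbitrary, so one induction serves both
    before the exchange, with \<open>g\<close> the initial basis state, and after it, with
    \<open>g\<close> the finished first run.\<close>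
  have run: "reaches q n (m * d) (K + t) (\<lambda>x J. F t x (J div d) * g x (J mod d))"
    if start: "reaches q n (m * d) K (\<lambda>x J. (if J div d = 0 then 1 else 0) * g x (J mod d))"
      and "t \<le> k" for K t g
    using \<open>t \<le> k\<close>
  proof (induction t)
    case 0
    have "reaches q n (m * d) K (\<lambda>x J. \<Sum>i<d. U 0 $$ (J div d, i) *
        ((if (i * d + J mod d) div d = 0 then 1 else 0) * g x ((i * d + J mod d) mod d)))"
      by (rule reaches_block[OF start dd, of "\<lambda>_ i j. U 0 $$ (i, j)"]) (use iso in simp)
    then have "reaches q n (m * d) K (\<lambda>x J. F 0 x (J div d) * g x (J mod d))"
    proof (rule reaches_cong)
      fix x J assume "J < qdim q n (m * d)"
      then have J: "J div d < d" using d by (simp add: dd less_mult_imp_div_less)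
      have "F 0 x (J div d) = (\<Sum>i<d. U 0 $$ (J div d, i) * unit_vec d 0 $ i)"
        unfolding F_def final_state.simps d_def[symmetric]
        by (rule mat_mult_vec_index) (use carr J in auto)
      also have "\<dots> = (\<Sum>i<d. U 0 $$ (J div d, i) * (if i = 0 then 1 else 0))"
        by (intro sum.cong refl) auto
      finally have F0: "F 0 x (J div d) = (\<Sum>i<d. U 0 $$ (J div d, i) * (if i = 0 then 1 else 0))" .
      show "(\<Sum>i<d. U 0 $$ (J div d, i) *
          ((if (i * d + J mod d) div d = 0 then 1 else 0) * g x ((i * d + J mod d) mod d)))
        = F 0 x (J div d) * g x (J mod d)"
        unfolding F0 sum_distrib_right using d by (intro sum.cong refl) auto
    qed
    then show ?case by simp
  next
    case (Suc t)
    then have t: "t \<le> k" "Suc t \<le> k" by auto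
    let ?Q = "\<lambda>x j. (query_op q n m x *\<^sub>v final_state q n m U x t) $ j"
    have "reaches q n (m * d) (Suc (K + t)) (\<lambda>x J. ?Q x (J div d) * g x (J mod d))"
    proof (rule reaches_query[OF Suc.IH[OF t(1)]])
      fix x J assume "J < qdim q n (m * d)"
      then have J: "J div d < d" using d by (simp add: dd less_mult_imp_div_less)
      have "?Q x (query_basis q n m x (J div d)) = F t x (J div d)"
        using J query_basis_less[of "J div d" q n m x] dim_final_state[OF U(1) t(1)]
        by (subst query_op_mult_vec)
          (auto simp: F_def d_def intro: sum_permutation[OF inj_on_query_basis])
      then show "?Q x (query_basis q n (m * d) x J div d) * g x (query_basis q n (m * d) x J mod d)
          = F t x (J div d) * g x (J mod d)"
        by (simp only: query_basis_tensor[OF d])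
    qed
    then have "reaches q n (m * d) (Suc (K + t)) (\<lambda>x J. \<Sum>i<d. U (Suc t) $$ (J div d, i) *
        (?Q x ((i * d + J mod d) div d) * g x ((i * d + J mod d) mod d)))"
      by (rule reaches_block[OF _ dd, of _ _ "\<lambda>_ i j. U (Suc t) $$ (i, j)"]) (use iso t in simp)
    then have "reaches q n (m * d) (Suc (K + t)) (\<lambda>x J. F (Suc t) x (J div d) * g x (J mod d))"
    proof (rule reaches_cong)
      fix x J assume "J < qdim q n (m * d)"
      then have J: "J div d < d" using d by (simp add: dd less_mult_imp_div_less)
      have F: "F (Suc t) x (J div d) = (\<Sum>i<d. U (Suc t) $$ (J div d, i) * ?Q x i)"
        unfolding F_def final_state.simps
        by (rule mat_mult_vec_index) (use carr[OF t(2)] J in \<open>auto simp: d_def\<close>)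
      show "(\<Sum>i<d. U (Suc t) $$ (J div d, i) *
          (?Q x ((i * d + J mod d) div d) * g x ((i * d + J mod d) mod d)))
        = F (Suc t) x (J div d) * g x (J mod d)"
        unfolding F sum_distrib_right using d by (intro sum.cong refl) (simp add: mult.assoc)
    qed
    then show ?case by simp
  qed
  let ?e = "\<lambda>j. if j = 0 then 1 else 0 :: complex"
  have "(\<Sum>J<qdim q n (m * d). (cmod (?e (J div d) * ?e (J mod d)))\<^sup>2)
      = (\<Sum>i<d. \<Sum>s<d. if s = 0 then (if i = 0 then 1 else 0) else 0)"
    unfolding dd sum_mult_index using d by (intro sum.cong refl) auto
  also have "\<dots> = 1" using d by (simp add: sum.delta)
  finally have "reaches q n (m * d) 0 (\<lambda>x J. ?e (J div d) * ?e (J mod d))"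
    using m d by (intro reaches_init) auto
  from run[OF this, of k]
  have 1: "reaches q n (m * d) k (\<lambda>x J. F k x (J div d) * ?e (J mod d))" by simp
  \<comment> \<open>The permutation of indices that exchanges the two copies.\<close>
  let ?p = "\<lambda>J. (J mod d) * d + J div d"
  have p: "?p J div d = J mod d" "?p J mod d = J div d" "?p J < d * d" if "J < d * d" for J
  proof -
    have J: "J div d < d" using that by (simp add: less_mult_imp_div_less)
    then show "?p J div d = J mod d" "?p J mod d = J div d" using d by auto
    have "J mod d < d" using d by simp
    have "?p J < (J mod d + 1) * d" using J by simp
    also have "\<dots> \<le> d * d" using \<open>J mod d < d\<close> by (intro mult_right_mono) auto
    finally show "?p J < d * d" .
  qed
  have "reaches q n (m * d) k (\<lambda>x J. ?e (J div d) * F k x (J mod d))"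
  proof (rule reaches_permutation[OF 1, of ?p])
    show "inj_on ?p {..<qdim q n (m * d)}"
      unfolding dd by (rule inj_onI) (metis lessThan_iff p(1,2) div_mult_mod_eq)
    show "?p ` {..<qdim q n (m * d)} \<subseteq> {..<qdim q n (m * d)}" unfolding dd using p(3) by auto
    show "?e (?p J div d) * F k x (?p J mod d) = F k x (J div d) * ?e (J mod d)"
      if "J < qdim q n (m * d)" for x J
      using p that unfolding dd by (simp add: mult.commute)
  qed
  from run[OF this, of k]
  have "reaches q n (m * d) (k + k) (\<lambda>x J. F k x (J div d) * F k x (J mod d))" by simp
  then show ?thesis unfolding mult_2
  proof (rule reaches_cong)
    fix x J assume "x \<in> strings q n" "J < qdim q n (m * d)"
    then show "F k x (J div d) * F k x (J mod d) = \<Psi> x (J div d) * \<Psi> x (J mod d)"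
      using d U(2) by (simp add: F_def dd less_mult_imp_div_less)
  qed
qed

section \<open>Amplitude amplification with a random number of iterations\<close>

lemma sum_qdim:
  fixes F :: "nat \<Rightarrow> 'a::comm_monoid_add"
  shows "(\<Sum>j<qdim q n m. F j) = (\<Sum>i<Suc n. \<Sum>b<q. \<Sum>w<m. F ((i * q + b) * m + w))"
  unfolding qdim_def Suc_eq_plus1 by (simp only: sum_mult_index)

text \<open>
  The amplitude of $|i,b,t\rangle$ is \<open>a i t\<close> if \<open>b\<close> is the value that \<open>r\<close> queries produce from 0,
  and 0 otherwise.
\<close>

definition answer :: "nat \<Rightarrow> nat \<Rightarrow> nat list \<Rightarrow> nat \<Rightarrow> nat \<Rightarrow> nat" where
  "answer q n x r i = (if i < n then (r * x ! i) mod q else 0)"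

definition queried :: "nat \<Rightarrow> nat \<Rightarrow> nat \<Rightarrow> nat list \<Rightarrow> nat \<Rightarrow> (nat \<Rightarrow> nat \<Rightarrow> real) \<Rightarrow> nat \<Rightarrow> complex" where
  "queried q n m x r a j = (if j div m mod q = answer q n x r (j div m div q)
     then of_real (a (j div m div q) (j mod m)) else 0)"

lemma queried_triple:
  assumes "b < q" "w < m"
  shows "queried q n m x r a ((i * q + b) * m + w)
       = (if b = answer q n x r i then of_real (a i w) else 0)"
  unfolding queried_def triple_index[OF assms] ..

text \<open>Symbols accumulate additively in the answer register, and \<open>q\<close> queries
  return it to 0. This is how answers are erased, since for \<open>q > 2\<close> the oracle is not
  its own inverse.\<close>

lemma reaches_queried:
  assumes "reaches q n m k (\<lambda>x. queried q n m x r (a x))"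
  shows "reaches q n m (k + s) (\<lambda>x. queried q n m x (r + s) (a x))"
proof (induction s)
  case 0
  then show ?case using assms by simp
next
  case (Suc s)
  have "reaches q n m (Suc (k + s)) (\<lambda>x. queried q n m x (r + Suc s) (a x))"
  proof (rule reaches_query[OF Suc.IH])
    fix x j assume j: "j < qdim q n m"
    define i b w where "i = j div m div q" and "b = j div m mod q" and "w = j mod m"
    have jeq: "j = (i * q + b) * m + w" by (simp add: i_def b_def w_def)
    have bw: "b < q" "w < m" using triple_index_bounds[OF j] by (auto simp: b_def w_def)
    define b' where "b' = (if i < n then (b + x ! i) mod q else b)"
    have b': "b' < q" using bw by (simp add: b'_def)
    have "b' = answer q n x (r + Suc s) i \<longleftrightarrow> b = answer q n x (r + s) i"
    proof (cases "i < n")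
      case True
      have "int q dvd (int b + int (x ! i)) - (int ((r + s) * x ! i) + int (x ! i))
          \<longleftrightarrow> int q dvd int b - int ((r + s) * x ! i)" by simp
      then have "(b + x ! i) mod q = ((r + s) * x ! i + x ! i) mod q
          \<longleftrightarrow> b mod q = ((r + s) * x ! i) mod q"
        unfolding mod_eq_dvd_iff[symmetric]
        by (simp only: of_nat_add[symmetric] of_nat_mod[symmetric] of_nat_eq_iff)
      then show ?thesis using True bw by (simp add: answer_def b'_def algebra_simps)
    qed (simp add: answer_def b'_def)
    then show "queried q n m x (r + Suc s) (a x) (query_basis q n m x j)
        = queried q n m x (r + s) (a x) j"
      unfolding jeq query_basis_triple[OF bw] b'_def[symmetric]
        queried_triple[OF b' bw(2)] queried_triple[OF bw] by simp
  qed
  then show ?case by simp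
qed

definition marked :: "nat \<Rightarrow> (nat \<Rightarrow> nat \<Rightarrow> bool) \<Rightarrow> nat list \<Rightarrow> nat \<Rightarrow> bool" where
  "marked n P x i \<longleftrightarrow> i < n \<and> P i (x ! i)"

text \<open>Amplitudes on the index register under amplitude amplification: a sign flip on the
  marked positions, then the reflection about the start vector \<open>r\<close>. The sum includes
  the null index \<open>n\<close>.\<close>

primrec grover :: "nat \<Rightarrow> (nat \<Rightarrow> real) \<Rightarrow> (nat \<Rightarrow> bool) \<Rightarrow> nat \<Rightarrow> nat \<Rightarrow> real" where
  "grover n r M 0 i = r i"
| "grover n r M (Suc t) i = 2 * r i * (\<Sum>l<Suc n. r l * (if M l then - grover n r M t l else grover n r M t l))
     - (if M i then - grover n r M t i else grover n r M t i)"

lemma isometry_on_reflection: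
  fixes r :: "nat \<Rightarrow> real"
  assumes "(\<Sum>i<d. (r i)\<^sup>2) = 1"
  shows "isometry_on d (\<lambda>i l. of_real (2 * r i * r l - (if i = l then 1 else 0)))"
  unfolding isometry_on_def
proof (intro allI impI)
  fix i j assume ij: "i < d" "j < d"
  have "(\<Sum>l<d. cnj (of_real (2 * r l * r i - (if l = i then 1 else 0)))
            * of_real (2 * r l * r j - (if l = j then 1 else 0)))
      = complex_of_real (\<Sum>l<d. (2 * r l * r i - (if l = i then 1 else 0))
            * (2 * r l * r j - (if l = j then 1 else 0)))"
    by (simp only: complex_cnj_complex_of_real of_real_mult[symmetric] of_real_sum)
  also have "(\<Sum>l<d. (2 * r l * r i - (if l = i then 1 else 0))
            * (2 * r l * r j - (if l = j then 1 else 0)))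
      = (\<Sum>l<d. 4 * r i * r j * (r l)\<^sup>2 - (if l = i then 2 * r i * r j else 0)
            - (if l = j then 2 * r i * r j else 0) + (if l = i then (if i = j then 1 else 0) else 0))"
    by (intro sum.cong refl) (auto simp: algebra_simps power2_eq_square)
  also have "\<dots> = (if i = j then 1 else 0)"
    using ij assms unfolding sum.distrib sum_subtractf sum_distrib_left[symmetric]
    by (simp add: sum.delta)
  finally show "(\<Sum>l<d. cnj (of_real (2 * r l * r i - (if l = i then 1 else 0)))
            * of_real (2 * r l * r j - (if l = j then 1 else 0)))
      = (if i = j then 1 else 0 :: complex)" by simp
qed

lemma isometry_on_id: "isometry_on d (\<lambda>i j. if i = j then 1 else 0)"
  using isometry_on_permutation[of "\<lambda>j. j" d] by simp

lemma reaches_grover: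
  fixes r :: "nat \<Rightarrow> real"
  assumes r: "(\<Sum>i<Suc n. (r i)\<^sup>2) = 1" and q: "q > 0"
  shows "reaches q n (Suc S) (q * S + 1) (\<lambda>x. queried q n (Suc S) x 1
           (\<lambda>i t. grover n r (marked n P x) t i / sqrt (Suc S)))"
proof -
  let ?T = "Suc S"
  let ?G = "\<lambda>x t i. grover n r (marked n P x) t i / sqrt ?T"
  \<comment> \<open>\<open>min s t\<close> is the number of iterations that branch \<open>t\<close>
    has undergone after \<open>s\<close> rounds.\<close>
  have main: "reaches q n ?T (q * s) (\<lambda>x. queried q n ?T x 0 (\<lambda>i t. ?G x (min s t) i))"
    if "s \<le> S" for s
    using that
  proof (induction s)
    case 0
    let ?u = "queried q n ?T [] 0 (\<lambda>i t. r i / sqrt ?T)"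
    have "(\<Sum>j<qdim q n ?T. (cmod (?u j))\<^sup>2)
        = (\<Sum>i<Suc n. \<Sum>b<q. \<Sum>w<?T. if b = 0 then (r i)\<^sup>2 / ?T else 0)"
      unfolding sum_qdim
      by (intro sum.cong refl, subst queried_triple)
        (auto simp: answer_def power_divide norm_divide simp del: of_nat_Suc)
    also have "\<dots> = (\<Sum>i<Suc n. \<Sum>b<q. if b = 0 then (r i)\<^sup>2 else 0)"
      by (intro sum.cong refl) (auto simp del: of_nat_Suc)
    also have "\<dots> = 1" using q r by (simp add: sum.delta del: sum.lessThan_Suc)
    finally have "reaches q n ?T 0 (\<lambda>x. ?u)" by (intro reaches_init) auto
    then have "reaches q n ?T 0 (\<lambda>x. queried q n ?T x 0 (\<lambda>i t. ?G x (min 0 t) i))"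
      by (rule reaches_cong) (simp add: queried_def answer_def)
    then show ?case by simp
  next
    case (Suc s)
    let ?H = "\<lambda>x i t. if marked n P x i \<and> t > s then - ?G x (min s t) i else ?G x (min s t) i"
    let ?\<sigma> = "\<lambda>j. if j div ?T div q < n \<and> P (j div ?T div q) (j div ?T mod q) \<and> j mod ?T > s
                 then -1 else 1 :: complex"
    have IH: "reaches q n ?T (q * s) (\<lambda>x. queried q n ?T x 0 (\<lambda>i t. ?G x (min s t) i))"
      using Suc by simp
    from reaches_sign[OF reaches_queried[OF IH, of 1], of ?\<sigma>]
    have "reaches q n ?T (q * s + 1)
        (\<lambda>x j. ?\<sigma> j * queried q n ?T x (0 + 1) (\<lambda>i t. ?G x (min s t) i) j)" by simp
    then have "reaches q n ?T (q * s + 1) (\<lambda>x. queried q n ?T x 1 (?H x))"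
    proof (rule reaches_cong)
      fix x j assume x: "x \<in> strings q n"
      \<comment> \<open>Symbols below \<open>q\<close> are not changed by the reduction modulo
        \<open>q\<close>, so one query from 0 shows the symbol itself and the predicate
        \<open>P\<close> can be read off the answer register.\<close>
      have "x ! i < q" if "i < n" for i using x that nth_mem by (fastforce simp: strings_def)
      then show "?\<sigma> j * queried q n ?T x (0 + 1) (\<lambda>i t. ?G x (min s t) i) j = queried q n ?T x 1 (?H x) j"
        by (auto simp: queried_def answer_def marked_def)
    qed
    from reaches_queried[OF this, of "q - 1"]
    have "reaches q n ?T (q * s + q) (\<lambda>x. queried q n ?T x q (?H x))" using q by simp
    moreover have "queried q n ?T x q a = queried q n ?T x 0 a" for x a
      by (simp add: queried_def answer_def fun_eq_iff)
    ultimately have "reaches q n ?T (q * Suc s) (\<lambda>x. queried q n ?T x 0 (?H x))"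
      by (simp add: algebra_simps)
    moreover have d: "qdim q n ?T = Suc n * (q * ?T)"
      by (simp only: qdim_def Suc_eq_plus1 mult.assoc)
    \<comment> \<open>The reflection touches the index register only, controlled by the counter,
      which is the low digit of the block label \<open>e\<close>.\<close>
    let ?N = "\<lambda>e. if e mod ?T > s
      then (\<lambda>i l. complex_of_real (2 * r i * r l - (if i = l then 1 else 0)))
      else (\<lambda>i j. if i = j then 1 else 0)"
    have "isometry_on (Suc n) (?N e)" for e
      using isometry_on_reflection[OF r] isometry_on_id by simp
    ultimately have "reaches q n ?T (q * Suc s) (\<lambda>x j. \<Sum>i<Suc n.
        ?N (j mod (q * ?T)) (j div (q * ?T)) i * queried q n ?T x 0 (?H x) (i * (q * ?T) + j mod (q * ?T)))"
      by (intro reaches_block[OF _ d]) auto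
    then show ?case
    proof (rule reaches_cong)
      fix x j assume j: "j < qdim q n ?T"
      define i b w where "i = j div ?T div q" and "b = j div ?T mod q" and "w = j mod ?T"
      have jeq: "j = (i * q + b) * ?T + w" unfolding i_def b_def w_def by (rule triple_index_eq)
      have bw: "b < q" "w < ?T" "i \<le> n"
        using triple_index_bounds[OF j] unfolding i_def b_def w_def by auto
      define e where "e = b * ?T + w"
      have "e < (b + 1) * ?T" using bw by (simp add: e_def)
      also have "\<dots> \<le> q * ?T" using bw by (intro mult_right_mono) auto
      finally have eq: "e < q * ?T" .
      have jie: "j = i * (q * ?T) + e" unfolding jeq e_def by (simp add: algebra_simps)
      have je: "j mod (q * ?T) = e" "j div (q * ?T) = i"
        unfolding jie using eq q by (simp_all del: mult_Suc_right)
      have ew: "e mod ?T = w" using bw by (simp add: e_def del: mult_Suc_right)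
      have state: "queried q n ?T x 0 (?H x) (l * (q * ?T) + e)
          = (if b = 0 then of_real (?H x l w) else 0)" for l
      proof -
        have "l * (q * ?T) + e = (l * q + b) * ?T + w" by (simp add: e_def algebra_simps)
        then show ?thesis using queried_triple[OF bw(1,2)] by (simp add: answer_def)
      qed
      have rhs: "queried q n ?T x 0 (\<lambda>i t. ?G x (min (Suc s) t) i) j
          = (if b = 0 then of_real (?G x (min (Suc s) w) i) else 0)"
        unfolding jeq queried_triple[OF bw(1,2)] by (simp add: answer_def)
      have key: "(\<Sum>l<Suc n. (if w > s
          then (\<lambda>i l. complex_of_real (2 * r i * r l - (if i = l then 1 else 0)))
          else (\<lambda>i j. if i = j then 1 else 0)) i l * complex_of_real (?H x l w))
        = complex_of_real (?G x (min (Suc s) w) i)"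
      proof (cases "w > s")
        case True
        then have w: "min s w = s" "min (Suc s) w = Suc s" by auto
        define h where "h l = (if marked n P x l then - grover n r (marked n P x) s l
                               else grover n r (marked n P x) s l)" for l
        have H: "?H x l w = h l / sqrt ?T" for l using True w by (simp add: h_def)
        have "(\<Sum>l<Suc n. (2 * r i * r l - (if i = l then 1 else 0)) * (h l / sqrt ?T))
            = (\<Sum>l<Suc n. 2 * r i * (r l * h l) / sqrt ?T - (if l = i then h i / sqrt ?T else 0))"
          by (intro sum.cong refl) (auto simp: divide_inverse algebra_simps)
        also have "\<dots> = (2 * r i * (\<Sum>l<Suc n. r l * h l) - h i) / sqrt ?T"
          unfolding sum_subtractf sum_divide_distrib[symmetric] sum_distrib_left[symmetric]
          using bw(3) by (simp add: sum.delta diff_divide_distrib del: sum.lessThan_Suc)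
        also have "\<dots> = ?G x (min (Suc s) w) i" unfolding w by (simp add: h_def)
        finally have eq: "(\<Sum>l<Suc n. (2 * r i * r l - (if i = l then 1 else 0)) * (h l / sqrt ?T))
            = ?G x (min (Suc s) w) i" .
        show ?thesis
          unfolding H eq[symmetric] using True by (simp only: if_True of_real_mult of_real_sum)
      next
        case False
        then have w: "min s w = w" "min (Suc s) w = w" by auto
        have "(\<Sum>l<Suc n. (if i = l then 1 else 0) * complex_of_real (?H x l w))
            = (\<Sum>l<Suc n. if l = i then complex_of_real (?G x w i) else 0)"
          using False w by (intro sum.cong refl) auto
        also have "\<dots> = complex_of_real (?G x w i)"
          using bw(3) by (simp add: sum.delta del: sum.lessThan_Suc)
        finally show ?thesis unfolding w using False by (simp only: if_False)
      qed
      show "(\<Sum>l<Suc n. ?N (j mod (q * ?T)) (j div (q * ?T)) l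
            * queried q n ?T x 0 (?H x) (l * (q * ?T) + j mod (q * ?T)))
          = queried q n ?T x 0 (\<lambda>i t. ?G x (min (Suc s) t) i) j"
        unfolding je state rhs ew
      proof (cases "b = 0")
        case True
        show "(\<Sum>l<Suc n. (if w > s
            then (\<lambda>i l. complex_of_real (2 * r i * r l - (if i = l then 1 else 0)))
            else (\<lambda>i j. if i = j then 1 else 0)) i l
              * (if b = 0 then complex_of_real (?H x l w) else 0))
          = (if b = 0 then complex_of_real (?G x (min (Suc s) w) i) else 0)"
          using key by (simp only: True if_True refl)
      qed simp
    qed
  qed
  have "reaches q n ?T (q * S + 1) (\<lambda>x. queried q n ?T x (0 + 1) (\<lambda>i t. ?G x (min S t) i))"
    by (rule reaches_queried[OF main]) simp
  then show ?thesis
  proof (rule reaches_cong)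
    fix x j
    have "j mod ?T \<le> S" by (simp add: less_Suc_eq_le[symmetric])
    then show "queried q n ?T x (0 + 1) (\<lambda>i t. ?G x (min S t) i) j = queried q n ?T x 1 (\<lambda>i t. ?G x t i) j"
      by (simp add: queried_def min_absorb2)
  qed
qed

text \<open>In the plane spanned by the marked and the unmarked part of \<open>r\<close>, the start
  vector has angle \<open>\<theta>\<close> and every round rotates by \<open>2 * \<theta>\<close>.
  The divisions by \<open>sin \<theta>\<close> and \<open>cos \<theta>\<close> normalize the two
  parts.\<close>

lemma grover_closed_form:
  fixes r :: "nat \<Rightarrow> real"
  assumes s: "sin \<theta> \<noteq> 0" and c: "cos \<theta> \<noteq> 0"
    and M: "(\<Sum>l | l < Suc n \<and> M l. (r l)\<^sup>2) = (sin \<theta>)\<^sup>2"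
    and M': "(\<Sum>l | l < Suc n \<and> \<not> M l. (r l)\<^sup>2) = (cos \<theta>)\<^sup>2"
  shows "grover n r M t i = r i * (if M i then sin ((2 * real t + 1) * \<theta>) / sin \<theta>
                                   else cos ((2 * real t + 1) * \<theta>) / cos \<theta>)"
proof (induction t arbitrary: i)
  case (Suc t)
  let ?a = "(2 * real t + 1) * \<theta>"
  have arg: "?a + \<theta> = (2 * real t + 2) * \<theta>" "(2 * real (Suc t) + 1) * \<theta> = ?a + \<theta> + \<theta>"
    by (simp_all add: algebra_simps)
  have "(\<Sum>l<Suc n. r l * (if M l then - grover n r M t l else grover n r M t l))
      = (\<Sum>l<Suc n. (if M l then - (sin ?a / sin \<theta>) * (r l)\<^sup>2 else 0)
                   + (if \<not> M l then (cos ?a / cos \<theta>) * (r l)\<^sup>2 else 0))"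
    by (intro sum.cong refl) (simp add: Suc.IH power2_eq_square)
  also have "\<dots> = - (sin ?a / sin \<theta>) * (sin \<theta>)\<^sup>2 + (cos ?a / cos \<theta>) * (cos \<theta>)\<^sup>2"
    unfolding sum.distrib M[symmetric] M'[symmetric] sum_distrib_left
    by (simp only: sum.inter_filter[symmetric, OF finite_lessThan] lessThan_iff)
  also have "\<dots> = cos (?a + \<theta>)"
    using s c by (simp add: cos_add power2_eq_square)
  finally have mean: "(\<Sum>l<Suc n. r l * (if M l then - grover n r M t l else grover n r M t l))
      = cos (?a + \<theta>)" .
  have 1: "sin (?a + \<theta> + \<theta>) = sin ?a + 2 * cos (?a + \<theta>) * sin \<theta>"
  proof -
    have "sin ?a = sin (?a + \<theta> - \<theta>)" by simp
    then show ?thesis unfolding sin_add[of "?a + \<theta>" \<theta>] sin_diff[of "?a + \<theta>" \<theta>] by simp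
  qed
  have 2: "cos (?a + \<theta> + \<theta>) = 2 * cos (?a + \<theta>) * cos \<theta> - cos ?a"
  proof -
    have "cos ?a = cos (?a + \<theta> - \<theta>)" by simp
    then show ?thesis unfolding cos_add[of "?a + \<theta>" \<theta>] cos_diff[of "?a + \<theta>" \<theta>] by simp
  qed
  have "grover n r M (Suc t) i = 2 * r i * cos (?a + \<theta>)
      - (if M i then - grover n r M t i else grover n r M t i)"
    unfolding grover.simps mean ..
  also have "\<dots> = r i * (if M i then sin (?a + \<theta> + \<theta>) / sin \<theta> else cos (?a + \<theta> + \<theta>) / cos \<theta>)"
    using s c unfolding 1 2 by (simp add: Suc.IH field_simps)
  finally show ?case unfolding arg(2) .
qed (use s c in simp)

text \<open>The double angle formula turns the squares into cosines, which telescope against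
  \<open>2 * sin (2 * \<theta>)\<close>. The factor stays on the left to avoid a division.\<close>

lemma sum_sin_squares:
  "4 * sin (2 * \<theta>) * (\<Sum>t<T. (sin ((2 * real t + 1) * \<theta>))\<^sup>2)
     = 2 * real T * sin (2 * \<theta>) - sin (4 * real T * \<theta>)"
proof (induction T)
  case (Suc T)
  let ?b = "(4 * real T + 2) * \<theta>"
  have sq: "(sin ((2 * real T + 1) * \<theta>))\<^sup>2 = (1 - cos ?b) / 2"
    using cos_double_sin[of "(2 * real T + 1) * \<theta>"] by (simp add: algebra_simps)
  have telescope: "2 * sin (2 * \<theta>) * cos ?b = sin (4 * real (Suc T) * \<theta>) - sin (4 * real T * \<theta>)"
  proof -
    have e: "4 * real (Suc T) * \<theta> = ?b + 2 * \<theta>" "4 * real T * \<theta> = ?b - 2 * \<theta>"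
      by (simp_all add: algebra_simps)
    show ?thesis unfolding e sin_add sin_diff by simp
  qed
  have "4 * sin (2 * \<theta>) * (\<Sum>t<Suc T. (sin ((2 * real t + 1) * \<theta>))\<^sup>2)
      = 4 * sin (2 * \<theta>) * (\<Sum>t<T. (sin ((2 * real t + 1) * \<theta>))\<^sup>2)
        + 4 * sin (2 * \<theta>) * (sin ((2 * real T + 1) * \<theta>))\<^sup>2"
    by (simp add: distrib_left)
  moreover have "4 * sin (2 * \<theta>) * (sin ((2 * real T + 1) * \<theta>))\<^sup>2
      = 2 * sin (2 * \<theta>) - 2 * sin (2 * \<theta>) * cos ?b"
    unfolding sq by (simp add: right_diff_distrib)
  moreover have "2 * real (Suc T) * sin (2 * \<theta>) = 2 * real T * sin (2 * \<theta>) + 2 * sin (2 * \<theta>)"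
    by (simp add: algebra_simps)
  ultimately show ?case using Suc.IH telescope by linarith
qed simp

text \<open>Averaged over \<open>t\<close>, the success probability is 1/2 minus
  \<open>sin (4 * T * \<theta>) / (4 * T * sin (2 * \<theta>))\<close>. From \<open>p <= 1/2\<close>
  the square of \<open>sin (2 * \<theta>)\<close>, which is \<open>4 * p * (1 - p)\<close>, is at
  least \<open>2 * p\<close> and so at least \<open>1 / W\<close>. Hence
  \<open>T * sin (2 * \<theta>)\<close> is at least 4 and the error term at most 1/16.\<close>

lemma grover_success:
  fixes r :: "nat \<Rightarrow> real"
  assumes r: "(\<Sum>i<Suc n. (r i)\<^sup>2) = 1" and W: "W > 0" and T: "4 * sqrt W \<le> real T"
    and p_def: "p = (\<Sum>l | l < Suc n \<and> M l. (r l)\<^sup>2)" and p: "1 / (2 * W) \<le> p" "p \<le> 1/2"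
  shows "(\<Sum>l | l < Suc n \<and> M l. \<Sum>t<T. (grover n r M t l / sqrt (real T))\<^sup>2) \<ge> 7/16"
proof -
  have T0: "real T > 0" using W T by (smt (verit) real_sqrt_gt_0_iff)
  have p0: "p > 0" using p(1) W by (smt (verit) divide_pos_pos)
  define \<theta> where "\<theta> = arcsin (sqrt p)"
  have sp: "- 1 \<le> sqrt p" "sqrt p \<le> 1" using p0 p by (auto intro: order_trans[of _ 0])
  have sin: "sin \<theta> = sqrt p" using sp by (simp add: \<theta>_def)
  have cos: "cos \<theta> = sqrt (1 - p)" using sp p0 by (simp add: \<theta>_def cos_arcsin)
  have pos: "sin \<theta> > 0" "cos \<theta> > 0" using p0 p by (auto simp: sin cos)
  have sin2: "(sin \<theta>)\<^sup>2 = p" and cos2: "(cos \<theta>)\<^sup>2 = 1 - p" using p0 p by (auto simp: sin cos)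
  have "(\<Sum>i<Suc n. (r i)\<^sup>2) = (\<Sum>l | l < Suc n \<and> M l. (r l)\<^sup>2) + (\<Sum>l | l < Suc n \<and> \<not> M l. (r l)\<^sup>2)"
    by (subst sum.union_disjoint[symmetric]) (auto intro!: sum.cong simp del: sum.lessThan_Suc)
  then have M': "(\<Sum>l | l < Suc n \<and> \<not> M l. (r l)\<^sup>2) = (cos \<theta>)\<^sup>2"
    using r unfolding cos2 p_def by simp
  have M: "(\<Sum>l | l < Suc n \<and> M l. (r l)\<^sup>2) = (sin \<theta>)\<^sup>2" by (simp add: sin2 p_def)
  let ?A = "\<Sum>t<T. (sin ((2 * real t + 1) * \<theta>))\<^sup>2"
  have "(\<Sum>l | l < Suc n \<and> M l. \<Sum>t<T. (grover n r M t l / sqrt (real T))\<^sup>2)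
      = (\<Sum>l | l < Suc n \<and> M l. (r l)\<^sup>2 * (?A / (p * T)))"
  proof (rule sum.cong[OF refl])
    fix l assume "l \<in> {l. l < Suc n \<and> M l}"
    then have "(grover n r M t l / sqrt (real T))\<^sup>2
        = (r l)\<^sup>2 * ((sin ((2 * real t + 1) * \<theta>))\<^sup>2 / (p * T))" for t
      using pos grover_closed_form[OF _ _ M M', of t l]
      by (simp add: power_mult_distrib power_divide sin2)
    then show "(\<Sum>t<T. (grover n r M t l / sqrt (real T))\<^sup>2) = (r l)\<^sup>2 * (?A / (p * T))"
      by (simp add: sum_distrib_left sum_divide_distrib)
  qed
  also have "\<dots> = ?A / T"
    unfolding sum_distrib_right[symmetric] p_def[symmetric] using p0 by simp
  finally have eq: "(\<Sum>l | l < Suc n \<and> M l. \<Sum>t<T. (grover n r M t l / sqrt (real T))\<^sup>2) = ?A / T" .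
  let ?s = "sin (2 * \<theta>)"
  have s0: "?s > 0" using pos by (simp add: sin_double)
  have "?s\<^sup>2 = 4 * p * (1 - p)" by (simp add: sin_double power_mult_distrib sin2 cos2)
  also have "\<dots> \<ge> 4 * p * (1/2)" using p0 p by (intro mult_left_mono) auto
  finally have "1 / W \<le> ?s\<^sup>2" using p(1) by (simp add: field_simps)
  then have "sqrt (1 / W) \<le> ?s" using s0 by (auto intro: real_le_lsqrt)
  then have "1 \<le> ?s * sqrt W" using W by (simp add: real_sqrt_divide field_simps)
  also have "\<dots> \<le> ?s * (T / 4)" using T s0 by (intro mult_left_mono) auto
  finally have "4 * ?s * (7 / 16 * T) \<le> 2 * T * ?s - 1" by (simp add: algebra_simps)
  also have "\<dots> \<le> 4 * ?s * ?A" unfolding sum_sin_squares using sin_le_one[of "4 * real T * \<theta>"] by simp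
  finally have "7 / 16 * T \<le> ?A" using s0 by simp
  then show ?thesis unfolding eq using T0 by (simp add: field_simps)
qed

lemma norm_reaches:
  assumes "reaches q n m k \<Psi>" "q > 0" "x \<in> strings q n"
  shows "(\<Sum>j<qdim q n m. (cmod (\<Psi> x j))\<^sup>2) = 1"
proof -
  obtain U where U: "query_algorithm q n k m U"
    "\<And>j. j < qdim q n m \<Longrightarrow> final_state q n m U x k $ j = \<Psi> x j"
    using assms unfolding reaches_def by blast
  have "(\<Sum>j<qdim q n m. (cmod (\<Psi> x j))\<^sup>2)
      = (vnorm (qdim q n m) (\<lambda>j. final_state q n m U x k $ j))\<^sup>2"
    unfolding vnorm_square using U(2) by simp
  then show ?thesis using norm_final_state[OF U(1) order_refl assms(2)] by simp
qed

text \<open>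
  The null query \<open>n\<close> carries half of the initial weight, so that the marked weight is at most 1/2
  and the amplification angle stays away from \<open>\<pi>/2\<close>. A random number of iterations then succeeds
  with probability at least 7/16, and two runs with probability at least 1 - (9/16)^2 > 2/3.
\<close>

lemma query_search:
  fixes v :: "nat \<Rightarrow> real" and P :: "nat \<Rightarrow> nat \<Rightarrow> bool"
  assumes q: "q > 0" and v: "\<And>i. i < n \<Longrightarrow> v i \<ge> 0" and W_def: "W = (\<Sum>i<n. v i)" and W: "W \<ge> 1"
  obtains k m U and out :: "nat \<Rightarrow> nat \<times> nat" where
    "query_algorithm q n k m U" "real k \<le> 10 * real q * sqrt W"
    "\<And>x j. x \<in> strings q n \<Longrightarrow> j < qdim q n m \<Longrightarrow> final_state q n m U x k $ j \<noteq> 0 \<Longrightarrow>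
       fst (out j) < n \<Longrightarrow> snd (out j) = x ! fst (out j)"
    "\<And>x. x \<in> strings q n \<Longrightarrow> (\<Sum>i | i < n \<and> P i (x ! i). v i) \<ge> 1 \<Longrightarrow>
       output_prob (final_state q n m U x k) out {(i, b). i < n \<and> P i b} \<ge> 2/3"
proof -
  \<comment> \<open>With half of the mass at the null index, the marked mass is the marked weight
    divided by \<open>2 * W\<close>; for marked weight at least 1 it lies between
    \<open>1 / (2 * W)\<close> and 1/2.\<close>
  define r where "r i = (if i < n then sqrt (v i / (2 * W)) else sqrt (1/2))" for i
  have r2: "(r i)\<^sup>2 = v i / (2 * W)" if "i < n" for i using that v W by (simp add: r_def)
  have r: "(\<Sum>i<Suc n. (r i)\<^sup>2) = 1"
  proof -
    have "(\<Sum>i<n. (r i)\<^sup>2) = W / (2 * W)" unfolding W_def sum_divide_distrib using r2 by (simp add: W_def)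
    then show ?thesis using W by (simp add: r_def)
  qed
  define S where "S = nat \<lfloor>4 * sqrt W\<rfloor>"
  have sW: "sqrt W \<ge> 1" using W by simp
  have S: "real S \<le> 4 * sqrt W" "4 * sqrt W \<le> real (Suc S)"
    unfolding S_def using sW by linarith+
  let ?T = "Suc S" and ?V = "{(i, b). i < n \<and> P i b}"
  define d where "d = qdim q n ?T"
  define \<Psi> where "\<Psi> x = queried q n ?T x 1 (\<lambda>i t. grover n r (marked n P x) t i / sqrt ?T)" for x
  have single: "reaches q n ?T (q * S + 1) \<Psi>"
    unfolding \<Psi>_def by (rule reaches_grover[OF r q])
  have d0: "d > 0" using q by (simp add: d_def qdim_def)
  define m where "m = ?T * d"
  define k where "k = 2 * (q * S + 1)"
  have dd: "qdim q n m = d * d" by (simp add: m_def d_def qdim_def algebra_simps)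
  have twice: "reaches q n m k (\<lambda>x J. \<Psi> x (J div d) * \<Psi> x (J mod d))"
    using reaches_twice[OF single q] unfolding m_def k_def d_def .
  obtain U where U: "query_algorithm q n k m U"
    "\<And>x j. x \<in> strings q n \<Longrightarrow> j < d * d \<Longrightarrow>
       final_state q n m U x k $ j = \<Psi> x (j div d) * \<Psi> x (j mod d)"
    using twice unfolding reaches_def dd by blast
  \<comment> \<open>A label consists of the queried position and the symbol in the answer register;
    of the two copies the first one decides if its label is valid.\<close>
  define lab where "lab j = (j div ?T div q, j div ?T mod q)" for j
  define out where "out j = (if lab (j div d) \<in> ?V then lab (j div d) else lab (j mod d))" for j
  have lab: "snd (lab j) = x ! fst (lab j)"
    if "x \<in> strings q n" "\<Psi> x j \<noteq> 0" "fst (lab j) < n" for x j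
  proof -
    have "x ! fst (lab j) < q" using that(1,3) nth_mem by (fastforce simp: strings_def)
    then show ?thesis
      using that(2,3) by (auto simp: \<Psi>_def queried_def lab_def answer_def split: if_splits)
  qed
  show ?thesis
  proof (rule that[of k m U out, OF U(1)])
    \<comment> \<open>Two runs of \<open>q * S + 1\<close> queries, with \<open>S\<close> at most
      \<open>4 * sqrt W\<close>; the summand 1 is absorbed by \<open>q * sqrt W\<close>, which gives
      the factor 10.\<close>
    have "real k = 2 * (q * real S + 1)" by (simp add: k_def)
    also have "\<dots> \<le> 2 * (q * (4 * sqrt W) + q * sqrt W)"
      using S(1) q sW mult_mono[of 1 "real q" 1 "sqrt W"]
      by (intro mult_left_mono add_mono) auto
    finally show "real k \<le> 10 * real q * sqrt W" by simp
  next
    fix x j assume "x \<in> strings q n" "j < qdim q n m" "final_state q n m U x k $ j \<noteq> 0"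
      "fst (out j) < n"
    then show "snd (out j) = x ! fst (out j)"
      using U(2)[of x j] lab unfolding dd out_def by (auto split: if_splits)
  next
    fix x assume x: "x \<in> strings q n" and wt: "(\<Sum>i | i < n \<and> P i (x ! i). v i) \<ge> 1"
    have xq: "x ! i < q" if "i < n" for i using x that nth_mem by (fastforce simp: strings_def)
    let ?M = "marked n P x"
    have set: "{l. l < Suc n \<and> ?M l} = {i. i < n \<and> P i (x ! i)}" by (auto simp: marked_def)
    have p: "(\<Sum>l | l < Suc n \<and> ?M l. (r l)\<^sup>2) = (\<Sum>i | i < n \<and> P i (x ! i). v i) / (2 * W)"
      unfolding set sum_divide_distrib by (intro sum.cong refl) (simp add: r2)
    have le: "(\<Sum>i | i < n \<and> P i (x ! i). v i) \<le> W"
      unfolding W_def by (rule sum_mono2) (use v in auto)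
    have "7/16 \<le> (\<Sum>l | l < Suc n \<and> ?M l. \<Sum>t<?T. (grover n r ?M t l / sqrt ?T)\<^sup>2)"
      by (rule grover_success[OF r _ S(2) refl, of ?M]) (use W wt le in \<open>auto simp: p field_simps\<close>)
    also have "\<dots> = (\<Sum>l<Suc n. if ?M l then \<Sum>t<?T. (grover n r ?M t l / sqrt ?T)\<^sup>2 else 0)"
      by (subst sum.inter_filter[symmetric]) auto
    also have "\<dots> = (\<Sum>i<Suc n. \<Sum>b<q. \<Sum>w<?T. if i < n \<and> P i b \<and> b = x ! i
          then (grover n r ?M w i / sqrt ?T)\<^sup>2 else 0)"
    proof (rule sum.cong[OF refl])
      fix i
      have "(\<Sum>b<q. \<Sum>w<?T. if i < n \<and> P i b \<and> b = x ! i then (grover n r ?M w i / sqrt ?T)\<^sup>2 else 0)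
          = (\<Sum>b<q. if b = x ! i then (if ?M i then \<Sum>w<?T. (grover n r ?M w i / sqrt ?T)\<^sup>2 else 0) else 0)"
        by (rule sum.cong[OF refl]) (auto simp: marked_def simp del: sum.lessThan_Suc)
      also have "\<dots> = (if ?M i then \<Sum>t<?T. (grover n r ?M t i / sqrt ?T)\<^sup>2 else 0)"
        using xq by (simp add: sum.delta marked_def del: sum.lessThan_Suc)
      finally show "(if ?M i then \<Sum>t<?T. (grover n r ?M t i / sqrt ?T)\<^sup>2 else 0)
          = (\<Sum>b<q. \<Sum>w<?T. if i < n \<and> P i b \<and> b = x ! i then (grover n r ?M w i / sqrt ?T)\<^sup>2 else 0)" ..
    qed
    also have "\<dots> = (\<Sum>j<d. if lab j \<in> ?V then (cmod (\<Psi> x j))\<^sup>2 else 0)"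
      unfolding d_def sum_qdim
    proof (intro sum.cong refl)
      fix i b w assume "b \<in> {..<q}" "w \<in> {..<?T}"
      then have bw: "b < q" "w < ?T" by auto
      show "(if i < n \<and> P i b \<and> b = x ! i then (grover n r ?M w i / sqrt ?T)\<^sup>2 else 0)
          = (if lab ((i * q + b) * ?T + w) \<in> ?V then (cmod (\<Psi> x ((i * q + b) * ?T + w)))\<^sup>2 else 0)"
        unfolding lab_def \<Psi>_def queried_triple[OF bw] triple_index[OF bw]
        using xq[of i] by (auto simp: answer_def norm_divide power_divide simp del: of_nat_Suc)
    qed
    finally have good: "7/16 \<le> (\<Sum>j<d. if lab j \<in> ?V then (cmod (\<Psi> x j))\<^sup>2 else 0)" .
    have norm: "(\<Sum>j<d. (cmod (\<Psi> x j))\<^sup>2) = 1" unfolding d_def by (rule norm_reaches[OF single q x])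
    define B where "B = (\<Sum>j<d. if lab j \<notin> ?V then (cmod (\<Psi> x j))\<^sup>2 else 0)"
    have "(\<Sum>j<d. if lab j \<in> ?V then (cmod (\<Psi> x j))\<^sup>2 else 0) + B = 1"
      unfolding B_def norm[symmetric] sum.distrib[symmetric] by (intro sum.cong refl) auto
    then have B: "B \<le> 9/16" using good by simp
    have B0: "B \<ge> 0" unfolding B_def by (intro sum_nonneg) auto
    let ?\<psi> = "final_state q n m U x k"
    have dim: "dim_vec ?\<psi> = d * d" using dim_final_state[OF U(1)] dd by simp
    have "output_prob ?\<psi> out ?V = (\<Sum>j<d * d. if out j \<in> ?V then (cmod (?\<psi> $ j))\<^sup>2 else 0)"
      unfolding output_prob_def dim by (subst sum.inter_filter[symmetric]) (auto intro!: sum.cong)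
    \<comment> \<open>The pair fails exactly if both labels fail, so the success probability is the
      product of the totals minus the product of the failing parts.\<close>
    also have "\<dots> = (\<Sum>i<d. \<Sum>s<d. (cmod (\<Psi> x i))\<^sup>2 * (cmod (\<Psi> x s))\<^sup>2
        - (if lab i \<notin> ?V then (cmod (\<Psi> x i))\<^sup>2 else 0) * (if lab s \<notin> ?V then (cmod (\<Psi> x s))\<^sup>2 else 0))"
      unfolding sum_mult_index
    proof (intro sum.cong refl)
      fix i s assume i_s: "i \<in> {..<d}" "s \<in> {..<d}"
      then have "i * d + s < (i + 1) * d" by simp
      also have "\<dots> \<le> d * d" using i_s by (intro mult_right_mono) auto
      finally have lt: "i * d + s < d * d" .
      show "(if out (i * d + s) \<in> ?V then (cmod (?\<psi> $ (i * d + s)))\<^sup>2 else 0)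
          = (cmod (\<Psi> x i))\<^sup>2 * (cmod (\<Psi> x s))\<^sup>2
            - (if lab i \<notin> ?V then (cmod (\<Psi> x i))\<^sup>2 else 0) * (if lab s \<notin> ?V then (cmod (\<Psi> x s))\<^sup>2 else 0)"
        unfolding U(2)[OF x lt] out_def using i_s
        by (auto simp: norm_mult power_mult_distrib simp del: mem_Collect_eq)
    qed
    also have "\<dots> = 1 - B\<^sup>2"
      unfolding sum_subtractf sum_product[symmetric] norm B_def by (simp add: power2_eq_square)
    also have "\<dots> \<ge> 1 - (9/16)\<^sup>2"
      using B B0 by (intro diff_left_mono power_mono) auto
    finally show "2/3 \<le> output_prob ?\<psi> out ?V" by (simp add: power2_eq_square)
  qed
qed

section \<open>Fractional certificates\<close>

definition far :: "(nat list \<rightharpoonup> bool) \<Rightarrow> nat list \<Rightarrow> nat list set" where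
  "far f z = {y \<in> dom f. f y \<noteq> f z}"

definition frac_cert :: "nat \<Rightarrow> (nat list \<rightharpoonup> bool) \<Rightarrow> nat list \<Rightarrow> (nat \<Rightarrow> real) \<Rightarrow> bool" where
  "frac_cert n f z v \<longleftrightarrow> (\<forall>i<n. v i \<ge> 0) \<and>
     (\<forall>y\<in>far f z. (\<Sum>i | i < n \<and> y ! i \<noteq> z ! i. v i) \<ge> 1)"

text \<open>The square root is taken inside the infimum, so a bound proved for each single
  certificate passes to the infimum directly.\<close>

definition sqrt_frac_cert :: "nat \<Rightarrow> (nat list \<rightharpoonup> bool) \<Rightarrow> nat list \<Rightarrow> real" where
  "sqrt_frac_cert n f z = Inf {sqrt (\<Sum>i<n. v i) | v. frac_cert n f z v}"

lemma sum_residues: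
  fixes u :: "nat \<Rightarrow> real"
  assumes "finite I"
  shows "(\<Sum>j\<in>I. \<Sum>i | i < N \<and> i mod n = j. u i) = (\<Sum>i | i < N \<and> i mod n \<in> I. u i)"
proof -
  have "(\<Sum>j\<in>I. \<Sum>i | i < N \<and> i mod n = j. u i) = sum u (\<Union>j\<in>I. {i. i < N \<and> i mod n = j})"
    using assms by (subst sum.UNION_disjoint) auto
  also have "(\<Union>j\<in>I. {i. i < N \<and> i mod n = j}) = {i. i < N \<and> i mod n \<in> I}" by auto
  finally show ?thesis .
qed

text \<open>
  The residue modulo \<open>n\<close> covers both input models of the sabotage problems: in the strong one a
  position of the input of length \<open>3 n\<close> is mapped to the position inside its block.
\<close>

lemma weights_of_algorithm:
  assumes alg: "query_algorithm q N k m U" and q: "q > 0" and n: "n > 0"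
  obtains v :: "nat \<Rightarrow> real" where "\<And>i. v i \<ge> 0" "(\<Sum>i<n. v i) \<le> 576 * (real k)\<^sup>2"
    "\<And>s y. (\<And>i. i < N \<Longrightarrow> s ! i \<noteq> s0 ! i \<Longrightarrow> y ! (i mod n) \<noteq> z ! (i mod n)) \<Longrightarrow>
       vdist (final_state q N m U s k) (final_state q N m U s0 k) \<ge> 1/12 \<Longrightarrow>
       (\<Sum>i | i < n \<and> y ! i \<noteq> z ! i. v i) \<ge> 1"
proof -
  obtain u where u: "\<And>i. u i \<ge> 0" "(\<Sum>i<N. u i) \<le> real k"
    "\<And>s. vdist (final_state q N m U s k) (final_state q N m U s0 k)
           \<le> 2 * sqrt (real k * (\<Sum>i | i < N \<and> s ! i \<noteq> s0 ! i. u i))"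
    by (rule query_weights[OF alg q, of s0]) blast
  \<comment> \<open>From \<open>1/12 \<le> 2 * sqrt (real k * ?X)\<close> follows
    \<open>1 \<le> 576 * real k * ?X\<close>, which fixes the scaling. Positions with the same
    residue are pooled because in the strong model they stand for the same coordinate.\<close>
  define v where "v j = 576 * real k * (\<Sum>i | i < N \<and> i mod n = j. u i)" for j
  have pos: "v j \<ge> 0" for j unfolding v_def using u(1) by (intro mult_nonneg_nonneg sum_nonneg) auto
  have sum_v: "(\<Sum>j\<in>I. v j) = 576 * real k * (\<Sum>i | i < N \<and> i mod n \<in> I. u i)" if "finite I" for I
    unfolding v_def sum_distrib_left[symmetric] sum_residues[OF that] ..
  have "{i. i < N \<and> i mod n \<in> {..<n}} = {..<N}" using n by auto
  then have "(\<Sum>j<n. v j) = 576 * real k * (\<Sum>i<N. u i)" using sum_v[of "{..<n}"] by simp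
  also have "\<dots> \<le> 576 * real k * real k" using u(2) by (intro mult_left_mono) auto
  finally have total: "(\<Sum>j<n. v j) \<le> 576 * (real k)\<^sup>2" by (simp add: power2_eq_square)
  have "(\<Sum>i | i < n \<and> y ! i \<noteq> z ! i. v i) \<ge> 1"
    if diff: "\<And>i. i < N \<Longrightarrow> s ! i \<noteq> s0 ! i \<Longrightarrow> y ! (i mod n) \<noteq> z ! (i mod n)"
      and dist: "vdist (final_state q N m U s k) (final_state q N m U s0 k) \<ge> 1/12" for s y
  proof -
    let ?X = "\<Sum>i | i < N \<and> s ! i \<noteq> s0 ! i. u i"
    have X: "?X \<ge> 0" using u(1) by (intro sum_nonneg) auto
    have "1/12 \<le> 2 * sqrt (real k * ?X)" using u(3)[of s] dist by linarith
    then have "1/24 \<le> sqrt (real k * ?X)" by simp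
    then have "(1/24)\<^sup>2 \<le> (sqrt (real k * ?X))\<^sup>2" by (intro power_mono) auto
    then have "1 \<le> 576 * real k * ?X" using X by (simp add: power2_eq_square)
    also have "\<dots> \<le> 576 * real k * (\<Sum>i | i < N \<and> i mod n \<in> {i. i < n \<and> y ! i \<noteq> z ! i}. u i)"
      using u(1) diff n by (intro mult_left_mono sum_mono2) auto
    also have "\<dots> = (\<Sum>i | i < n \<and> y ! i \<noteq> z ! i. v i)" by (rule sum_v[symmetric]) simp
    finally show ?thesis .
  qed
  from that[OF pos total this] show ?thesis .
qed

text \<open>Outcomes of zero amplitude are exempt from the inclusion. This is how the correctness of
  labels, known only for nonzero amplitudes, enters the bound for the sabotage search.\<close>

lemma output_prob_mono:
  assumes "\<And>j. j < dim_vec v \<Longrightarrow> v $ j \<noteq> 0 \<Longrightarrow> out j \<in> V \<Longrightarrow> out' j \<in> V'"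
  shows "output_prob v out V \<le> output_prob v out' V'"
proof -
  have "output_prob v out V = (\<Sum>j | j < dim_vec v \<and> out j \<in> V \<and> v $ j \<noteq> 0. (cmod (v $ j))\<^sup>2)"
    unfolding output_prob_def by (rule sum.mono_neutral_right) auto
  also have "\<dots> \<le> output_prob v out' V'"
    unfolding output_prob_def by (rule sum_mono2) (use assms in auto)
  finally show ?thesis .
qed

lemma output_prob_sum:
  assumes "finite I"
  shows "output_prob v out I = (\<Sum>i\<in>I. output_prob v out {i})"
proof -
  have "(\<Sum>i\<in>I. output_prob v out {i})
      = sum (\<lambda>j. (cmod (v $ j))\<^sup>2) (\<Union>i\<in>I. {j. j < dim_vec v \<and> out j \<in> {i}})"
    unfolding output_prob_def using assms by (subst sum.UNION_disjoint) auto
  also have "(\<Union>i\<in>I. {j. j < dim_vec v \<and> out j \<in> {i}}) = {j. j < dim_vec v \<and> out j \<in> I}" by auto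
  finally show ?thesis by (simp add: output_prob_def)
qed

lemma output_prob_final_Compl:
  assumes "query_algorithm q n k m U" "q > 0"
  shows "output_prob (final_state q n m U x k) out V + output_prob (final_state q n m U x k) out (- V) = 1"
  unfolding output_prob_Compl dim_final_state[OF assms(1) order_refl]
  using norm_final_state[OF assms(1) order_refl assms(2)] by simp

lemma output_prob_final_diff:
  assumes "query_algorithm q n k m U" "q > 0"
  shows "output_prob (final_state q n m U x k) out V - output_prob (final_state q n m U y k) out V
       \<le> 2 * vdist (final_state q n m U x k) (final_state q n m U y k)"
  by (rule output_prob_diff_le) (use assms dim_final_state norm_final_state in auto)

lemma vdist_final_commute:
  assumes "query_algorithm q n k m U"
  shows "vdist (final_state q n m U x k) (final_state q n m U y k)
       = vdist (final_state q n m U y k) (final_state q n m U x k)"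
  by (rule vdist_commute) (simp add: dim_final_state[OF assms])

lemma strings_nth_less: "x \<in> strings q n \<Longrightarrow> i < n \<Longrightarrow> x ! i < q"
  using nth_mem by (fastforce simp: strings_def)

lemma Compl_bool: "- {True} = {False}" "- {False} = {True}"
  by auto

lemma trivial_algorithm:
  assumes "q > 0" obtains U where "query_algorithm q n 0 1 U"
proof -
  have "isometry_on (qdim q n 1) (\<lambda>i j. 1\<^sub>m (qdim q n 1) $$ (i, j))"
    using isometry_on_id[of "qdim q n 1"] by (simp add: isometry_on_def)
  then have "query_algorithm q n 0 1 (\<lambda>_. 1\<^sub>m (qdim q n 1))"
    by (simp add: query_algorithm_def unitary_on_iff)
  then show ?thesis by (rule that)
qed

section \<open>The certification problem at a fixed input\<close>

locale pointed_function =
  fixes n :: nat and f :: "nat list \<rightharpoonup> bool" and z :: "nat list"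
  assumes f: "partial_boolean n f" and z: "z \<in> dom f"
begin

lemma z_strings: "z \<in> strings 2 n" and far_strings: "y \<in> far f z \<Longrightarrow> y \<in> strings 2 n"
  using f z by (auto simp: partial_boolean_def far_def)

lemma z_notin_far: "z \<notin> far f z"
  by (simp add: far_def)

lemma z_nth: "i < n \<Longrightarrow> z ! i < 2"
  by (rule strings_nth_less[OF z_strings])

lemma far_differs:
  assumes "y \<in> far f z" obtains i where "i < n" "y ! i \<noteq> z ! i"
proof -
  have "y \<noteq> z" "length y = n" "length z = n"
    using assms z_notin_far z_strings far_strings by (auto simp: strings_def)
  then show ?thesis using that by (metis nth_equalityI)
qed

text \<open>Provides a certificate in every case, so the infimum is over a nonempty set and every
  \<open>LEAST\<close> below is attained.\<close>

lemma frac_cert_ones: "frac_cert n f z (\<lambda>_. 1)"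
proof -
  have "1 \<le> real (card {i. i < n \<and> y ! i \<noteq> z ! i})" if y: "y \<in> far f z" for y
  proof -
    have "{i. i < n \<and> y ! i \<noteq> z ! i} \<noteq> {}" using far_differs[OF y] by blast
    then have "0 < card {i. i < n \<and> y ! i \<noteq> z ! i}" by (simp only: card_gt_0_iff) simp
    then show ?thesis by linarith
  qed
  then show ?thesis by (simp add: frac_cert_def)
qed

lemma sqrt_frac_cert_le:
  assumes "frac_cert n f z v" shows "sqrt_frac_cert n f z \<le> sqrt (\<Sum>i<n. v i)"
  unfolding sqrt_frac_cert_def
  by (rule cInf_lower) (use assms in \<open>auto simp: frac_cert_def intro!: bdd_belowI[of _ 0] sum_nonneg\<close>)

lemma le_sqrt_frac_cert:
  assumes "\<And>v. frac_cert n f z v \<Longrightarrow> a \<le> c * sqrt (\<Sum>i<n. v i)" "c > 0"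
  shows "a \<le> c * sqrt_frac_cert n f z"
proof -
  have "a / c \<le> sqrt_frac_cert n f z"
    unfolding sqrt_frac_cert_def
    by (rule cInf_greatest) (use assms frac_cert_ones in \<open>auto simp: divide_le_eq mult.commute\<close>)
  then show ?thesis using assms(2) by (simp add: divide_le_eq mult.commute)
qed

lemma frac_cert_total:
  assumes "frac_cert n f z v" "far f z \<noteq> {}" shows "(\<Sum>i<n. v i) \<ge> 1"
proof -
  obtain y where "y \<in> far f z" using assms by auto
  then have "1 \<le> (\<Sum>i | i < n \<and> y ! i \<noteq> z ! i. v i)" using assms by (auto simp: frac_cert_def)
  also have "\<dots> \<le> (\<Sum>i<n. v i)" by (rule sum_mono2) (use assms in \<open>auto simp: frac_cert_def\<close>)
  finally show ?thesis .
qed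

text \<open>All query measures have the form \<open>LEAST k. P k\<close>, so two translations
  suffice: certificates into algorithms and algorithms into certificates. The 40 is
  \<open>10 * q\<close> for the largest alphabet, \<open>q = 4\<close>. The bound \<open>c\<close>
  is a parameter because index search has \<open>25 * max 1 (real k)\<close> in place of
  \<open>24 * real k\<close>.\<close>

lemma Least_sqrt_frac_cert:
  assumes up: "\<And>v. frac_cert n f z v \<Longrightarrow> \<exists>k. P k \<and> real k \<le> 40 * sqrt (\<Sum>i<n. v i)"
    and down: "\<And>k. P k \<Longrightarrow> \<exists>v. frac_cert n f z v \<and> sqrt (\<Sum>i<n. v i) \<le> c k"
  shows "real (LEAST k. P k) \<le> 40 * sqrt_frac_cert n f z"
    and "sqrt_frac_cert n f z \<le> c (LEAST k. P k)"
proof -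
  show "real (LEAST k. P k) \<le> 40 * sqrt_frac_cert n f z"
  proof (rule le_sqrt_frac_cert)
    fix v assume "frac_cert n f z v"
    then obtain k where "P k" "real k \<le> 40 * sqrt (\<Sum>i<n. v i)" using up by blast
    then show "real (LEAST k. P k) \<le> 40 * sqrt (\<Sum>i<n. v i)"
      using Least_le[of P k] by linarith
  qed simp
  have "P (LEAST k. P k)" using up[OF frac_cert_ones] by (metis LeastI)
  then show "sqrt_frac_cert n f z \<le> c (LEAST k. P k)" using down sqrt_frac_cert_le by fastforce
qed

lemma sqrt_le_24: "W \<le> 576 * (real k)\<^sup>2 \<Longrightarrow> sqrt W \<le> 24 * real k"
  by (rule real_le_lsqrt) (auto simp: power_mult_distrib)

lemma frac_cert_of_dist:
  assumes alg: "query_algorithm 2 n k m U"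
    and dist: "\<And>y. y \<in> far f z \<Longrightarrow> vdist (final_state 2 n m U y k) (final_state 2 n m U z k) \<ge> 1/12"
  shows "\<exists>v. frac_cert n f z v \<and> sqrt (\<Sum>i<n. v i) \<le> 24 * real k"
\<comment> \<open>Residues modulo \<open>n\<close> require \<open>n > 0\<close>; for
  \<open>n = 0\<close> there is no far input.\<close>
proof (cases "n = 0")
  case True
  then have "far f z = {}" using far_differs by (metis ex_in_conv not_less_zero)
  then show ?thesis by (intro exI[of _ "\<lambda>_. 0"]) (simp add: frac_cert_def)
next
  case False
  then obtain v where v: "\<And>i. v i \<ge> 0" "(\<Sum>i<n. v i) \<le> 576 * (real k)\<^sup>2"
    "\<And>s y. (\<And>i. i < n \<Longrightarrow> s ! i \<noteq> z ! i \<Longrightarrow> y ! (i mod n) \<noteq> z ! (i mod n)) \<Longrightarrow>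
       vdist (final_state 2 n m U s k) (final_state 2 n m U z k) \<ge> 1/12 \<Longrightarrow>
       (\<Sum>i | i < n \<and> y ! i \<noteq> z ! i. v i) \<ge> 1"
    using weights_of_algorithm[OF alg, of n z z] by auto
  have "frac_cert n f z v" using v(1) v(3) dist by (simp add: frac_cert_def)
  then show ?thesis using sqrt_le_24[OF v(2)] by blast
qed

subsection \<open>Decision problems on the original input\<close>

text \<open>The search looks for a position that differs from \<open>z\<close>, and the input is
  rejected iff one is reported. Reported symbols are the true ones, so on \<open>z\<close> rejection
  has probability exactly 0.\<close>

lemma decision_algorithm:
  assumes v: "frac_cert n f z v"
  obtains k m U and acc :: "nat \<Rightarrow> bool" where "query_algorithm 2 n k m U"
    "real k \<le> 40 * sqrt (\<Sum>i<n. v i)"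
    "output_prob (final_state 2 n m U z k) acc {False} = 0"
    "\<And>y. y \<in> far f z \<Longrightarrow> output_prob (final_state 2 n m U y k) acc {False} \<ge> 2/3"
\<comment> \<open>Without far inputs the certificate may have total below 1, outside the range of
  the search; accepting always is then correct.\<close>
proof (cases "far f z = {}")
  case True
  obtain U where U: "query_algorithm 2 n 0 1 U" using trivial_algorithm[of 2] by auto
  show ?thesis
    by (rule that[of 0 1 U "\<lambda>_. True", OF U])
      (use True v in \<open>auto simp: output_prob_def frac_cert_def intro: sum_nonneg\<close>)
next
  case False
  let ?W = "\<Sum>i<n. v i"
  have W: "?W \<ge> 1" by (rule frac_cert_total[OF v False])
  have v0: "\<And>i. i < n \<Longrightarrow> v i \<ge> 0" using v by (simp add: frac_cert_def)
  show ?thesis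
  proof (rule query_search[where q = 2 and P = "\<lambda>i b. b \<noteq> z ! i", OF pos2 _ refl W], goal_cases)
    case (1 i)
    then show ?case by (rule v0)
  next
    case (2 k m U out)
    note alg = 2(1) and k = 2(2) and lab = 2(3) and succ = 2(4)
  let ?acc = "\<lambda>j. \<not> (fst (out j) < n \<and> snd (out j) \<noteq> z ! fst (out j))"
  show ?case
  proof (rule that[OF alg, of ?acc])
    show "real k \<le> 40 * sqrt ?W" using k W by simp
    show "output_prob (final_state 2 n m U z k) ?acc {False} = 0"
      unfolding output_prob_def using lab[OF z_strings] dim_final_state[OF alg]
      by (intro sum.neutral) auto
    fix y assume y: "y \<in> far f z"
    have "2/3 \<le> output_prob (final_state 2 n m U y k) out {(i, b). i < n \<and> b \<noteq> z ! i}"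
      by (rule succ[OF far_strings[OF y]]) (use v y in \<open>simp add: frac_cert_def\<close>)
    also have "\<dots> \<le> output_prob (final_state 2 n m U y k) ?acc {False}"
      by (rule output_prob_mono) auto
    finally show "2/3 \<le> output_prob (final_state 2 n m U y k) ?acc {False}" .
  qed
  qed
qed

lemma dom_cert_fun: "dom (cert_fun f z) = insert z (far f z)"
  using z by (auto simp: cert_fun_def far_def split: if_splits)

lemma cert_fun_z [simp]: "cert_fun f z z = Some True"
  and cert_fun_far: "y \<in> far f z \<Longrightarrow> cert_fun f z y = Some False"
  using z_notin_far by (auto simp: cert_fun_def far_def)

text \<open>For the lower bound: rejection has probability 0 on \<open>z\<close> and at least 1/2 on
  a far input, and probabilities differ by at most twice the distance, so the final states are at
  least 1/4 apart.\<close>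

lemma QC_at_bounds:
  "real (QC_at n f z) \<le> 40 * sqrt_frac_cert n f z" "sqrt_frac_cert n f z \<le> 24 * real (QC_at n f z)"
proof -
  let ?P = "\<lambda>k. \<exists>m U (acc :: nat \<Rightarrow> bool). query_algorithm 2 n k m U \<and>
     output_prob (final_state 2 n m U z k) acc {True} = 1 \<and>
     (\<forall>y\<in>dom f. f y \<noteq> f z \<longrightarrow> output_prob (final_state 2 n m U y k) acc {False} \<ge> 1/2)"
  have up: "\<exists>k. ?P k \<and> real k \<le> 40 * sqrt (\<Sum>i<n. v i)" if v: "frac_cert n f z v" for v
  proof -
    obtain k m U and acc :: "nat \<Rightarrow> bool" where *: "query_algorithm 2 n k m U"
      "real k \<le> 40 * sqrt (\<Sum>i<n. v i)"
      "output_prob (final_state 2 n m U z k) acc {False} = 0"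
      "\<And>y. y \<in> far f z \<Longrightarrow> output_prob (final_state 2 n m U y k) acc {False} \<ge> 2/3"
      by (rule decision_algorithm[OF v]) blast
    have "output_prob (final_state 2 n m U z k) acc {True} = 1"
      using output_prob_final_Compl[OF *(1), of z acc "{True}"] *(3) by (simp add: Compl_bool)
    moreover have "output_prob (final_state 2 n m U y k) acc {False} \<ge> 1/2"
      if "y \<in> dom f" "f y \<noteq> f z" for y
      using *(4)[of y] that by (simp add: far_def)
    ultimately show ?thesis using *(1,2) by blast
  qed
  have down: "\<exists>v. frac_cert n f z v \<and> sqrt (\<Sum>i<n. v i) \<le> 24 * real k" if P: "?P k" for k
  proof -
    obtain m U and acc :: "nat \<Rightarrow> bool" where *: "query_algorithm 2 n k m U"
      "output_prob (final_state 2 n m U z k) acc {True} = 1"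
      "\<And>y. y \<in> far f z \<Longrightarrow> output_prob (final_state 2 n m U y k) acc {False} \<ge> 1/2"
      using P by (auto simp: far_def)
    show ?thesis
    proof (rule frac_cert_of_dist[OF *(1)])
      fix y assume "y \<in> far f z"
      then have "output_prob (final_state 2 n m U y k) acc {False} \<ge> 1/2" by (rule *(3))
      moreover have "output_prob (final_state 2 n m U z k) acc {False} = 0"
        using output_prob_final_Compl[OF *(1), of z acc "{True}"] *(2) by (simp add: Compl_bool)
      ultimately show "1/12 \<le> vdist (final_state 2 n m U y k) (final_state 2 n m U z k)"
        using output_prob_final_diff[OF *(1), of y acc "{False}" z] by simp
    qed
  qed
  show "real (QC_at n f z) \<le> 40 * sqrt_frac_cert n f z"
    "sqrt_frac_cert n f z \<le> 24 * real (QC_at n f z)"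
    unfolding QC_at_def by - (rule Least_sqrt_frac_cert[OF up down]; assumption)+
qed

lemma Q_cert_bounds:
  "real (Q 2 n (cert_fun f z)) \<le> 40 * sqrt_frac_cert n f z"
  "sqrt_frac_cert n f z \<le> 24 * real (Q 2 n (cert_fun f z))"
proof -
  let ?P = "\<lambda>k. \<exists>m U (out :: nat \<Rightarrow> bool). query_algorithm 2 n k m U \<and>
     (\<forall>x\<in>dom (cert_fun f z).
        output_prob (final_state 2 n m U x k) out {the (cert_fun f z x)} \<ge> 2/3)"
  have up: "\<exists>k. ?P k \<and> real k \<le> 40 * sqrt (\<Sum>i<n. v i)" if v: "frac_cert n f z v" for v
  proof -
    obtain k m U and acc :: "nat \<Rightarrow> bool" where *: "query_algorithm 2 n k m U"
      "real k \<le> 40 * sqrt (\<Sum>i<n. v i)"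
      "output_prob (final_state 2 n m U z k) acc {False} = 0"
      "\<And>y. y \<in> far f z \<Longrightarrow> output_prob (final_state 2 n m U y k) acc {False} \<ge> 2/3"
      by (rule decision_algorithm[OF v]) blast
    have "output_prob (final_state 2 n m U z k) acc {True} = 1"
      using output_prob_final_Compl[OF *(1), of z acc "{True}"] *(3) by (simp add: Compl_bool)
    then have "output_prob (final_state 2 n m U x k) acc {the (cert_fun f z x)} \<ge> 2/3"
      if "x \<in> dom (cert_fun f z)" for x
      using that *(4) by (auto simp: dom_cert_fun cert_fun_far)
    then show ?thesis using *(1,2) by blast
  qed
  have down: "\<exists>v. frac_cert n f z v \<and> sqrt (\<Sum>i<n. v i) \<le> 24 * real k" if P: "?P k" for k
  proof -
    obtain m U and out :: "nat \<Rightarrow> bool" where *: "query_algorithm 2 n k m U"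
      "\<And>x. x \<in> dom (cert_fun f z) \<Longrightarrow>
        output_prob (final_state 2 n m U x k) out {the (cert_fun f z x)} \<ge> 2/3"
      using P by blast
    show ?thesis
    proof (rule frac_cert_of_dist[OF *(1)])
      fix y assume y: "y \<in> far f z"
      have "output_prob (final_state 2 n m U y k) out {False} \<ge> 2/3"
        using *(2)[of y] y by (simp add: dom_cert_fun cert_fun_far)
      moreover have "output_prob (final_state 2 n m U z k) out {False} \<le> 1/3"
        using output_prob_final_Compl[OF *(1), of z out "{True}"] *(2)[of z]
        by (simp add: Compl_bool dom_cert_fun)
      ultimately show "1/12 \<le> vdist (final_state 2 n m U y k) (final_state 2 n m U z k)"
        using output_prob_final_diff[OF *(1), of y out "{False}" z] by simp
    qed
  qed
  show "real (Q 2 n (cert_fun f z)) \<le> 40 * sqrt_frac_cert n f z"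
    "sqrt_frac_cert n f z \<le> 24 * real (Q 2 n (cert_fun f z))"
    unfolding Q_def Q_search_def by - (rule Least_sqrt_frac_cert[OF up down]; assumption)+
qed

text \<open>Upper bound: the whole final state is output. The run on \<open>z\<close> is supported
  on accepting outcomes, which a far input yields with probability at most 1/3, so the squared
  overlap is at most 1/3 and the trace distance at least 1/3. Lower bound: the distance of the full
  states dominates the trace distance of the outputs.\<close>

lemma QD_cert_bounds:
  "real (QD n (cert_fun f z)) \<le> 40 * sqrt_frac_cert n f z"
  "sqrt_frac_cert n f z \<le> 24 * real (QD n (cert_fun f z))"
proof -
  let ?g = "cert_fun f z"
  let ?P = "\<lambda>k. \<exists>m U a c. query_algorithm 2 n k m U \<and> a * c = qdim 2 n m \<and>
     (\<forall>x\<in>dom ?g. \<forall>y\<in>dom ?g. ?g x \<noteq> ?g y \<longrightarrow>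
        trace_distance (reduced_state a c (final_state 2 n m U x k))
                       (reduced_state a c (final_state 2 n m U y k)) \<ge> 1/6)"
  have up: "\<exists>k. ?P k \<and> real k \<le> 40 * sqrt (\<Sum>i<n. v i)" if v: "frac_cert n f z v" for v
  proof -
    obtain k m U and acc :: "nat \<Rightarrow> bool" where *: "query_algorithm 2 n k m U"
      "real k \<le> 40 * sqrt (\<Sum>i<n. v i)"
      "output_prob (final_state 2 n m U z k) acc {False} = 0"
      "\<And>y. y \<in> far f z \<Longrightarrow> output_prob (final_state 2 n m U y k) acc {False} \<ge> 2/3"
      by (rule decision_algorithm[OF v]) blast
    let ?d = "qdim 2 n m" and ?\<psi> = "\<lambda>x. final_state 2 n m U x k"
    have dim: "dim_vec (?\<psi> x) = ?d" and norm: "vnorm ?d (\<lambda>j. ?\<psi> x $ j) = 1" for x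
      using dim_final_state[OF *(1)] norm_final_state[OF *(1)] by auto
    have overlap: "(cmod (\<Sum>j<?d. cnj (?\<psi> z $ j) * ?\<psi> y $ j))\<^sup>2 \<le> 1/3" if y: "y \<in> far f z" for y
    proof -
      let ?J = "{j. j < ?d \<and> acc j}"
      have zero: "?\<psi> z $ j = 0" if "j < ?d" "\<not> acc j" for j
        using *(3) that unfolding output_prob_def dim by (subst (asm) sum_nonneg_eq_0_iff) auto
      have restrict: "(\<Sum>j<?d. cnj (?\<psi> z $ j) * ?\<psi> y $ j) = (\<Sum>j\<in>?J. cnj (?\<psi> z $ j) * ?\<psi> y $ j)"
        by (rule sum.mono_neutral_right) (auto simp: zero)
      have "cmod (\<Sum>j<?d. cnj (?\<psi> z $ j) * ?\<psi> y $ j)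
          \<le> (\<Sum>j\<in>?J. \<bar>cmod (?\<psi> z $ j)\<bar> * \<bar>cmod (?\<psi> y $ j)\<bar>)"
        unfolding restrict by (rule order_trans[OF norm_sum]) (simp add: norm_mult)
      also have "\<dots> \<le> L2_set (\<lambda>j. cmod (?\<psi> z $ j)) ?J * L2_set (\<lambda>j. cmod (?\<psi> y $ j)) ?J"
        by (rule L2_set_mult_ineq)
      finally have "(cmod (\<Sum>j<?d. cnj (?\<psi> z $ j) * ?\<psi> y $ j))\<^sup>2
          \<le> (L2_set (\<lambda>j. cmod (?\<psi> z $ j)) ?J * L2_set (\<lambda>j. cmod (?\<psi> y $ j)) ?J)\<^sup>2"
        by (rule power_mono) simp
      also have "\<dots> = output_prob (?\<psi> z) acc {True} * output_prob (?\<psi> y) acc {True}"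
        by (simp add: output_prob_eq_L2 dim power_mult_distrib)
      also have "\<dots> \<le> 1 * (1/3)"
      proof (rule mult_mono)
        show "output_prob (?\<psi> z) acc {True} \<le> 1"
          using output_prob_le_norm[of "?\<psi> z" acc "{True}"] by (simp add: dim norm)
        show "output_prob (?\<psi> y) acc {True} \<le> 1/3"
          using output_prob_final_Compl[OF *(1), of y acc "{True}"] *(4)[OF y]
          by (simp add: Compl_bool)
      qed (auto simp: output_prob_nonneg)
      finally show ?thesis by simp
    qed
    have "trace_distance (reduced_state ?d 1 (?\<psi> x)) (reduced_state ?d 1 (?\<psi> y)) \<ge> 1/6"
      if xy: "x \<in> dom ?g" "y \<in> dom ?g" "?g x \<noteq> ?g y" for x y
    proof -
      have "(cmod (\<Sum>j<?d. cnj (?\<psi> x $ j) * ?\<psi> y $ j))\<^sup>2 \<le> 1/3"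
      proof (cases "x = z")
        case True
        then show ?thesis using xy overlap by (auto simp: dom_cert_fun)
      next
        case False
        then have "x \<in> far f z" "y = z" using xy by (auto simp: dom_cert_fun cert_fun_far)
        moreover have "cmod (\<Sum>j<?d. cnj (?\<psi> x $ j) * ?\<psi> y $ j)
            = cmod (cnj (\<Sum>j<?d. cnj (?\<psi> x $ j) * ?\<psi> y $ j))" by (simp only: complex_mod_cnj)
        ultimately show ?thesis using overlap[of x] by (simp add: mult.commute del: complex_mod_cnj)
      qed
      then show ?thesis using trace_distance_pure_ge[OF dim dim norm, of x y] by simp
    qed
    then have "?P k" using *(1) by (intro exI[of _ m] exI[of _ U] exI[of _ ?d] exI[of _ 1]) auto
    then show ?thesis using *(2) by blast
  qed
  have down: "\<exists>v. frac_cert n f z v \<and> sqrt (\<Sum>i<n. v i) \<le> 24 * real k" if P: "?P k" for k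
  proof -
    obtain m U a c where *: "query_algorithm 2 n k m U" "a * c = qdim 2 n m"
      "\<And>x y. x \<in> dom ?g \<Longrightarrow> y \<in> dom ?g \<Longrightarrow> ?g x \<noteq> ?g y \<Longrightarrow>
        trace_distance (reduced_state a c (final_state 2 n m U x k))
                       (reduced_state a c (final_state 2 n m U y k)) \<ge> 1/6"
      using P by blast
    show ?thesis
    proof (rule frac_cert_of_dist[OF *(1)])
      fix y assume y: "y \<in> far f z"
      have "1/6 \<le> trace_distance (reduced_state a c (final_state 2 n m U y k))
                       (reduced_state a c (final_state 2 n m U z k))"
        by (rule *(3)) (use y in \<open>auto simp: dom_cert_fun cert_fun_far\<close>)
      also have "\<dots> \<le> vdist (final_state 2 n m U y k) (final_state 2 n m U z k)"
        by (rule trace_distance_reduced_le)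
          (use *(1) dim_final_state norm_final_state in \<open>auto simp: *(2)\<close>)
      finally show "1/12 \<le> vdist (final_state 2 n m U y k) (final_state 2 n m U z k)" by simp
    qed
  qed
  show "real (QD n ?g) \<le> 40 * sqrt_frac_cert n f z" "sqrt_frac_cert n f z \<le> 24 * real (QD n ?g)"
    unfolding QD_def by - (rule Least_sqrt_frac_cert[OF up down]; assumption)+
qed

subsection \<open>The minimax adversary bound\<close>

text \<open>A certificate \<open>v\<close> of total \<open>W\<close> yields weights
  \<open>v i / sqrt W\<close> for \<open>z\<close> and, where \<open>y\<close> differs from
  \<open>z\<close>, \<open>sqrt W * v i\<close> over the square of \<open>D y\<close> for
  \<open>y\<close>. Their geometric means \<open>v i / D y\<close> sum to 1, and
  \<open>D y >= 1\<close> keeps the total of \<open>y\<close> at most \<open>sqrt W\<close>.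
  Conversely, for feasible weights with maximum \<open>a\<close>, Cauchy-Schwarz makes
  \<open>a * w z i\<close> a certificate, of total at most \<open>a * a\<close>.\<close>

lemma MM_cert_bounds:
  "MM n (cert_fun f z) \<le> sqrt_frac_cert n f z" "sqrt_frac_cert n f z \<le> MM n (cert_fun f z)"
proof -
  let ?g = "cert_fun f z"
  let ?S = "{Max ((\<lambda>x. \<Sum>i<n. w x i) ` dom ?g) | w. MM_feasible n ?g w}"
  have "far f z \<subseteq> strings 2 n" using far_strings by blast
  moreover have "finite (strings 2 n)"
    using finite_lists_length_eq[of "{..<2::nat}" n] by (simp add: strings_def conj_commute)
  ultimately have fin: "finite (dom ?g)" by (simp add: dom_cert_fun finite_subset)
  have ge: "(\<Sum>i<n. w x i) \<le> Max ((\<lambda>x. \<Sum>i<n. w x i) ` dom ?g)" if "x \<in> dom ?g"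
    for w :: "nat list \<Rightarrow> nat \<Rightarrow> real" and x
    using fin that by (intro Max_ge) auto
  have z_dom: "z \<in> dom ?g" by (simp add: dom_cert_fun)
  have nonneg: "0 \<le> Max ((\<lambda>x. \<Sum>i<n. w x i) ` dom ?g)" if "MM_feasible n ?g w" for w
  proof -
    have "0 \<le> (\<Sum>i<n. w z i)" using that z_dom by (intro sum_nonneg) (auto simp: MM_feasible_def)
    then show ?thesis using ge[OF z_dom, of w] by linarith
  qed
  have bdd: "bdd_below ?S" using nonneg by (intro bdd_belowI[of _ 0]) auto
  have up: "MM n ?g \<le> sqrt (\<Sum>i<n. v i) \<and> ?S \<noteq> {}" if v: "frac_cert n f z v" for v
  proof -
    let ?W = "\<Sum>i<n. v i"
    have v0: "\<And>i. i < n \<Longrightarrow> v i \<ge> 0" using v by (simp add: frac_cert_def)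
    have W0: "?W \<ge> 0" using v0 by (intro sum_nonneg) auto
    define D where "D y = (\<Sum>i | i < n \<and> y ! i \<noteq> z ! i. v i)" for y
    have D: "D y \<ge> 1" if "y \<in> far f z" for y using v that by (simp add: frac_cert_def D_def)
    have DW: "D y \<le> ?W" for y unfolding D_def by (rule sum_mono2) (use v0 in auto)
    \<comment> \<open>\<open>?W = 0\<close> occurs only if no input is far; the quotients are then 0
      and there is no constraint to meet.\<close>
    define w where "w x i = (if x = z then v i / sqrt ?W
      else if x ! i \<noteq> z ! i then sqrt ?W * v i / (D x)\<^sup>2 else 0)" for x i
    have one: "(\<Sum>i | i < n \<and> y ! i \<noteq> z ! i. sqrt (w z i * w y i)) = 1" if y: "y \<in> far f z" for y
    proof -
      have "sqrt ?W > 0" using D[OF y] DW[of y] by simp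
      then have "sqrt (w z i * w y i) = v i / D y" if "i < n" "y ! i \<noteq> z ! i" for i
        using that y z_notin_far v0[OF that(1)] D[OF y]
        by (auto simp: w_def real_sqrt_divide real_sqrt_mult)
      then have "(\<Sum>i | i < n \<and> y ! i \<noteq> z ! i. sqrt (w z i * w y i)) = D y / D y"
        unfolding D_def sum_divide_distrib by (intro sum.cong) auto
      then show ?thesis using D[OF y] by simp
    qed
    have feas: "MM_feasible n ?g w"
      unfolding MM_feasible_def
    proof (intro conjI ballI allI impI)
      show "0 \<le> w x i" if "i < n" for x i using v0[OF that] W0 by (simp add: w_def)
      fix x y assume xy: "x \<in> dom ?g" "y \<in> dom ?g" "?g x \<noteq> ?g y"
      show "1 \<le> (\<Sum>i | i < n \<and> x ! i \<noteq> y ! i. sqrt (w x i * w y i))"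
      proof (cases "x = z")
        case True
        then have "y \<in> far f z" using xy by (auto simp: dom_cert_fun)
        from one[OF this] show ?thesis using True by (simp add: eq_commute[of "z ! _"])
      next
        case False
        then have "x \<in> far f z" "y = z" using xy by (auto simp: dom_cert_fun cert_fun_far)
        with one[of x] show ?thesis by (simp add: mult.commute)
      qed
    qed
    have le: "(\<Sum>i<n. w x i) \<le> sqrt ?W" if "x \<in> dom ?g" for x
    proof (cases "x = z")
      case True
      then have "(\<Sum>i<n. w x i) = ?W / sqrt ?W" by (simp add: w_def sum_divide_distrib)
      then show ?thesis using W0 by (simp add: real_div_sqrt)
    next
      case False
      then have x: "x \<in> far f z" using that by (simp add: dom_cert_fun)
      have "(\<Sum>i<n. w x i) = (\<Sum>i | i < n \<and> x ! i \<noteq> z ! i. sqrt ?W * v i / (D x)\<^sup>2)"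
        using False by (simp add: w_def sum.inter_filter[symmetric] if_distrib cong: if_cong)
      also have "\<dots> = sqrt ?W * D x / (D x)\<^sup>2"
        unfolding D_def by (simp only: sum_distrib_left sum_divide_distrib)
      also have "\<dots> = sqrt ?W / D x" using D[OF x] by (simp add: power2_eq_square)
      also have "\<dots> \<le> sqrt ?W / 1" using D[OF x] W0 by (intro divide_left_mono) auto
      finally show ?thesis by simp
    qed
    have mem: "Max ((\<lambda>x. \<Sum>i<n. w x i) ` dom ?g) \<in> ?S" using feas by blast
    have "MM n ?g \<le> Max ((\<lambda>x. \<Sum>i<n. w x i) ` dom ?g)"
      unfolding MM_def by (rule cInf_lower[OF mem bdd])
    also have "\<dots> \<le> sqrt ?W" using fin z_dom le by (subst Max_le_iff) auto
    finally show ?thesis using mem by blast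
  qed
  show "MM n ?g \<le> sqrt_frac_cert n f z" using le_sqrt_frac_cert[of "MM n ?g" 1] up by simp
  show "sqrt_frac_cert n f z \<le> MM n ?g"
    unfolding MM_def
  proof (rule cInf_greatest)
    show "?S \<noteq> {}" using up[OF frac_cert_ones] by blast
    fix a assume "a \<in> ?S"
    then obtain w where w: "MM_feasible n ?g w" and a: "a = Max ((\<lambda>x. \<Sum>i<n. w x i) ` dom ?g)" by blast
    have a0: "a \<ge> 0" using nonneg[OF w] by (simp add: a)
    have w0: "w x i \<ge> 0" if "x \<in> dom ?g" "i < n" for x i using w that by (simp add: MM_feasible_def)
    have "frac_cert n f z (\<lambda>i. a * w z i)"
      unfolding frac_cert_def
    proof (intro conjI allI impI ballI)
      show "0 \<le> a * w z i" if "i < n" for i using a0 w0[OF z_dom that] by simp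
      fix y assume y: "y \<in> far f z"
      then have yd: "y \<in> dom ?g" by (simp add: dom_cert_fun)
      let ?D = "{i. i < n \<and> y ! i \<noteq> z ! i}"
      have "1 \<le> (\<Sum>i\<in>?D. sqrt (w y i * w z i))"
        using w yd z_dom y by (simp add: MM_feasible_def cert_fun_far)
      also have "\<dots> = (\<Sum>i\<in>?D. \<bar>sqrt (w y i)\<bar> * \<bar>sqrt (w z i)\<bar>)"
        using w0 yd z_dom by (intro sum.cong) (auto simp: real_sqrt_mult)
      also have "\<dots> \<le> L2_set (\<lambda>i. sqrt (w y i)) ?D * L2_set (\<lambda>i. sqrt (w z i)) ?D"
        by (rule L2_set_mult_ineq)
      also have "\<dots> = sqrt ((\<Sum>i\<in>?D. w y i) * (\<Sum>i\<in>?D. w z i))"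
        unfolding L2_set_def real_sqrt_mult using w0 yd z_dom
        by (intro arg_cong2[of _ _ _ _ "(*)"] arg_cong[of _ _ sqrt] sum.cong) auto
      finally have "1 \<le> (\<Sum>i\<in>?D. w y i) * (\<Sum>i\<in>?D. w z i)" by simp
      also have "\<dots> \<le> a * (\<Sum>i\<in>?D. w z i)"
      proof (rule mult_right_mono)
        have "(\<Sum>i\<in>?D. w y i) \<le> (\<Sum>i<n. w y i)" by (rule sum_mono2) (use w0 yd in auto)
        also have "\<dots> \<le> a" unfolding a by (rule ge[OF yd])
        finally show "(\<Sum>i\<in>?D. w y i) \<le> a" .
      qed (use w0 z_dom in \<open>auto intro: sum_nonneg\<close>)
      finally show "1 \<le> (\<Sum>i\<in>?D. a * w z i)" by (simp add: sum_distrib_left)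
    qed
    then have "sqrt_frac_cert n f z \<le> sqrt (\<Sum>i<n. a * w z i)" by (rule sqrt_frac_cert_le)
    also have "\<dots> = sqrt (a * (\<Sum>i<n. w z i))" by (simp add: sum_distrib_left)
    also have "\<dots> \<le> sqrt (a * a)"
      using ge[OF z_dom, of w] a0 unfolding a[symmetric]
      by (intro real_sqrt_le_mono mult_left_mono) auto
    also have "\<dots> = a" using a0 by simp
    finally show "sqrt_frac_cert n f z \<le> a" .
  qed
qed

end

section \<open>Sabotage complexity\<close>

lemma sum_shift_index:
  fixes v :: "nat \<Rightarrow> real"
  shows "(\<Sum>i | i < d + n \<and> d \<le> i \<and> R (i - d). v (i - d)) = (\<Sum>i | i < n \<and> R i. v i)"
  by (rule sum.reindex_bij_witness[of _ "\<lambda>i. d + i" "\<lambda>i. i - d"]) auto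

lemma strings_mono: "q \<le> q' \<Longrightarrow> strings q n \<subseteq> strings q' n"
  by (auto simp: strings_def)

lemma strings_append: "x \<in> strings q m \<Longrightarrow> y \<in> strings q n \<Longrightarrow> x @ y \<in> strings q (m + n)"
  by (auto simp: strings_def)

lemma length_strings: "x \<in> strings q n \<Longrightarrow> length x = n"
  by (simp add: strings_def)

lemma sab_string_nth:
  "i < length x \<Longrightarrow> i < length y \<Longrightarrow> sab_string x y b ! i = (if x ! i = y ! i then x ! i else b)"
  by (simp add: sab_string_def)

lemma sab_string_strings:
  assumes "x \<in> strings q n" "y \<in> strings q n" "b < q" shows "sab_string x y b \<in> strings q n"
proof -
  have "length x = n" "length y = n" using assms by (auto simp: strings_def)
  then have "length (sab_string x y b) = n" by (simp add: sab_string_def)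
  moreover have "sab_string x y b ! i < q" if "i < n" for i
    using that assms \<open>length x = n\<close> \<open>length y = n\<close>
    by (simp add: sab_string_nth strings_nth_less)
  ultimately show ?thesis by (auto simp: strings_def in_set_conv_nth)
qed

text \<open>
  The two input models at once: the sabotaged string is preceded by \<open>pre x\<close> of length \<open>d\<close>, which
  is empty in the weak model and \<open>x @ z\<close> in the strong one.
\<close>

locale sabotage_input = pointed_function +
  fixes d :: nat and pre :: "nat list \<Rightarrow> nat list"
  assumes pre_strings: "x \<in> insert z (far f z) \<Longrightarrow> pre x \<in> strings 4 d"
    and pre_diff: "x \<in> far f z \<Longrightarrow> i < d \<Longrightarrow> pre x ! i \<noteq> pre z ! i \<Longrightarrow>
      x ! (i mod n) \<noteq> z ! (i mod n)"
    and dvd: "n dvd d"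
begin

definition inp :: "nat list \<Rightarrow> nat \<Rightarrow> nat list" where
  "inp x b = pre x @ sab_string x z b"

definition diff :: "nat list \<Rightarrow> nat set" where
  "diff x = {i. i < n \<and> x ! i \<noteq> z ! i}"

definition ind_solved :: "nat \<Rightarrow> bool" where
  "ind_solved k \<longleftrightarrow> (\<exists>m U (out :: nat \<Rightarrow> nat). query_algorithm 4 (d + n) k m U \<and>
     (\<forall>x\<in>far f z. \<forall>b\<in>{star, dagger}.
        output_prob (final_state 4 (d + n) m U (inp x b) k) out (diff x) \<ge> 2/3))"

lemma finite_diff: "finite (diff x)"
  by (simp add: diff_def)

lemma diff_subset: "diff x \<subseteq> {..<n}"
  by (auto simp: diff_def)

lemma lengths: "x \<in> far f z \<Longrightarrow> length x = n" "length z = n"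
    "x \<in> insert z (far f z) \<Longrightarrow> length (pre x) = d"
  using far_strings z_strings pre_strings length_strings by blast+

lemma inp_strings:
  assumes "x \<in> far f z" "b < 4" shows "inp x b \<in> strings 4 (d + n)"
proof -
  have "x \<in> strings 4 n" "z \<in> strings 4 n"
    using strings_mono[of 2 4 n] far_strings[OF assms(1)] z_strings by auto
  then show ?thesis
    unfolding inp_def using assms pre_strings by (intro strings_append sab_string_strings) auto
qed

lemma inp_nth:
  assumes "x \<in> far f z" "i < n"
  shows "inp x b ! (d + i) = (if x ! i = z ! i then z ! i else b)"
  using assms lengths(1)[of x] lengths(2) lengths(3)[of x] by (simp add: inp_def nth_append sab_string_nth)

lemma inp_nth_marked:
  assumes x: "x \<in> far f z" and i: "i < n" and b: "b \<in> {star, dagger}"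
  shows "inp x b ! (d + i) \<in> {star, dagger} \<longleftrightarrow> x ! i \<noteq> z ! i"
  using inp_nth[OF x i, of b] z_nth[OF i] b by auto

text \<open>The last block departs from \<open>z\<close> only at sabotaged positions, and the prefix
  departs from \<open>pre z\<close> only where \<open>x\<close> departs from \<open>z\<close>. As
  \<open>n\<close> divides \<open>d\<close>, the residue is the position within a block, so every
  deviation from the reference is charged to a coordinate where \<open>x\<close> and
  \<open>z\<close> differ.\<close>

lemma inp_diff:
  assumes x: "x \<in> far f z" and i: "i < d + n" and neq: "inp x b ! i \<noteq> (pre z @ z) ! i"
  shows "x ! (i mod n) \<noteq> z ! (i mod n)"
proof (cases "i < d")
  case True
  then show ?thesis using pre_diff[OF x True] neq lengths(3)[of x] lengths(3)[of z] x
    by (simp add: inp_def nth_append)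
next
  case False
  define j where "j = i - d"
  have j: "i = d + j" "j < n" using False i by (auto simp: j_def)
  have "(d + j) mod n = j" using j(2) dvd by (auto elim!: dvdE)
  then show ?thesis using neq inp_nth[OF x j(2), of b] lengths(3)[of z]
    unfolding j(1) by (auto simp: nth_append split: if_splits)
qed

text \<open>At a coordinate where \<open>x\<close> differs from \<open>z\<close> one sabotaged block
  carries 3, while the other block only has symbols up to 2. Hence the two cases in
  \<open>sab_fun\<close> do not overlap.\<close>

lemma inp_inj:
  assumes "x \<in> far f z" "y \<in> far f z" shows "inp x dagger \<noteq> inp y star"
proof
  assume eq: "inp x dagger = inp y star"
  obtain i where i: "i < n" "x ! i \<noteq> z ! i" using far_differs[OF assms(1)] by blast
  have "inp x dagger ! (d + i) = 3" using inp_nth[OF assms(1) i(1)] i by simp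
  moreover have "inp y star ! (d + i) < 3" using inp_nth[OF assms(2) i(1)] z_nth[OF i(1)] by simp
  ultimately show False using eq by simp
qed

lemma sab_fun_inp:
  assumes S: "\<And>b. S b = (\<lambda>x. inp x b) ` far f z"
  shows "dom (sab_fun S) = (\<Union>b\<in>{star, dagger}. (\<lambda>x. inp x b) ` far f z)"
    and "x \<in> far f z \<Longrightarrow> sab_fun S (inp x star) = Some False"
    and "x \<in> far f z \<Longrightarrow> sab_fun S (inp x dagger) = Some True"
  using inp_inj by (auto simp: sab_fun_def S split: if_splits)

text \<open>One search serves decision and index: it looks for a sabotaged symbol in the last block,
  with the certificate shifted there and weight 0 on the prefix. The label shows a true position
  together with its true symbol, which must be \<open>b\<close>. The cost
  \<open>10 * 4 * sqrt W\<close> is the origin of 40.\<close>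

lemma sabotage_algorithm:
  assumes v: "frac_cert n f z v"
  shows "\<exists>k m U (out :: nat \<Rightarrow> nat \<times> nat). query_algorithm 4 (d + n) k m U \<and>
    real k \<le> 40 * sqrt (\<Sum>i<n. v i) \<and>
    (\<forall>x\<in>far f z. \<forall>b\<in>{star, dagger}.
       output_prob (final_state 4 (d + n) m U (inp x b) k) out
         {(i, c). d \<le> i \<and> i - d \<in> diff x \<and> c = b} \<ge> 2/3)"
proof (cases "far f z = {}")
  case True
  obtain U where "query_algorithm 4 (d + n) 0 1 U" using trivial_algorithm[of 4] by auto
  moreover have "0 \<le> (\<Sum>i<n. v i)" using v by (auto simp: frac_cert_def intro: sum_nonneg)
  ultimately show ?thesis using True by (intro exI[of _ 0] exI[of _ 1] exI[of _ U]) auto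
next
  case False
  let ?v = "\<lambda>i. if d \<le> i then v (i - d) else 0"
  let ?P = "\<lambda>i c. d \<le> i \<and> c \<in> {star, dagger}"
  have v0: "\<And>i. i < n \<Longrightarrow> v i \<ge> 0" using v by (simp add: frac_cert_def)
  have sum_v: "(\<Sum>i | i < d + n \<and> d \<le> i \<and> R (i - d). ?v i) = (\<Sum>i | i < n \<and> R i. v i)" for R
    unfolding sum_shift_index[where v = v and n = n and d = d and R = R, symmetric] by (intro sum.cong) auto
  have "(\<Sum>i<d + n. ?v i) = (\<Sum>i | i < d + n \<and> d \<le> i \<and> True. ?v i)"
    by (rule sum.mono_neutral_right) auto
  also have "\<dots> = (\<Sum>i<n. v i)" unfolding sum_v[of "\<lambda>_. True"] by (simp add: lessThan_def)
  finally have W: "(\<Sum>i<n. v i) = (\<Sum>i<d + n. ?v i)" ..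
  show ?thesis
  proof (rule query_search[where q = 4 and P = ?P and n = "d + n" and v = ?v, OF _ _ W],
      goal_cases)
    case (2 i)
    then show ?case using v0 by auto
  next
    case 3
    show ?case by (rule frac_cert_total[OF v False])
  next
    case (4 k m U out)
    have "output_prob (final_state 4 (d + n) m U (inp x b) k) out
         {(i, c). d \<le> i \<and> i - d \<in> diff x \<and> c = b} \<ge> 2/3"
      if x: "x \<in> far f z" and b: "b \<in> {star, dagger}" for x b
    proof -
      let ?s = "inp x b"
      have s: "?s \<in> strings 4 (d + n)" using x b by (intro inp_strings) auto
      have "?P i (?s ! i) \<longleftrightarrow> d \<le> i \<and> x ! (i - d) \<noteq> z ! (i - d)" if "i < d + n" for i
        using inp_nth_marked[OF x _ b, of "i - d"] that by (cases "d \<le> i") auto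
      then have "{i. i < d + n \<and> ?P i (?s ! i)} = {i. i < d + n \<and> d \<le> i \<and> x ! (i - d) \<noteq> z ! (i - d)}"
        by blast
      then have "(\<Sum>i | i < d + n \<and> ?P i (?s ! i). ?v i) = (\<Sum>i | i < n \<and> x ! i \<noteq> z ! i. v i)"
        using sum_v[of "\<lambda>i. x ! i \<noteq> z ! i"] by simp
      also have "\<dots> \<ge> 1" using v x by (simp add: frac_cert_def)
      finally have "2/3 \<le> output_prob (final_state 4 (d + n) m U ?s k) out
          {(i, c). i < d + n \<and> ?P i c}" by (rule 4(4)[OF s])
      also have "\<dots> \<le> output_prob (final_state 4 (d + n) m U ?s k) out
          {(i, c). d \<le> i \<and> i - d \<in> diff x \<and> c = b}"
      proof (rule output_prob_mono)
        fix j assume j: "j < dim_vec (final_state 4 (d + n) m U ?s k)"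
          "final_state 4 (d + n) m U ?s k $ j \<noteq> 0" "out j \<in> {(i, c). i < d + n \<and> ?P i c}"
        obtain i c where out: "out j = (i, c)" by force
        have ic: "i < d + n" "d \<le> i" "c \<in> {star, dagger}" using j(3) by (auto simp: out)
        have "c = ?s ! i" using 4(3)[OF s _ j(2)] j(1) dim_final_state[OF 4(1)] ic(1) by (simp add: out)
        moreover have i: "i - d < n" "?s ! i = ?s ! (d + (i - d))" using ic by auto
        ultimately have "x ! (i - d) \<noteq> z ! (i - d)" "c = b"
          using ic(3) inp_nth[OF x i(1), of b] z_nth[OF i(1)] by (auto split: if_splits)
        then show "out j \<in> {(i, c). d \<le> i \<and> i - d \<in> diff x \<and> c = b}"
          using ic i by (simp add: out diff_def)
      qed
      finally show ?thesis .
    qed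
    then show ?case using 4(1,2) by (intro exI[of _ k] exI[of _ m] exI[of _ U] exI[of _ out]) auto
  qed simp
qed

text \<open>The reference \<open>pre z @ z\<close> is \<open>z\<close> sabotaged against itself,
  which leaves no sabotaged symbol. An instance far from it in the final state, with either symbol,
  forces weight 1 on \<open>diff x\<close>.\<close>

lemma sabotage_weights:
  assumes alg: "query_algorithm 4 (d + n) k m U"
  shows "\<exists>v. (\<forall>i. v i \<ge> 0) \<and> (\<Sum>i<n. v i) \<le> 576 * (real k)\<^sup>2 \<and>
    (\<forall>x\<in>far f z. \<forall>b. vdist (final_state 4 (d + n) m U (inp x b) k)
                            (final_state 4 (d + n) m U (pre z @ z) k) \<ge> 1/12
        \<longrightarrow> (\<Sum>i\<in>diff x. v i) \<ge> 1)"
proof (cases "n = 0")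
  case True
  then have "far f z = {}" using far_differs by (metis ex_in_conv not_less_zero)
  then show ?thesis by (intro exI[of _ "\<lambda>_. 0"]) simp
next
  case False
  then have n: "n > 0" by simp
  show ?thesis
  proof (rule weights_of_algorithm[OF alg _ n, of "pre z @ z" z], goal_cases)
    case (2 v)
    have "(\<Sum>i\<in>diff x. v i) \<ge> 1"
      if "x \<in> far f z" "vdist (final_state 4 (d + n) m U (inp x b) k)
                              (final_state 4 (d + n) m U (pre z @ z) k) \<ge> 1/12" for x b
      using 2(3)[OF inp_diff[OF that(1)] that(2)] by (simp add: diff_def)
    then show ?case using 2(1,2) by blast
  qed simp
qed

text \<open>For the lower bound, the two instances of one \<open>x\<close> are told apart by
  probabilities 2/3 and 1/3, so their states are 1/6 apart and at least one of them is 1/12 away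
  from the reference. Either one suffices, because \<open>diff x\<close> does not depend on the
  symbol.\<close>

lemma sabotage_decision_bounds:
  assumes S: "\<And>b. S b = (\<lambda>x. inp x b) ` far f z"
  shows "real (Q 4 (d + n) (sab_fun S)) \<le> 40 * sqrt_frac_cert n f z"
    "sqrt_frac_cert n f z \<le> 24 * real (Q 4 (d + n) (sab_fun S))"
proof -
  let ?\<psi> = "\<lambda>m U k s. final_state 4 (d + n) m U s k"
  let ?P = "\<lambda>k. \<exists>m U (out :: nat \<Rightarrow> bool). query_algorithm 4 (d + n) k m U \<and>
     (\<forall>s\<in>dom (sab_fun S). output_prob (?\<psi> m U k s) out {the (sab_fun S s)} \<ge> 2/3)"
  have up: "\<exists>k. ?P k \<and> real k \<le> 40 * sqrt (\<Sum>i<n. v i)" if v: "frac_cert n f z v" for v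
  proof -
    obtain k m U and out :: "nat \<Rightarrow> nat \<times> nat" where *: "query_algorithm 4 (d + n) k m U"
      "real k \<le> 40 * sqrt (\<Sum>i<n. v i)"
      "\<And>x b. x \<in> far f z \<Longrightarrow> b \<in> {star, dagger} \<Longrightarrow> output_prob (?\<psi> m U k (inp x b)) out
         {(i, c). d \<le> i \<and> i - d \<in> diff x \<and> c = b} \<ge> 2/3"
      using sabotage_algorithm[OF v] by blast
    let ?out = "\<lambda>j. snd (out j) = dagger"
    have "output_prob (?\<psi> m U k s) ?out {the (sab_fun S s)} \<ge> 2/3" if s: "s \<in> dom (sab_fun S)" for s
    proof -
      obtain x b where x: "x \<in> far f z" and b: "b \<in> {star, dagger}" and s_eq: "s = inp x b"
        using s unfolding sab_fun_inp(1)[OF S] by blast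
      have "the (sab_fun S s) = (b = dagger)"
        using b sab_fun_inp(2,3)[OF S x] unfolding s_eq by auto
      then have "output_prob (?\<psi> m U k s) out {(i, c). d \<le> i \<and> i - d \<in> diff x \<and> c = b}
          \<le> output_prob (?\<psi> m U k s) ?out {the (sab_fun S s)}"
        by (intro output_prob_mono) auto
      then show ?thesis using *(3)[OF x b] unfolding s_eq by linarith
    qed
    then show ?thesis using *(1,2) by blast
  qed
  have down: "\<exists>v. frac_cert n f z v \<and> sqrt (\<Sum>i<n. v i) \<le> 24 * real k" if P: "?P k" for k
  proof -
    obtain m U and out :: "nat \<Rightarrow> bool" where alg: "query_algorithm 4 (d + n) k m U"
      and out: "\<And>s. s \<in> dom (sab_fun S) \<Longrightarrow>
        output_prob (?\<psi> m U k s) out {the (sab_fun S s)} \<ge> 2/3"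
      using P by blast
    obtain v where v: "\<And>i. v i \<ge> 0" "(\<Sum>i<n. v i) \<le> 576 * (real k)\<^sup>2"
      "\<And>x b. x \<in> far f z \<Longrightarrow> vdist (?\<psi> m U k (inp x b)) (?\<psi> m U k (pre z @ z)) \<ge> 1/12 \<Longrightarrow>
         (\<Sum>i\<in>diff x. v i) \<ge> 1"
      using sabotage_weights[OF alg] by blast
    have "(\<Sum>i\<in>diff x. v i) \<ge> 1" if x: "x \<in> far f z" for x
    proof -
      let ?s = "\<lambda>b. ?\<psi> m U k (inp x b)" and ?b = "?\<psi> m U k (pre z @ z)"
      have dims: "dim_vec (?s b) = qdim 4 (d + n) m" "dim_vec ?b = qdim 4 (d + n) m" for b
        using dim_final_state[OF alg] by auto
      have "output_prob (?s dagger) out {True} \<ge> 2/3" "output_prob (?s star) out {False} \<ge> 2/3"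
        using out[of "inp x dagger"] out[of "inp x star"] x sab_fun_inp(2,3)[OF S x]
        by (auto simp: sab_fun_inp(1)[OF S])
      moreover have "output_prob (?s star) out {True} + output_prob (?s star) out {False} = 1"
        using output_prob_final_Compl[OF alg, of _ out "{True}"] by (simp add: Compl_bool)
      ultimately have "1/6 \<le> vdist (?s dagger) (?s star)"
        using output_prob_final_diff[OF alg, of "inp x dagger" out "{True}" "inp x star"] by simp
      also have "\<dots> \<le> vdist (?s dagger) ?b + vdist ?b (?s star)"
        by (rule vdist_triangle[OF dims])
      also have "vdist ?b (?s star) = vdist (?s star) ?b" by (rule vdist_final_commute[OF alg])
      finally have "1/12 \<le> vdist (?s dagger) ?b \<or> 1/12 \<le> vdist (?s star) ?b" by linarith
      then show ?thesis using v(3)[OF x] by blast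
    qed
    then have "frac_cert n f z v" using v(1) by (simp add: frac_cert_def diff_def)
    then show ?thesis using sqrt_le_24[OF v(2)] by blast
  qed
  show "real (Q 4 (d + n) (sab_fun S)) \<le> 40 * sqrt_frac_cert n f z"
    "sqrt_frac_cert n f z \<le> 24 * real (Q 4 (d + n) (sab_fun S))"
    unfolding Q_def Q_search_def by - (rule Least_sqrt_frac_cert[OF up down]; assumption)+
qed

lemma Q_search_ind_eq:
  assumes S: "\<And>b. S b = (\<lambda>x. inp x b) ` far f z"
  shows "Q_search 4 (d + n) (S star \<union> S dagger) (\<lambda>s. {i. i < n \<and> s ! (d + i) \<in> {star, dagger}})
    = (LEAST k. ind_solved k)"
proof -
  have "{i. i < n \<and> inp x b ! (d + i) \<in> {star, dagger}} = diff x"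
    if "x \<in> far f z" "b \<in> {star, dagger}" for x b
    using inp_nth_marked[OF that(1) _ that(2)] by (auto simp: diff_def)
  then show ?thesis unfolding Q_search_def ind_solved_def S by (simp add: ball_Un ball_conj_distrib)
qed

lemma ind_solved_upper:
  assumes v: "frac_cert n f z v" shows "\<exists>k. ind_solved k \<and> real k \<le> 40 * sqrt (\<Sum>i<n. v i)"
proof -
  obtain k m U and out :: "nat \<Rightarrow> nat \<times> nat" where *: "query_algorithm 4 (d + n) k m U"
    "real k \<le> 40 * sqrt (\<Sum>i<n. v i)"
    "\<And>x b. x \<in> far f z \<Longrightarrow> b \<in> {star, dagger} \<Longrightarrow>
       output_prob (final_state 4 (d + n) m U (inp x b) k) out
         {(i, c). d \<le> i \<and> i - d \<in> diff x \<and> c = b} \<ge> 2/3"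
    using sabotage_algorithm[OF v] by blast
  have "output_prob (final_state 4 (d + n) m U (inp x b) k) (\<lambda>j. fst (out j) - d) (diff x) \<ge> 2/3"
    if "x \<in> far f z" "b \<in> {star, dagger}" for x b
    by (rule order_trans[OF *(3)[OF that] output_prob_mono]) auto
  then have "ind_solved k" using *(1) unfolding ind_solved_def by blast
  then show ?thesis using *(2) by blast
qed

text \<open>If the reference run already names an element of \<open>diff x\<close> with probability
  at least 1/3, three times its output distribution \<open>p\<close> has weight at least 1 on
  \<open>diff x\<close>. Otherwise this probability rises by at least 1/3 on the instance, so the
  states differ and the query weights \<open>u\<close> reach 1 there. In both cases
  \<open>u i + 3 * p i\<close> works, and 576 + 3 is at most 625, the square of 25.\<close>

lemma ind_solved_lower:
  assumes "ind_solved k"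
  shows "\<exists>v. frac_cert n f z v \<and> sqrt (\<Sum>i<n. v i) \<le> 25 * max 1 (real k)"
proof -
  let ?\<psi> = "\<lambda>m U s. final_state 4 (d + n) m U s k"
  obtain m U and out :: "nat \<Rightarrow> nat" where alg: "query_algorithm 4 (d + n) k m U"
    and out: "\<And>x b. x \<in> far f z \<Longrightarrow> b \<in> {star, dagger} \<Longrightarrow>
       output_prob (?\<psi> m U (inp x b)) out (diff x) \<ge> 2/3"
    using assms unfolding ind_solved_def by blast
  obtain u where u: "\<And>i. u i \<ge> 0" "(\<Sum>i<n. u i) \<le> 576 * (real k)\<^sup>2"
    "\<And>x b. x \<in> far f z \<Longrightarrow> vdist (?\<psi> m U (inp x b)) (?\<psi> m U (pre z @ z)) \<ge> 1/12 \<Longrightarrow>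
       (\<Sum>i\<in>diff x. u i) \<ge> 1"
    using sabotage_weights[OF alg] by blast
  define p where "p i = output_prob (?\<psi> m U (pre z @ z)) out {i}" for i
  have p0: "p i \<ge> 0" for i by (simp add: p_def output_prob_nonneg)
  have p_sum: "(\<Sum>i\<in>I. p i) = output_prob (?\<psi> m U (pre z @ z)) out I" if "finite I" for I
    unfolding p_def output_prob_sum[OF that] ..
  have p1: "(\<Sum>i<n. p i) \<le> 1"
    using output_prob_final_Compl[OF alg, of "pre z @ z" out "{..<n}"]
      output_prob_nonneg[of "?\<psi> m U (pre z @ z)" out "- {..<n}"]
    by (simp add: p_sum)
  have "(\<Sum>i\<in>diff x. u i + 3 * p i) \<ge> 1" if x: "x \<in> far f z" for x
  proof (cases "(\<Sum>i\<in>diff x. p i) \<ge> 1/3")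
    case True
    have "(\<Sum>i\<in>diff x. u i) \<ge> 0" using u(1) by (intro sum_nonneg)
    then show ?thesis using True by (simp add: sum.distrib sum_distrib_left[symmetric])
  next
    case False
    then have "1/3 \<le> output_prob (?\<psi> m U (inp x star)) out (diff x)
        - output_prob (?\<psi> m U (pre z @ z)) out (diff x)"
      using out[OF x, of star] by (simp add: p_sum[OF finite_diff])
    then have "1/12 \<le> vdist (?\<psi> m U (inp x star)) (?\<psi> m U (pre z @ z))"
      using output_prob_final_diff[OF alg, of "inp x star" out "diff x" "pre z @ z"] by simp
    then have "(\<Sum>i\<in>diff x. u i) \<ge> 1" by (rule u(3)[OF x])
    moreover have "(\<Sum>i\<in>diff x. p i) \<ge> 0" using p0 by (intro sum_nonneg)
    ultimately show ?thesis by (simp add: sum.distrib sum_distrib_left[symmetric])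
  qed
  then have "frac_cert n f z (\<lambda>i. u i + 3 * p i)" using u(1) p0 by (simp add: frac_cert_def diff_def)
  moreover have "sqrt (\<Sum>i<n. u i + 3 * p i) \<le> 25 * max 1 (real k)"
  proof (rule real_le_lsqrt)
    have "(real k)\<^sup>2 \<le> (max 1 (real k))\<^sup>2" "1 \<le> (max 1 (real k))\<^sup>2"
      by (auto intro: power_mono one_le_power)
    moreover have "(25 * max 1 (real k))\<^sup>2 = 625 * (max 1 (real k))\<^sup>2"
      by (simp only: power_mult_distrib) simp
    moreover have "(\<Sum>i<n. u i + 3 * p i) = (\<Sum>i<n. u i) + 3 * (\<Sum>i<n. p i)"
      by (simp add: sum.distrib sum_distrib_left)
    ultimately show "(\<Sum>i<n. u i + 3 * p i) \<le> (25 * max 1 (real k))\<^sup>2"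
      using u(2) p1 by linarith
  qed simp
  ultimately show ?thesis by blast
qed

lemma sabotage_ind_bounds:
  "real (LEAST k. ind_solved k) \<le> 40 * sqrt_frac_cert n f z"
  "sqrt_frac_cert n f z \<le> 25 * max 1 (real (LEAST k. ind_solved k))"
  by (rule Least_sqrt_frac_cert[OF ind_solved_upper ind_solved_lower]; assumption)+

text \<open>
  Without queries the output has a fixed distribution; the characterization below does not refer
  to the input model.
\<close>

lemma ind_solved_0_iff:
  "(LEAST k. ind_solved k) = 0 \<longleftrightarrow>
     (\<exists>p. (\<forall>i. 0 \<le> p i) \<and> (\<Sum>i<n. p i) \<le> 1 \<and> (\<forall>x\<in>far f z. (\<Sum>i | i < n \<and> x ! i \<noteq> z ! i. p i) \<ge> (2/3 :: real)))"
    (is "?L = 0 \<longleftrightarrow> ?R")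
proof
  assume "?L = 0"
  moreover have "ind_solved ?L" using ind_solved_upper[OF frac_cert_ones] by (metis LeastI)
  ultimately have "ind_solved 0" by simp
  then obtain m U and out :: "nat \<Rightarrow> nat" where alg: "query_algorithm 4 (d + n) 0 m U"
    and out: "\<And>x b. x \<in> far f z \<Longrightarrow> b \<in> {star, dagger} \<Longrightarrow>
       output_prob (final_state 4 (d + n) m U (inp x b) 0) out (diff x) \<ge> 2/3"
    unfolding ind_solved_def by blast
  \<comment> \<open>No query has been made, so the state is the same for every input and the empty
    list can stand for it.\<close>
  let ?\<psi> = "final_state 4 (d + n) m U [] 0"
  define p where "p i = output_prob ?\<psi> out {i}" for i
  have p_sum: "(\<Sum>i\<in>I. p i) = output_prob ?\<psi> out I" if "finite I" for I
    unfolding p_def output_prob_sum[OF that] ..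
  have "(\<Sum>i<n. p i) \<le> 1"
    using output_prob_final_Compl[OF alg, of "[]" out "{..<n}"]
      output_prob_nonneg[of ?\<psi> out "- {..<n}"] by (simp add: p_sum del: final_state.simps)
  moreover have "(\<Sum>i | i < n \<and> x ! i \<noteq> z ! i. p i) \<ge> 2/3" if "x \<in> far f z" for x
    using out[OF that, of star] p_sum[OF finite_diff, of x] by (simp add: diff_def)
  moreover have "\<forall>i. 0 \<le> p i" by (simp add: p_def output_prob_nonneg)
  ultimately show ?R by blast
next
  assume ?R
  then obtain p where p: "\<And>i. 0 \<le> p i" "(\<Sum>i<n. p i) \<le> 1"
    "\<And>x. x \<in> far f z \<Longrightarrow> (\<Sum>i | i < n \<and> x ! i \<noteq> z ! i. p i) \<ge> (2/3 :: real)" by blast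
  let ?D = "qdim 4 (d + n) 1"
  have nD: "Suc n \<le> ?D" by (simp add: qdim_def)
  \<comment> \<open>The missing mass goes to \<open>n\<close>, which is never a valid index. The
    amplitudes \<open>sqrt (r i)\<close> then form a unit vector whose measured basis state is
    announced as the index.\<close>
  define r where "r i = (if i < n then p i else if i = n then 1 - (\<Sum>i<n. p i) else 0)" for i
  have r0: "r i \<ge> 0" for i using p(1,2) by (simp add: r_def)
  have "(\<Sum>i<?D. r i) = (\<Sum>i<Suc n. r i)"
    by (rule sum.mono_neutral_right) (use nD in \<open>auto simp: r_def\<close>)
  also have "\<dots> = 1" by (simp add: r_def)
  finally have "(\<Sum>i<?D. (cmod (complex_of_real (sqrt (r i))))\<^sup>2) = 1" using r0 by simp
  then have "reaches 4 (d + n) 1 0 (\<lambda>x i. complex_of_real (sqrt (r i)))"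
    by (rule reaches_init) simp
  then obtain U where alg: "query_algorithm 4 (d + n) 0 1 U"
    and U: "\<And>s j. s \<in> strings 4 (d + n) \<Longrightarrow> j < ?D \<Longrightarrow>
      final_state 4 (d + n) 1 U s 0 $ j = complex_of_real (sqrt (r j))"
    unfolding reaches_def by blast
  have "output_prob (final_state 4 (d + n) 1 U (inp x b) 0) (\<lambda>j. j) (diff x) \<ge> 2/3"
    if x: "x \<in> far f z" and b: "b \<in> {star, dagger}" for x b
  proof -
    have s: "inp x b \<in> strings 4 (d + n)" using x b by (intro inp_strings) auto
    have dim: "dim_vec (final_state 4 (d + n) 1 U (inp x b) 0) = ?D"
      by (rule dim_final_state[OF alg order_refl])
    have "output_prob (final_state 4 (d + n) 1 U (inp x b) 0) (\<lambda>j. j) (diff x)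
        = (\<Sum>j\<in>diff x. r j)"
      unfolding output_prob_def dim
    proof (intro sum.cong)
      show "{j. j < ?D \<and> j \<in> diff x} = diff x" using diff_subset nD by fastforce
      fix j assume "j \<in> diff x"
      then have "j < ?D" using diff_subset nD by fastforce
      then show "(cmod (final_state 4 (d + n) 1 U (inp x b) 0 $ j))\<^sup>2 = r j"
        using U[OF s] r0 by simp
    qed
    also have "\<dots> = (\<Sum>i | i < n \<and> x ! i \<noteq> z ! i. p i)"
      by (intro sum.cong) (auto simp: diff_def r_def)
    finally show ?thesis using p(3)[OF x] by simp
  qed
  then have "ind_solved 0" using alg unfolding ind_solved_def by blast
  then show "?L = 0" by (rule Least_eq_0)
qed

end

section \<open>The weak and the strong input model as instances\<close>

context pointed_function
begin

text \<open>The certification function is 1 at \<open>z\<close> only and 0 exactly on far inputs, so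
  \<open>z\<close> is always the second string of the sabotaged pair.\<close>

lemma sab_weak_cert: "sab_weak (cert_fun f z) b = (\<lambda>x. sab_string x z b) ` far f z"
  and sab_str_cert: "sab_str (cert_fun f z) b = (\<lambda>x. x @ z @ sab_string x z b) ` far f z"
proof -
  have "cert_fun f z x = Some False \<longleftrightarrow> x \<in> far f z" "cert_fun f z x = Some True \<longleftrightarrow> x = z" for x
    using z by (auto simp: cert_fun_def far_def)
  then show "sab_weak (cert_fun f z) b = (\<lambda>x. sab_string x z b) ` far f z"
    "sab_str (cert_fun f z) b = (\<lambda>x. x @ z @ sab_string x z b) ` far f z"
    unfolding sab_weak_def sab_str_def by auto
qed

sublocale weak: sabotage_input n f z 0 "\<lambda>_. []"
  by unfold_locales (auto simp: strings_def)

sublocale str: sabotage_input n f z "2 * n" "\<lambda>x. x @ z"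
proof unfold_locales
  fix x assume "x \<in> insert z (far f z)"
  then have "x @ z \<in> strings 2 (n + n)" using strings_append z_strings far_strings by blast
  then show "x @ z \<in> strings 4 (2 * n)" using strings_mono[of 2 4] by (auto simp: mult_2)
next
  fix x i assume x: "x \<in> far f z" and i: "i < 2 * n" and neq: "(x @ z) ! i \<noteq> (z @ z) ! i"
  have "length x = n" "length z = n"
    using far_strings[OF x] z_strings by (auto simp: strings_def)
  then show "x ! (i mod n) \<noteq> z ! (i mod n)" using neq by (auto simp: nth_append split: if_splits)
qed simp

lemma QS_weak_cert_bounds:
  "real (QS_weak n (cert_fun f z)) \<le> 40 * sqrt_frac_cert n f z"
  "sqrt_frac_cert n f z \<le> 24 * real (QS_weak n (cert_fun f z))"
  using weak.sabotage_decision_bounds[of "sab_weak (cert_fun f z)"]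
  by (simp_all add: QS_weak_def sab_weak_cert weak.inp_def)

lemma QS_str_cert_bounds:
  "real (QS_str n (cert_fun f z)) \<le> 40 * sqrt_frac_cert n f z"
  "sqrt_frac_cert n f z \<le> 24 * real (QS_str n (cert_fun f z))"
  using str.sabotage_decision_bounds[of "sab_str (cert_fun f z)"]
  by (simp_all add: QS_str_def sab_str_cert str.inp_def)

lemma QS_weak_ind_cert: "QS_weak_ind n (cert_fun f z) = (LEAST k. weak.ind_solved k)"
  using weak.Q_search_ind_eq[of "sab_weak (cert_fun f z)"]
  by (simp add: QS_weak_ind_def sab_weak_cert weak.inp_def)

lemma QS_str_ind_cert: "QS_str_ind n (cert_fun f z) = (LEAST k. str.ind_solved k)"
  using str.Q_search_ind_eq[of "sab_str (cert_fun f z)"]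
  by (simp add: QS_str_ind_def sab_str_cert str.inp_def)

lemma QS_weak_ind_cert_bounds:
  "real (QS_weak_ind n (cert_fun f z)) \<le> 40 * sqrt_frac_cert n f z"
  "sqrt_frac_cert n f z \<le> 25 * max 1 (real (QS_weak_ind n (cert_fun f z)))"
  unfolding QS_weak_ind_cert by - (fact weak.sabotage_ind_bounds)+

lemma QS_str_ind_cert_bounds:
  "real (QS_str_ind n (cert_fun f z)) \<le> 40 * sqrt_frac_cert n f z"
  "sqrt_frac_cert n f z \<le> 25 * max 1 (real (QS_str_ind n (cert_fun f z)))"
  unfolding QS_str_ind_cert by - (fact str.sabotage_ind_bounds)+

text \<open>Both sides are characterized by the same condition, in which neither \<open>d\<close>
  nor \<open>pre\<close> occurs. It allows the two index variants to be compared without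
  \<open>max 1\<close>.\<close>

lemma QS_ind_0_iff: "QS_weak_ind n (cert_fun f z) = 0 \<longleftrightarrow> QS_str_ind n (cert_fun f z) = 0"
  unfolding QS_weak_ind_cert QS_str_ind_cert weak.ind_solved_0_iff str.ind_solved_0_iff ..

end

section \<open>Maxima over the domain\<close>

text \<open>Real-valued counterpart of the maxima in \<open>cert\<close> and \<open>QC\<close>,
  which include 0 for the empty domain.\<close>

definition max0 :: "('a \<Rightarrow> real) \<Rightarrow> 'a set \<Rightarrow> real" where
  "max0 a D = Max (insert 0 (a ` D))"

lemma max0_nonneg: "finite D \<Longrightarrow> 0 \<le> max0 a D"
  by (simp add: max0_def)

lemma max0_ge: "finite D \<Longrightarrow> x \<in> D \<Longrightarrow> a x \<le> max0 a D"
  by (simp add: max0_def)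

lemma max0_le: "finite D \<Longrightarrow> 0 \<le> c \<Longrightarrow> (\<And>x. x \<in> D \<Longrightarrow> a x \<le> c) \<Longrightarrow> max0 a D \<le> c"
  by (auto simp: max0_def)

lemma real_Max_insert_0: "finite D \<Longrightarrow> real (Max (insert 0 (a ` D))) = max0 (\<lambda>x. real (a x)) D"
  unfolding max0_def
  by (subst mono_Max_commute) (auto simp: mono_def image_image)

lemma max0_mono:
  assumes "finite D" "0 \<le> c" "\<And>x. x \<in> D \<Longrightarrow> a x \<le> c * b x"
  shows "max0 a D \<le> c * max0 b D"
proof (rule max0_le)
  fix x assume "x \<in> D"
  then show "a x \<le> c * max0 b D"
    using assms by (meson max0_ge mult_left_mono order_trans)
qed (use assms max0_nonneg[of D b] in auto)

lemma max0_mono_max_1: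
  assumes "finite D" "0 \<le> c" "\<And>x. x \<in> D \<Longrightarrow> a x \<le> c * max 1 (b x)"
  shows "max0 a D \<le> c * max 1 (max0 b D)"
proof (rule max0_le)
  fix x assume x: "x \<in> D"
  have "c * max 1 (b x) \<le> c * max 1 (max0 b D)"
    using assms max0_ge[OF assms(1) x, of b] by (intro mult_left_mono) auto
  then show "a x \<le> c * max 1 (max0 b D)" using assms(3)[OF x] by linarith
qed (use assms in auto)

lemma max0_eq_0_iff:
  assumes "finite D" "\<And>x. x \<in> D \<Longrightarrow> 0 \<le> a x"
  shows "max0 a D = 0 \<longleftrightarrow> (\<forall>x\<in>D. a x = 0)"
proof
  assume "max0 a D = 0"
  then show "\<forall>x\<in>D. a x = 0" using assms max0_ge by (metis order_antisym)
next
  assume "\<forall>x\<in>D. a x = 0"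
  then show "max0 a D = 0"
    using assms max0_le[of D 0 a] max0_nonneg[of D a] by (metis order_antisym order_refl)
qed

theorem theorem4:
  shows "\<exists>C::real. C > 0 \<and> (\<forall>n f. partial_boolean n f \<longrightarrow>
    (let Ms = {real (QC n f), real (cert (Q 2 n) f), real (cert (QD n) f), cert (MM n) f,
               real (cert (QS_weak n) f), real (cert (QS_str n) f)};
         Is = {real (cert (QS_weak_ind n) f), real (cert (QS_str_ind n) f)}
     in (\<forall>a\<in>Ms. \<forall>b\<in>Ms. a \<le> C * b) \<and>
        (\<forall>a\<in>Is. \<forall>b\<in>Ms \<union> Is. a \<le> C * b) \<and>
        (\<forall>a\<in>Ms. \<forall>b\<in>Is. a \<le> C * max 1 b)))"
proof (intro exI[of _ 1000] conjI allI impI)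
  fix n f assume f: "partial_boolean n f"
  let ?D = "dom f" and ?g = "cert_fun f"
  define R where "R = max0 (sqrt_frac_cert n f) ?D"
  define Ms where "Ms = {real (QC n f), real (cert (Q 2 n) f), real (cert (QD n) f), cert (MM n) f,
               real (cert (QS_weak n) f), real (cert (QS_str n) f)}"
  define Iw where "Iw = real (cert (QS_weak_ind n) f)"
  define Is where "Is = real (cert (QS_str_ind n) f)"
  have "finite (strings 2 n)"
    using finite_lists_length_eq[of "{..<2::nat}" n] by (simp add: strings_def conj_commute)
  then have fin: "finite ?D" using f finite_subset by (auto simp: partial_boolean_def)
  have point: "pointed_function n f z" if "z \<in> ?D" for z
    using f that by unfold_locales
  have bounds: "0 \<le> max0 a ?D \<and> max0 a ?D \<le> 40 * R \<and> R \<le> 24 * max0 a ?D"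
    if "\<And>z. z \<in> ?D \<Longrightarrow> a z \<le> 40 * sqrt_frac_cert n f z"
      "\<And>z. z \<in> ?D \<Longrightarrow> sqrt_frac_cert n f z \<le> 24 * a z" for a
    unfolding R_def using max0_mono[OF fin, of 40 a] max0_mono[OF fin, of 24 _ a] that
      max0_nonneg[OF fin] by auto
  have MM: "MM n (?g z) = sqrt_frac_cert n f z" if "z \<in> ?D" for z
    using pointed_function.MM_cert_bounds[OF point[OF that]] by (rule order_antisym)
  have "cert (MM n) f = R"
    unfolding cert_def R_def max0_def by (intro arg_cong[of _ _ "\<lambda>A. Max (insert 0 A)"] image_cong refl MM)
  moreover have "R \<ge> 0" unfolding R_def by (rule max0_nonneg[OF fin])
  ultimately have "0 \<le> cert (MM n) f \<and> cert (MM n) f \<le> 40 * R \<and> R \<le> 24 * cert (MM n) f" by simp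
  then have Ms: "0 \<le> a \<and> a \<le> 40 * R \<and> R \<le> 24 * a" if "a \<in> Ms" for a
    using that unfolding Ms_def QC_def cert_def[of "Q 2 n"] cert_def[of "QD n"]
      cert_def[of "QS_weak n"] cert_def[of "QS_str n"] real_Max_insert_0[OF fin]
    using bounds[OF pointed_function.QC_at_bounds[OF point]]
      bounds[OF pointed_function.Q_cert_bounds[OF point]]
      bounds[OF pointed_function.QD_cert_bounds[OF point]]
      bounds[OF pointed_function.QS_weak_cert_bounds[OF point]]
      bounds[OF pointed_function.QS_str_cert_bounds[OF point]]
    by blast
  have Iw: "Iw = max0 (\<lambda>z. real (QS_weak_ind n (?g z))) ?D"
    and Is: "Is = max0 (\<lambda>z. real (QS_str_ind n (?g z))) ?D"
    unfolding Iw_def Is_def cert_def real_Max_insert_0[OF fin] by simp_all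
  have Iw_bounds: "Iw \<le> 40 * R" "R \<le> 25 * max 1 Iw"
    unfolding Iw R_def
    using pointed_function.QS_weak_ind_cert_bounds[OF point]
    by (intro max0_mono[OF fin] max0_mono_max_1[OF fin]; simp)+
  have Is_bounds: "Is \<le> 40 * R" "R \<le> 25 * max 1 Is"
    unfolding Is R_def
    using pointed_function.QS_str_ind_cert_bounds[OF point]
    by (intro max0_mono[OF fin] max0_mono_max_1[OF fin]; simp)+
  have zero: "Iw = 0 \<longleftrightarrow> Is = 0"
    unfolding Iw Is using pointed_function.QS_ind_0_iff[OF point]
    by (simp add: max0_eq_0_iff[OF fin])
  have nat: "Iw = 0 \<or> Iw \<ge> 1" "Is = 0 \<or> Is \<ge> 1"
    unfolding Iw_def Is_def by (auto simp: Suc_le_eq)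
  \<comment> \<open>All comparisons pass through \<open>R\<close>: the factor is at most
    \<open>40 * 24\<close> here and \<open>40 * 25\<close> between index variants, whence
    1000.\<close>
  have 1: "a \<le> 1000 * b" if "a \<in> Ms" "b \<in> Ms" for a b
    using Ms[OF that(1)] Ms[OF that(2)] by linarith
  have 2: "a \<le> 1000 * b" if "a \<in> {Iw, Is}" "b \<in> Ms" for a b
    using Iw_bounds(1) Is_bounds(1) Ms[OF that(2)] that(1) by auto
  have 3: "a \<le> 1000 * b" if "a \<in> {Iw, Is}" "b \<in> {Iw, Is}" for a b
  \<comment> \<open>Index variants are natural numbers, so a nonzero one equals its maximum with 1,
    while for \<open>b = 0\<close> both vanish together by \<open>zero\<close>.\<close>
  proof (cases "b = 0")
    case True
    then have "a = 0" using that zero by auto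
    then show ?thesis using True by simp
  next
    case False
    then have "b \<ge> 1" using that(2) nat by auto
    moreover have "R \<le> 25 * max 1 b" "a \<le> 40 * R" using that Iw_bounds Is_bounds by auto
    ultimately show ?thesis by (simp add: max_def split: if_splits)
  qed
  have 4: "a \<le> 1000 * max 1 b" if "a \<in> Ms" "b \<in> {Iw, Is}" for a b
    using Ms[OF that(1)] that(2) Iw_bounds(2) Is_bounds(2) by auto
  show "let Ms = {real (QC n f), real (cert (Q 2 n) f), real (cert (QD n) f), cert (MM n) f,
               real (cert (QS_weak n) f), real (cert (QS_str n) f)};
         Is = {real (cert (QS_weak_ind n) f), real (cert (QS_str_ind n) f)}
     in (\<forall>a\<in>Ms. \<forall>b\<in>Ms. a \<le> 1000 * b) \<and>
        (\<forall>a\<in>Is. \<forall>b\<in>Ms \<union> Is. a \<le> 1000 * b) \<and>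
        (\<forall>a\<in>Ms. \<forall>b\<in>Is. a \<le> 1000 * max 1 b)"
    unfolding Let_def Ms_def[symmetric] Iw_def[symmetric] Is_def[symmetric]
    using 1 2 3 4 by blast
qed simp

end
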